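(* Let $\hat\Phi^*$ be the pullback by a quantum thick morphism $\Phi$ from $M_1$ to $M_2$ with quantum generating function $S_\hbar(x,q)=S^0_\hbar(x)+\varphi^i_\hbar(x)q_i+S^{ij}_\hbar(x)q_iq_j+\cdots$ in local coordinates, so that for $g\in C^\infty(M_2)$ $$(\hat\Phi^*e^{\frac i\hbar g})(x)=\int dy\,\frac{dq}{(2\pi\hbar)^{d}}\;e^{\frac i\hbar\left(S_\hbar(x,q)-y^\alpha q_\alpha\right)}e^{\frac i\hbar g(y)},\qquad d=\dim M_2 .$$ Then $$(\hat\Phi^*e^{\frac i\hbar g})(x)=\exp\left(\frac i\hbar\sum_{\gamma\in[\Gamma^\circ]}\frac{1}{|\mathrm{sym}(\gamma)|}\left(\frac\hbar i\right)^{b_\gamma}\langle S_\hbar,g;\gamma\rangle(x)\right)=\sum_{\gamma\in[\overline\Gamma^\circ]}\frac{1}{|\mathrm{sym}(\gamma)|}\left(\frac\hbar i\right)^{|E_\gamma|-|\gamma|}\langle S_\hbar,g;\gamma\rangle(x).$$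
   Context: Manifolds are ordinary (non-super) and the formulas are in local coordinates $x$ on $M_1$, $y$ on $M_2$, with momenta $p,q$. A quantum generating function is a formal power series in $q$ whose coefficients are smooth in $x$ and formal power series in $\hbar$, symmetric in their indices; a quantum thick morphism is a collection of such functions in each coordinate system and is identified with its pullback action above. Repeated indices are summed. $S_\hbar^{a_1\dots a_m}(x)$ is the coefficient of $q_{a_1}\cdots q_{a_m}$ ($S^i_\hbar=\varphi^i_\hbar$; no indices: $S^0_\hbar$); $\varphi_\hbar(x)=(\varphi^i_\hbar(x))$. The integral is formal: $e^{\frac i\hbar S_\hbar^+(x,q)}$, where $S_\hbar^+$ is the part of $S_\hbar$ of order $\ge2$ in $q$, is expanded in powers of $q$ and each term is evaluated by Fourier inversion, $\int dy\frac{dq}{(2\pi\hbar)^d}e^{\frac i\hbar(c^\alpha-y^\alpha)q_\alpha}q_{a_1}\cdots q_{a_m}f(y)=(\hbar/i)^m\partial_{a_1}\cdots\partial_{a_m}f(c)$ with $c=\varphi_\hbar(x)$; functions at $\varphi_\hbar(x)$ are Taylor expanded in $\hbar$ about the $\hbar^0$ term. Equalities are of formal series, compared degree by degree, where $S_\hbar^{a_1\dots a_m}$ with $m\ge2$ has degree $m$. A bipartite graph is $\gamma=(B_\gamma,W_\gamma,E_\gamma)$ with black vertices $B_\gamma=\{1,\dots,n\}$, white vertices $W_\gamma=\{-1,\dots,-m\}$ and a finite multiset $E_\gamma$ of elements of $B_\gamma\times W_\gamma$ (edges; parallel edges are allowed but not distinguished). $|\gamma|$ is the number of vertices, $b_\gamma:=|E_\gamma|-|\gamma|+1$.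 An isomorphism is a pair of permutations of the black and white vertices preserving edge multiplicities; $\mathrm{sym}(\gamma)$ is the automorphism group (permutations of parallel edges not counted). $\overline\Gamma^\circ$ is the set of all bipartite graphs (possibly disconnected, and including the empty graph, whose term is $1$) whose leaves (vertices attached to exactly one edge) are all white; $\Gamma^\circ\subset\overline\Gamma^\circ$ is the set of nonempty connected ones, including the one-vertex graphs $\bullet$ and $\circ$. Brackets $[\cdot]$ denote isomorphism classes. For a vertex $v$ let $e^v_1,\dots,e^v_{m_v}$ be the edges attached to it, and for black $v$ let $k^v_i$ be the number of white vertices with which $v$ shares exactly $i$ edges. Using edges as dummy summation indices, $$\langle S_\hbar,g;\gamma\rangle(x):=\Big(\prod_{v\in B_\gamma}\frac{m_v!}{(1!)^{k^v_1}(2!)^{k^v_2}\cdots(m_v!)^{k^v_{m_v}}}S_\hbar^{e^v_1\dots e^v_{m_v}}(x)\Big)\Big(\prod_{w\in W_\gamma}\frac{\partial}{\partial y^{e^w_1}}\cdots\frac{\partial}{\partial y^{e^w_{m_w}}}g(\varphi_\hbar(x))\Big).$$ *)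

theory Defs
  imports "HOL-Analysis.Analysis" "HOL-Combinatorics.Permutations"
begin

text \<open>
  Conventions.  A formal series in the Planck constant is a \<^typ>\<open>complex fps\<close>.  The explicit
  Planck constants (in \<open>\<i>/h\<close>, \<open>h/\<i>\<close>) make \<open>exp (\<i> g / h)\<close> an honest oscillating function, and
  the sum over disconnected graphs contains arbitrarily high powers of \<open>1/h\<close> (from isolated
  vertices), which cannot be summed inside Laurent series.  Hence \<open>h\<close> is an arbitrary nonzero
  number, and the order of the formal expansion of the coefficients is recorded by a formal
  variable \<open>\<epsilon>\<close>: the series \<open>\<Sum>k. a k * h^k\<close> is represented by \<open>\<Sum>k. a k * h^k * \<epsilon>^k\<close>.
  A second formal variable \<open>t\<close> records the degree: a coefficient with \<open>m \<ge> 2\<close> indices carries \<open>t^m\<close>.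
  Everything therefore takes values in \<open>\<complex>[[\<epsilon>]][[t]]\<close> (the outer variable being \<open>t\<close>), for each
  nonzero value of \<open>h\<close>.
\<close>

type_synonym formal = "complex fps fps"

definition cst :: "complex \<Rightarrow> formal" where
  "cst z = fps_const (fps_const z)"

text \<open>Infinite sums of formal series are taken coefficient by coefficient.\<close>

definition formal_summable :: "('i \<Rightarrow> formal) \<Rightarrow> 'i set \<Rightarrow> bool" where
  "formal_summable f A \<longleftrightarrow> (\<forall>D k. (\<lambda>i. fps_nth (fps_nth (f i) D) k) summable_on A)"

definition formal_sum :: "('i \<Rightarrow> formal) \<Rightarrow> 'i set \<Rightarrow> formal" where
  "formal_sum f A =
     Abs_fps (\<lambda>D. Abs_fps (\<lambda>k. \<Sum>\<^sub>\<infinity>i\<in>A. fps_nth (fps_nth (f i) D) k))"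

text \<open>The argument may have a nonzero constant term, so this is not a composition of power series.\<close>

definition formal_exp :: "formal \<Rightarrow> formal" where
  "formal_exp F = formal_sum (\<lambda>n::nat. cst (1 / fact n) * F ^ n) UNIV"


section \<open>Partial derivatives and Taylor expansion\<close>

definition partial :: "'d \<Rightarrow> (real ^ 'd \<Rightarrow> complex) \<Rightarrow> real ^ 'd \<Rightarrow> complex" where
  "partial a F y = frechet_derivative F (at y) (axis a 1)"

definition partials :: "'d list \<Rightarrow> (real ^ 'd \<Rightarrow> complex) \<Rightarrow> real ^ 'd \<Rightarrow> complex" where
  "partials as F = foldr partial as F"

text \<open>To be used for open sets.  Differentiability of all iterated partial derivatives
  includes their continuity.\<close>

definition smooth_on :: "(real ^ 'd) set \<Rightarrow> (real ^ 'd \<Rightarrow> complex) \<Rightarrow> bool" where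
  "smooth_on V F \<longleftrightarrow> (\<forall>as. partials as F differentiable_on V)"

text \<open>The value of \<open>F\<close> at a formal point \<open>c\<close>, Taylor expanded about the term of order zero
  (which is a real point).  The sum over lists of length \<open>n\<close> is the \<open>n\<close>-th Taylor term.\<close>

definition base_point :: "('d \<Rightarrow> formal) \<Rightarrow> real ^ 'd" where
  "base_point c = (\<chi> i. Re (fps_nth (fps_nth (c i) 0) 0))"

definition eval_at :: "(real ^ 'd \<Rightarrow> complex) \<Rightarrow> ('d::finite \<Rightarrow> formal) \<Rightarrow> formal" where
  "eval_at F c =
     formal_sum (\<lambda>as. cst (partials as F (base_point c) / fact (length as)) *
                      (\<Prod>a\<leftarrow>as. c a - cst (of_real (base_point c $ a)))) UNIV"


section \<open>Quantum generating functions and the pullback\<close>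

text \<open>\<open>S as x\<close> is the coefficient (a formal series in the Planck constant) of \<open>q\<^sub>a\<^sub>1 \<dots> q\<^sub>a\<^sub>m\<close>, where
  \<open>as = [a\<^sub>1, \<dots>, a\<^sub>m]\<close>.  \<open>U\<close> and \<open>V\<close> are the coordinate domains of source and target.  The
  coefficients may be complex (as happens for compositions of thick morphisms), but the
  order zero part of \<open>S [i]\<close> has to give a map from \<open>U\<close> to \<open>V\<close>.\<close>

type_synonym ('d, 'n) genfun = "'d list \<Rightarrow> real ^ 'n \<Rightarrow> complex fps"

definition quantum_generating_function ::
    "(real ^ 'n) set \<Rightarrow> (real ^ 'd) set \<Rightarrow> ('d::finite, 'n::finite) genfun \<Rightarrow> bool" where
  "quantum_generating_function U V S \<longleftrightarrow>
     open U \<and> open V \<and>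
     (\<forall>as bs. mset as = mset bs \<longrightarrow> (\<forall>x\<in>U. S as x = S bs x)) \<and>
     (\<forall>as k. smooth_on U (\<lambda>x. fps_nth (S as x) k)) \<and>
     (\<forall>x\<in>U. \<exists>y\<in>V. \<forall>i. fps_nth (S [i] x) 0 = of_real (y $ i))"

definition coef :: "complex \<Rightarrow> ('d, 'n) genfun \<Rightarrow> 'd list \<Rightarrow> real ^ 'n \<Rightarrow> formal" where
  "coef h S as x =
     (if length as \<ge> 2 then fps_X ^ length as else 1) *
     fps_const (Abs_fps (\<lambda>k. fps_nth (S as x) k * h ^ k))"

definition phi :: "complex \<Rightarrow> ('d, 'n) genfun \<Rightarrow> real ^ 'n \<Rightarrow> 'd \<Rightarrow> formal" where
  "phi h S x i = coef h S [i] x"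

text \<open>The integral of \<open>exp (\<i>/h * (c\<^sup>\<alpha> - y\<^sup>\<alpha>) q\<^sub>\<alpha>) * q\<^sub>a\<^sub>1 \<dots> q\<^sub>a\<^sub>m * f y\<close> over \<open>y\<close> and \<open>q\<close> (with respect
  to \<open>dy dq / (2\<pi>h)\<^sup>d\<close>), by Fourier inversion.\<close>

definition fourier_integral ::
    "complex \<Rightarrow> ('d::finite \<Rightarrow> formal) \<Rightarrow> 'd list \<Rightarrow> (real ^ 'd \<Rightarrow> complex) \<Rightarrow> formal" where
  "fourier_integral h c as f = cst ((h / \<i>) ^ length as) * eval_at (partials as f) c"

text \<open>The factor \<open>exp (\<i>/h * S\<^sup>0)\<close> is taken out of the integral, \<open>\<phi>\<^sup>i q\<^sub>i - y\<^sup>i q\<^sub>i\<close> is the exponent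
  in the Fourier inversion, and \<open>exp (\<i>/h * S\<^sup>+)\<close> is expanded: the \<open>n\<close>-th power of
  \<open>S\<^sup>+ = (\<Sum>as | length as \<ge> 2. S as * q as)\<close> is a sum over lists \<open>ass\<close> of \<open>n\<close> index lists.\<close>

definition quantum_pullback ::
    "complex \<Rightarrow> ('d::finite, 'n) genfun \<Rightarrow> (real ^ 'd \<Rightarrow> complex) \<Rightarrow> real ^ 'n \<Rightarrow> formal" where
  "quantum_pullback h S f x =
     formal_exp (cst (\<i> / h) * coef h S [] x) *
     formal_sum
       (\<lambda>ass. cst ((\<i> / h) ^ length ass / fact (length ass)) *
              (\<Prod>as\<leftarrow>ass. coef h S as x) *
              fourier_integral h (phi h S x) (concat ass) f)
       {ass. \<forall>as\<in>set ass. length as \<ge> 2}"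


section \<open>Bipartite graphs\<close>

datatype bgraph = BGraph (num_black: nat) (num_white: nat) (edges: "(int \<times> int) multiset")

definition blacks :: "bgraph \<Rightarrow> int set" where
  "blacks \<gamma> = {1..int (num_black \<gamma>)}"

definition whites :: "bgraph \<Rightarrow> int set" where
  "whites \<gamma> = {- int (num_white \<gamma>)..-1}"

definition verts :: "bgraph \<Rightarrow> int set" where
  "verts \<gamma> = blacks \<gamma> \<union> whites \<gamma>"

definition bipartite :: "bgraph \<Rightarrow> bool" where
  "bipartite \<gamma> \<longleftrightarrow> set_mset (edges \<gamma>) \<subseteq> blacks \<gamma> \<times> whites \<gamma>"

definition attached :: "int \<Rightarrow> int \<times> int \<Rightarrow> bool" where
  "attached v e \<longleftrightarrow> fst e = v \<or> snd e = v"

definition valence :: "bgraph \<Rightarrow> int \<Rightarrow> nat" where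
  "valence \<gamma> v = size (filter_mset (attached v) (edges \<gamma>))"

definition adjacent :: "bgraph \<Rightarrow> (int \<times> int) set" where
  "adjacent \<gamma> = set_mset (edges \<gamma>) \<union> (set_mset (edges \<gamma>))\<inverse>"

definition connected_graph :: "bgraph \<Rightarrow> bool" where
  "connected_graph \<gamma> \<longleftrightarrow>
     verts \<gamma> \<noteq> {} \<and> (\<forall>u\<in>verts \<gamma>. \<forall>v\<in>verts \<gamma>. (u, v) \<in> (adjacent \<gamma>)\<^sup>*)"

definition all_graphs :: "bgraph set" where
  "all_graphs = {\<gamma>. bipartite \<gamma> \<and> (\<forall>v\<in>verts \<gamma>. valence \<gamma> v = 1 \<longrightarrow> v \<in> whites \<gamma>)}"

definition connected_graphs :: "bgraph set" where
  "connected_graphs = {\<gamma> \<in> all_graphs. connected_graph \<gamma>}"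

text \<open>Pairs of permutations of the black and of the white vertices; parallel edges are not
  permuted.\<close>

definition isos :: "bgraph \<Rightarrow> bgraph \<Rightarrow> ((int \<Rightarrow> int) \<times> (int \<Rightarrow> int)) set" where
  "isos \<gamma> \<gamma>' = {(\<sigma>, \<tau>). blacks \<gamma> = blacks \<gamma>' \<and> whites \<gamma> = whites \<gamma>' \<and>
     \<sigma> permutes blacks \<gamma> \<and> \<tau> permutes whites \<gamma> \<and>
     image_mset (map_prod \<sigma> \<tau>) (edges \<gamma>) = edges \<gamma>'}"

definition graph_iso :: "(bgraph \<times> bgraph) set" where
  "graph_iso = {(\<gamma>, \<gamma>'). bipartite \<gamma> \<and> bipartite \<gamma>' \<and> isos \<gamma> \<gamma>' \<noteq> {}}"

definition sym_group :: "bgraph \<Rightarrow> ((int \<Rightarrow> int) \<times> (int \<Rightarrow> int)) set" where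
  "sym_group \<gamma> = isos \<gamma> \<gamma>"

definition euler_exponent :: "bgraph \<Rightarrow> int" where
  "euler_exponent \<gamma> = int (size (edges \<gamma>)) - int (card (verts \<gamma>))"

definition betti :: "bgraph \<Rightarrow> int" where
  "betti \<gamma> = int (size (edges \<gamma>)) - int (card (verts \<gamma>)) + 1"


section \<open>Evaluation of graphs\<close>

definition num_nbrs :: "bgraph \<Rightarrow> int \<Rightarrow> nat \<Rightarrow> nat" where
  "num_nbrs \<gamma> v i = card {w \<in> whites \<gamma>. count (edges \<gamma>) (v, w) = i}"

definition vertex_factor :: "bgraph \<Rightarrow> int \<Rightarrow> complex" where
  "vertex_factor \<gamma> v =
     fact (valence \<gamma> v) / (\<Prod>i = 1..valence \<gamma> v. fact i ^ num_nbrs \<gamma> v i)"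

text \<open>An arbitrary enumeration of the edges; the symmetry of the coefficients and of the
  partial derivatives makes its choice irrelevant.\<close>

definition edge_list :: "bgraph \<Rightarrow> (int \<times> int) list" where
  "edge_list \<gamma> = (SOME es. mset es = edges \<gamma>)"

definition indices_at :: "bgraph \<Rightarrow> 'd list \<Rightarrow> int \<Rightarrow> 'd list" where
  "indices_at \<gamma> as v =
     map snd (filter (\<lambda>(e, a). attached v e) (zip (edge_list \<gamma>) as))"

text \<open>The outer sum is the summation over the dummy indices: \<open>as\<close> assigns an index to each edge.\<close>

definition graph_value ::
    "complex \<Rightarrow> ('d::finite, 'n) genfun \<Rightarrow> (real ^ 'd \<Rightarrow> complex) \<Rightarrow> bgraph \<Rightarrow> real ^ 'n \<Rightarrow> formal"
  where
  "graph_value h S g \<gamma> x =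
     (\<Sum>as | length as = size (edges \<gamma>).
        (\<Prod>v\<in>blacks \<gamma>. cst (vertex_factor \<gamma> v) * coef h S (indices_at \<gamma> as v) x) *
        (\<Prod>w\<in>whites \<gamma>. eval_at (partials (indices_at \<gamma> as w) g) (phi h S x)))"

text \<open>A representative of an isomorphism class.\<close>

definition rep :: "bgraph set \<Rightarrow> bgraph" where
  "rep C = (SOME \<gamma>. \<gamma> \<in> C)"

definition connected_term ::
    "complex \<Rightarrow> ('d::finite, 'n) genfun \<Rightarrow> (real ^ 'd \<Rightarrow> complex) \<Rightarrow> real ^ 'n \<Rightarrow> bgraph \<Rightarrow> formal"
  where
  "connected_term h S g x \<gamma> =
     cst (1 / of_nat (card (sym_group \<gamma>)) * (h / \<i>) powi betti \<gamma>) * graph_value h S g \<gamma> x"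

definition graph_term ::
    "complex \<Rightarrow> ('d::finite, 'n) genfun \<Rightarrow> (real ^ 'd \<Rightarrow> complex) \<Rightarrow> real ^ 'n \<Rightarrow> bgraph \<Rightarrow> formal"
  where
  "graph_term h S g x \<gamma> =
     cst (1 / of_nat (card (sym_group \<gamma>)) * (h / \<i>) powi euler_exponent \<gamma>) * graph_value h S g \<gamma> x"

end

theory Submission
  imports Defs
begin

text \<open>
  Write \<open>u = \<i>/h\<close>.  Taylor expansion at a formal point is multiplicative, so
  \<open>exp (u g) = (\<Sum>m. u^m g^m / m!)\<close> and the Leibniz rule for \<open>g^m\<close> turn the expanded integral into a
  sum over configurations: finitely many index lists (black vertices, weighted by \<open>1/n!\<close>), a number
  \<open>m\<close> of factors of \<open>g\<close> (white vertices, weighted by \<open>1/m!\<close>), and a map from the indices to the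
  factors.  The factor \<open>exp (u S\<^sup>0)\<close> inserts empty lists.  Forgetting the order of the indices in each
  list leaves a labelled bipartite graph, and the number of configurations over it is the product of
  the multinomial coefficients in its value; this also settles all questions of convergence, since
  configurations with a bounded number of indices grow polynomially in \<open>n\<close> and \<open>m\<close>.  By
  orbit-stabilizer, the sum over labelled graphs is the sum over isomorphism classes.

  For the exponential, let \<open>W k\<close> be the sum over the labelled graphs with \<open>k\<close> components.  Splitting off
  a chosen component gives \<open>k W k = W 1 * W (k - 1)\<close>, so \<open>W k = (W 1)^k / k!\<close>.
\<close>

section \<open>Sums of formal series\<close>

text \<open>As \<open>h\<close> is a number, isolated vertices make every coefficient a genuinely
  infinite series (it contains the exponentials of u S^0 and u g), so finite truncations cannot be
  compared. Instead a single absolutely summable family, indexed by configurations, is regrouped in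
  two ways: by graph, and by the shape of the expanded integral. The convergence of every piece,
  including the two exponential series, is inherited from this family. In t-degree D only
  configurations with at most D indices survive, because an index list of length l \<ge> 2 carries
  t^l. Lists of length 1 do not occur: the linear coefficient \<phi> is absorbed into the point at
  which g is evaluated, and this is why black leaves are excluded. Each vertex carries one factor u,
  from expanding an exponential, and each edge one factor 1/u, from Fourier inversion. This gives
  the exponent |E| - |\<gamma>|. In the connected sum one factor u is pulled out of the sum, which
  raises the exponent by one to the Betti number.\<close>

definition cf :: "nat \<Rightarrow> nat \<Rightarrow> formal \<Rightarrow> complex" where
  "cf D k F = fps_nth (fps_nth F D) k"

text \<open>\<open>D\<close> is the exponent of \<open>t\<close> and \<open>k\<close> that of
  \<epsilon>. Convergence is unconditional in each complex coefficient, hence absolute, so families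
  may be regrouped freely.\<close>

definition has_formal_sum :: "('i \<Rightarrow> formal) \<Rightarrow> formal \<Rightarrow> 'i set \<Rightarrow> bool" where
  "has_formal_sum f s A \<longleftrightarrow> (\<forall>D k. ((\<lambda>i. cf D k (f i)) has_sum cf D k s) A)"

lemma formal_eqI: "(\<And>D k. cf D k F = cf D k G) \<Longrightarrow> F = G"
  unfolding cf_def by (intro fps_ext) auto

lemma cf_add: "cf D k (F + G) = cf D k F + cf D k G"
  and cf_0 [simp]: "cf D k 0 = 0"
  by (simp_all add: cf_def)

lemma cf_sum: "cf D k (\<Sum>i\<in>I. F i) = (\<Sum>i\<in>I. cf D k (F i))"
  by (simp add: cf_def fps_sum_nth)

lemma cf_cst_mult [simp]: "cf D k (cst z * F) = z * cf D k F"
  by (simp add: cf_def cst_def)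

lemma cf_mult: "cf D k (F * G) = (\<Sum>i=0..D. \<Sum>j=0..k. cf i j F * cf (D - i) (k - j) G)"
  by (simp add: cf_def fps_mult_nth fps_sum_nth)

lemma cst_mult: "cst (a * b) = cst a * cst b"
  and cst_1 [simp]: "cst 1 = 1"
  and cst_0 [simp]: "cst 0 = 0"
  and cst_add: "cst (a + b) = cst a + cst b"
  by (simp_all add: cst_def)

lemma cst_power: "cst (a ^ n) = cst a ^ n"
  by (induction n) (simp_all add: cst_mult)

lemma cst_prod: "cst (\<Prod>i\<in>I. a i) = (\<Prod>i\<in>I. cst (a i))"
  by (induction I rule: infinite_finite_induct) (simp_all add: cst_mult)

lemma cst_of_nat: "cst (of_nat n) = of_nat n"
  by (induction n) (simp_all add: cst_add)

lemma cst_mult_assoc: "cst a * (cst b * F) = cst (a * b) * F"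
  by (simp add: cst_mult mult.assoc)

lemma has_formal_sum_imp: 
  assumes "has_formal_sum f s A"
  shows "formal_summable f A" "formal_sum f A = s"
proof -
  have *: "((\<lambda>i. fps_nth (fps_nth (f i) D) k) has_sum fps_nth (fps_nth s D) k) A" for D k
    using assms by (simp add: has_formal_sum_def cf_def)
  show "formal_summable f A"
    unfolding formal_summable_def using * has_sum_imp_summable by blast
  show "formal_sum f A = s"
    unfolding formal_sum_def by (intro fps_ext) (simp add: infsumI[OF *])
qed

lemma formal_summable_imp: "formal_summable f A \<Longrightarrow> has_formal_sum f (formal_sum f A) A"
  unfolding formal_summable_def has_formal_sum_def formal_sum_def cf_def by simp

lemma has_formal_sum_unique: "has_formal_sum f s A \<Longrightarrow> has_formal_sum f s' A \<Longrightarrow> s = s'"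
  using has_formal_sum_imp(2) by blast

lemma formal_summable_subset:
  "formal_summable f A \<Longrightarrow> B \<subseteq> A \<Longrightarrow> formal_summable f B"
  unfolding formal_summable_def using summable_on_subset_banach by blast

lemma has_formal_sum_finite: "finite A \<Longrightarrow> has_formal_sum f (sum f A) A"
  unfolding has_formal_sum_def by (simp add: cf_sum)

lemma has_sum_sum:
  fixes f :: "'i \<Rightarrow> 'a \<Rightarrow> 'b :: {topological_comm_monoid_add}"
  assumes "\<And>i. i \<in> I \<Longrightarrow> (f i has_sum s i) A"
  shows "((\<lambda>x. \<Sum>i\<in>I. f i x) has_sum (\<Sum>i\<in>I. s i)) A"
  using assms by (induction I rule: infinite_finite_induct) (auto intro!: has_sum_add)

lemma summable_on_sum:
  fixes f :: "'i \<Rightarrow> 'a \<Rightarrow> 'b :: {topological_comm_monoid_add, t2_space}"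
  assumes "\<And>i. i \<in> I \<Longrightarrow> f i summable_on A"
  shows "(\<lambda>x. \<Sum>i\<in>I. f i x) summable_on A"
  by (rule has_sum_imp_summable[OF has_sum_sum]) (rule has_sum_infsum[OF assms])

lemma has_formal_sum_mult:
  assumes "has_formal_sum f s A"
  shows "has_formal_sum (\<lambda>x. c * f x) (c * s) A"
  unfolding has_formal_sum_def cf_mult
  by (intro allI has_sum_sum has_sum_cmult_right) (use assms in \<open>simp add: has_formal_sum_def\<close>)

lemma has_formal_sum_reindex:
  "bij_betw g A B \<Longrightarrow> has_formal_sum (\<lambda>x. f (g x)) s A \<longleftrightarrow> has_formal_sum f s B"
  unfolding has_formal_sum_def
  by (intro iff_allI has_sum_reindex_bij_betw[where f = "\<lambda>i. cf _ _ (f i)"])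

lemma formal_summable_reindex:
  "bij_betw g A B \<Longrightarrow> formal_summable (\<lambda>x. f (g x)) A \<longleftrightarrow> formal_summable f B"
  by (metis formal_summable_imp has_formal_sum_imp(1) has_formal_sum_reindex)

lemma has_formal_sum_SigmaD:
  assumes "has_formal_sum f s (Sigma A B)"
    and "\<And>a. a \<in> A \<Longrightarrow> has_formal_sum (\<lambda>b. f (a, b)) (g a) (B a)"
  shows "has_formal_sum g s A"
  unfolding has_formal_sum_def
proof (intro allI)
  fix D k
  show "((\<lambda>a. cf D k (g a)) has_sum cf D k s) A"
    by (rule has_sum_SigmaD[where f = "\<lambda>p. cf D k (f p)" and B = B])
       (use assms in \<open>auto simp: has_formal_sum_def\<close>)
qed

text \<open>Convergent iterated sums do not imply summability over the pairs, so the latter is a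
  separate hypothesis; once it holds, the total must be the iterated value.\<close>

lemma has_formal_sum_SigmaI:
  assumes "\<And>a. a \<in> A \<Longrightarrow> has_formal_sum (\<lambda>b. f (a, b)) (g a) (B a)"
    and "has_formal_sum g s A"
    and "formal_summable f (Sigma A B)"
  shows "has_formal_sum f s (Sigma A B)"
  using has_formal_sum_SigmaD[OF formal_summable_imp[OF assms(3)] assms(1)] assms(2,3)
  by (metis formal_summable_imp has_formal_sum_unique)

lemma bij_betw_graph_of: "h ` A \<subseteq> B \<Longrightarrow> bij_betw (\<lambda>a. (h a, a)) A (Sigma B (\<lambda>b. {a \<in> A. h a = b}))"
  by (rule bij_betwI[where g = snd]) auto

text \<open>The regrouping used throughout: by number of components, by isomorphism class, by
  underlying graph and by the shape of a configuration.\<close>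

lemma has_formal_sum_group:
  assumes "has_formal_sum f s A" and "h ` A \<subseteq> B"
    and "\<And>b. b \<in> B \<Longrightarrow> has_formal_sum f (g b) {a \<in> A. h a = b}"
  shows "has_formal_sum g s B"
proof -
  have "has_formal_sum (\<lambda>p. f (snd p)) s (Sigma B (\<lambda>b. {a \<in> A. h a = b}))"
    using has_formal_sum_reindex[OF bij_betw_graph_of[OF assms(2)], of "\<lambda>p. f (snd p)" s] assms(1)
    by simp
  then show ?thesis
    by (rule has_formal_sum_SigmaD) (use assms(3) in simp)
qed

section \<open>Products of summable families and equal sharing of terms\<close>

lemma summable_on_iff_norm:
  fixes f :: "'a \<Rightarrow> complex"
  shows "f summable_on A \<longleftrightarrow> (\<lambda>x. norm (f x)) summable_on A"
  by (rule summable_on_iff_abs_summable_on_complex)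

lemma summable_on_product_complex:
  fixes f :: "'a \<Rightarrow> complex" and g :: "'b \<Rightarrow> complex"
  assumes "f summable_on A" "g summable_on B"
  shows "(\<lambda>p. f (fst p) * g (snd p)) summable_on (A \<times> B)"
proof -
  have f: "(\<lambda>x. norm (f x)) summable_on A" and g: "(\<lambda>x. norm (g x)) summable_on B"
    using assms summable_on_iff_norm by blast+
  have "(\<lambda>p. norm (f (fst p) * g (snd p))) summable_on (A \<times> B)"
  proof (rule summable_on_SigmaI)
    show "((\<lambda>y. norm (f (fst (x, y)) * g (snd (x, y)))) has_sum (norm (f x) * infsum (\<lambda>y. norm (g y)) B)) B" for x
      unfolding fst_conv snd_conv norm_mult by (intro has_sum_cmult_right has_sum_infsum g)
  qed (auto intro: summable_on_cmult_left f)
  then show ?thesis using summable_on_iff_norm by blast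
qed

text \<open>A coefficient of a product is a finite convolution of coefficients, and each of its
  terms is a product of two absolutely summable complex families.\<close>

lemma has_formal_sum_Times:
  assumes "has_formal_sum f s A" and "has_formal_sum g t B"
  shows "has_formal_sum (\<lambda>(a, b). f a * g b) (s * t) (A \<times> B)"
proof (rule has_formal_sum_SigmaI)
  show "has_formal_sum (\<lambda>b. case (a, b) of (a, b) \<Rightarrow> f a * g b) (f a * t) B" for a
    using has_formal_sum_mult[OF assms(2)] by simp
  show "has_formal_sum (\<lambda>a. f a * t) (s * t) A"
    using has_formal_sum_mult[OF assms(1), of t] by (simp add: mult.commute)
  have "(\<lambda>i. cf D k (f i)) summable_on A" "(\<lambda>i. cf D k (g i)) summable_on B" for D k
    using assms has_sum_imp_summable unfolding has_formal_sum_def by blast+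
  note sm = summable_on_product_complex[OF this]
  show "formal_summable (\<lambda>(a, b). f a * g b) (A \<times> B)"
    unfolding formal_summable_def cf_def[symmetric] case_prod_unfold cf_mult
    by (intro allI summable_on_sum sm)
qed

text \<open>Each value \<open>g a\<close> is handed out in equal shares over a finite set; the
  absolute values of the shares add up to at most that of \<open>g a\<close>. This serves to
  distribute a product of two graph weights over the ways of interleaving the labels.\<close>

lemma formal_summable_Sigma_average:
  assumes "formal_summable g A"
    and "\<And>a. a \<in> A \<Longrightarrow> finite (B a)"
    and "\<And>a b. a \<in> A \<Longrightarrow> b \<in> B a \<Longrightarrow> f (a, b) = cst (1 / of_nat (card (B a))) * g a"
  shows "formal_summable f (Sigma A B)"
  unfolding formal_summable_def cf_def[symmetric]
proof (intro allI)
  fix D k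
  have g: "(\<lambda>a. norm (cf D k (g a))) summable_on A"
    using assms(1) unfolding formal_summable_def cf_def summable_on_iff_norm by simp
  have "(\<lambda>p. norm (cf D k (f p))) summable_on Sigma A B"
  proof (rule summable_on_SigmaI)
    fix a assume a: "a \<in> A"
    show "((\<lambda>b. norm (cf D k (f (a, b)))) has_sum (\<Sum>b\<in>B a. norm (cf D k (f (a, b))))) (B a)"
      using assms(2)[OF a] by simp
  next
    show "(\<lambda>a. \<Sum>b\<in>B a. norm (cf D k (f (a, b)))) summable_on A"
    proof (rule summable_on_comparison_test[OF g])
      fix a assume a: "a \<in> A"
      have "(\<Sum>b\<in>B a. norm (cf D k (f (a, b)))) =
          (\<Sum>b\<in>B a. norm (cf D k (g a)) / of_nat (card (B a)))"
        by (intro sum.cong) (auto simp: assms(3)[OF a] norm_mult norm_divide)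
      also have "\<dots> \<le> norm (cf D k (g a))"
        using assms(2)[OF a] by (cases "B a = {}") (auto simp: field_simps)
      finally show "(\<Sum>b\<in>B a. norm (cf D k (f (a, b)))) \<le> norm (cf D k (g a))" .
    qed (auto intro: sum_nonneg)
  qed auto
  then show "(\<lambda>p. cf D k (f p)) summable_on Sigma A B"
    using summable_on_iff_norm by blast
qed

lemma has_formal_sum_Sigma_average:
  assumes "has_formal_sum g s A"
    and "\<And>a. a \<in> A \<Longrightarrow> finite (B a)" "\<And>a. a \<in> A \<Longrightarrow> B a \<noteq> {}"
    and "\<And>a b. a \<in> A \<Longrightarrow> b \<in> B a \<Longrightarrow> f (a, b) = cst (1 / of_nat (card (B a))) * g a"
  shows "has_formal_sum f s (Sigma A B)"
proof (rule has_formal_sum_SigmaI[OF _ assms(1)])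
  show "formal_summable f (Sigma A B)"
    by (rule formal_summable_Sigma_average[OF has_formal_sum_imp(1)[OF assms(1)] assms(2,4)])
  fix a assume a: "a \<in> A"
  have "(\<Sum>b\<in>B a. f (a, b)) = of_nat (card (B a)) * (cst (1 / of_nat (card (B a))) * g a)"
    using assms(4)[OF a] by simp
  also have "\<dots> = g a"
    using assms(2,3)[OF a] by (simp add: cst_of_nat[symmetric] cst_mult_assoc)
  finally show "has_formal_sum (\<lambda>b. f (a, b)) (g a) (B a)"
    using has_formal_sum_finite[OF assms(2)[OF a], of "\<lambda>b. f (a, b)"] by simp
qed

subsection \<open>A submultiplicative norm on truncated series\<close>

text \<open>Configurations contain products of arbitrarily many factors, so a bound is needed that
  passes through products; a single coefficient has no such bound. The l^1 norm of a truncated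
  series has one, since truncation only discards terms of the Cauchy product.\<close>

definition nrm :: "nat \<Rightarrow> nat \<Rightarrow> formal \<Rightarrow> real" where
  "nrm D k F = (\<Sum>i\<le>D. \<Sum>j\<le>k. norm (cf i j F))"

lemma nrm_nonneg [simp]: "nrm D k F \<ge> 0"
  by (simp add: nrm_def sum_nonneg)

lemma norm_cf_le_nrm: "norm (cf D k F) \<le> nrm D k F"
proof -
  have "norm (cf D k F) \<le> (\<Sum>j\<le>k. norm (cf D j F))"
    by (rule member_le_sum) auto
  also have "\<dots> \<le> nrm D k F"
    unfolding nrm_def by (rule member_le_sum[where f = "\<lambda>i. \<Sum>j\<le>k. norm (cf i j F)"]) (auto intro: sum_nonneg)
  finally show ?thesis .
qed

lemma nrm_0 [simp]: "nrm D k 0 = 0"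
  by (simp add: nrm_def)

lemma nrm_cst_mult: "nrm D k (cst z * F) = norm z * nrm D k F"
  unfolding nrm_def by (simp add: norm_mult sum_distrib_left)

text \<open>The pairs with i + j \<le> D lie in the full square, and all terms are
  nonnegative.\<close>

lemma cauchy_product_le:
  fixes a b :: "nat \<Rightarrow> real"
  assumes "\<And>i. a i \<ge> 0" "\<And>i. b i \<ge> 0"
  shows "(\<Sum>n\<le>D. \<Sum>i=0..n. a i * b (n - i)) \<le> (\<Sum>i\<le>D. a i) * (\<Sum>i\<le>D. b i)"
proof -
  have "(\<Sum>n\<le>D. \<Sum>i=0..n. a i * b (n - i)) = (\<Sum>(i, j)\<in>{(i, j). i + j \<le> D}. a i * b j)"
    by (simp add: sum.triangle_reindex_eq atMost_atLeast0)
  also have "\<dots> \<le> (\<Sum>(i, j)\<in>{..D} \<times> {..D}. a i * b j)"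
    by (rule sum_mono2) (auto simp: assms)
  also have "\<dots> = (\<Sum>i\<le>D. a i) * (\<Sum>i\<le>D. b i)"
    by (simp add: sum_product sum.cartesian_product)
  finally show ?thesis .
qed

lemma nrm_mult: "nrm D k (F * G) \<le> nrm D k F * nrm D k G"
proof -
  have inner: "(\<Sum>j\<le>k. \<Sum>j'=0..j. norm (cf i j' F) * norm (cf i' (j - j') G))
      \<le> (\<Sum>j\<le>k. norm (cf i j F)) * (\<Sum>j\<le>k. norm (cf i' j G))" for i i'
    by (rule cauchy_product_le) auto
  have "nrm D k (F * G) \<le> (\<Sum>n\<le>D. \<Sum>j\<le>k. \<Sum>i=0..n. \<Sum>j'=0..j. norm (cf i j' F) * norm (cf (n - i) (j - j') G))"
    unfolding nrm_def cf_mult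
    by (intro sum_mono order.trans[OF norm_sum]) (simp add: norm_mult)
  also have "\<dots> = (\<Sum>n\<le>D. \<Sum>i=0..n. \<Sum>j\<le>k. \<Sum>j'=0..j. norm (cf i j' F) * norm (cf (n - i) (j - j') G))"
    by (intro sum.cong refl sum.swap)
  also have "\<dots> \<le> (\<Sum>n\<le>D. \<Sum>i=0..n. (\<Sum>j\<le>k. norm (cf i j F)) * (\<Sum>j\<le>k. norm (cf (n - i) j G)))"
    by (intro sum_mono inner)
  also have "\<dots> \<le> nrm D k F * nrm D k G"
    unfolding nrm_def by (rule cauchy_product_le) (auto intro: sum_nonneg)
  finally show ?thesis .
qed

lemma nrm_1: "nrm D k 1 = 1"
proof -
  have "norm (cf i j 1) = (if i = 0 then if j = 0 then 1 else 0 else 0)" for i j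
    by (simp add: cf_def)
  then have "(\<Sum>j\<le>k. norm (cf i j 1)) = (if i = 0 then 1 else 0)" for i
    by (cases "i = 0") simp_all
  then show ?thesis by (simp add: nrm_def)
qed

lemma nrm_prod_list: "(\<And>x. x \<in> set xs \<Longrightarrow> nrm D k (f x) \<le> M) \<Longrightarrow> nrm D k (\<Prod>x\<leftarrow>xs. f x) \<le> M ^ length xs"
proof (induction xs)
  case (Cons x xs)
  have "nrm D k (f x * (\<Prod>x\<leftarrow>xs. f x)) \<le> nrm D k (f x) * nrm D k (\<Prod>x\<leftarrow>xs. f x)"
    by (rule nrm_mult)
  also have "\<dots> \<le> M * M ^ length xs"
    using Cons by (intro mult_mono) (auto intro: order.trans[OF nrm_nonneg])
  finally show ?case by simp
qed (simp add: nrm_1)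

lemma nrm_prod: "(\<And>x. x \<in> A \<Longrightarrow> nrm D k (f x) \<le> M) \<Longrightarrow> nrm D k (\<Prod>x\<in>A. f x) \<le> M ^ card A"
proof (induction A rule: infinite_finite_induct)
  case (insert x A)
  have "nrm D k (f x * (\<Prod>x\<in>A. f x)) \<le> nrm D k (f x) * nrm D k (\<Prod>x\<in>A. f x)"
    by (rule nrm_mult)
  also have "\<dots> \<le> M * M ^ card A"
    using insert by (intro mult_mono) (auto intro: order.trans[OF nrm_nonneg])
  finally show ?case using insert by simp
qed (simp_all add: nrm_1)

lemma formal_summable_nrm:
  assumes "\<And>D k. (\<lambda>i. nrm D k (f i)) summable_on A"
  shows "formal_summable f A"
  unfolding formal_summable_def cf_def[symmetric]
proof (intro allI)
  fix D k
  have "(\<lambda>i. norm (cf D k (f i))) summable_on A"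
    by (rule summable_on_comparison_test[OF assms[of D k]]) (auto intro: norm_cf_le_nrm)
  then show "(\<lambda>i. cf D k (f i)) summable_on A"
    using summable_on_iff_norm by blast
qed

section \<open>Smooth functions and evaluation at formal points\<close>

lemma partials_Nil [simp]: "partials [] F = F"
  and partials_Cons [simp]: "partials (a # as) F = partial a (partials as F)"
  and partials_append: "partials (as @ bs) F = partials as (partials bs F)"
  by (simp_all add: partials_def)

lemma smooth_on_partials: "smooth_on V F \<Longrightarrow> smooth_on V (partials bs F)"
  by (simp add: smooth_on_def partials_append[symmetric])

lemma smooth_on_partial: "smooth_on V F \<Longrightarrow> smooth_on V (partial a F)"
  using smooth_on_partials[of V F "[a]"] by simp

lemma smooth_on_imp_differentiable:
  "smooth_on V F \<Longrightarrow> open V \<Longrightarrow> y \<in> V \<Longrightarrow> F differentiable (at y)"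
  unfolding smooth_on_def
  by (metis at_within_open differentiable_on_def partials_Nil)

lemma partials_differentiable:
  "smooth_on V F \<Longrightarrow> open V \<Longrightarrow> y \<in> V \<Longrightarrow> partials as F differentiable (at y)"
  using smooth_on_partials smooth_on_imp_differentiable by blast

lemma partial_eqI: "(F has_derivative F') (at y) \<Longrightarrow> partial a F y = F' (axis a 1)"
  unfolding partial_def using frechet_derivative_at by metis

lemma partial_cong:
  assumes "open V" "\<And>y. y \<in> V \<Longrightarrow> F y = G y" "y \<in> V"
  shows "partial a F y = partial a G y"
proof -
  have "(F has_derivative f') (at y) \<longleftrightarrow> (G has_derivative f') (at y)" for f'
    using has_derivative_transform_within_open[OF _ assms(1,3)] assms(2) by metis
  then show ?thesis
    unfolding partial_def frechet_derivative_def by simp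
qed

lemma partials_cong:
  assumes "open V" "\<And>y. y \<in> V \<Longrightarrow> F y = G y" "y \<in> V"
  shows "partials as F y = partials as G y"
  using assms(3)
proof (induction as arbitrary: y)
  case (Cons a as)
  then show ?case using partial_cong[OF assms(1)] by (metis partials_Cons)
qed (simp add: assms)

lemma has_derivative_frechet:
  "F differentiable (at y) \<Longrightarrow> (F has_derivative frechet_derivative F (at y)) (at y)"
  using frechet_derivative_works by blast

lemma partial_add:
  "F differentiable (at y) \<Longrightarrow> G differentiable (at y) \<Longrightarrow>
     partial a (\<lambda>y. F y + G y) y = partial a F y + partial a G y"
  by (subst partial_eqI[OF has_derivative_add[OF has_derivative_frechet has_derivative_frechet]])
     (simp_all add: partial_def)

lemma partial_mult:
  "F differentiable (at y) \<Longrightarrow> G differentiable (at y) \<Longrightarrow>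
     partial a (\<lambda>y. F y * G y) y = partial a F y * G y + F y * partial a G y"
  by (subst partial_eqI[OF has_derivative_mult[OF has_derivative_frechet has_derivative_frechet]])
     (simp_all add: partial_def)

lemma has_derivative_exp_comp:
  fixes F :: "real ^ 'd \<Rightarrow> complex"
  assumes "F differentiable (at y)"
  shows "((\<lambda>y. exp (F y)) has_derivative (\<lambda>v. exp (F y) * frechet_derivative F (at y) v)) (at y)"
proof -
  have "(exp has_derivative (\<lambda>v. exp (F y) * v)) (at (F y))"
    using DERIV_exp[of "F y"] by (simp add: has_field_derivative_def)
  from diff_chain_at[OF has_derivative_frechet[OF assms] this]
  show ?thesis by (simp add: o_def)
qed

lemma partial_exp:
  "F differentiable (at y) \<Longrightarrow> partial a (\<lambda>y. exp (F y)) y = exp (F y) * partial a F y"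
  by (subst partial_eqI[OF has_derivative_exp_comp]) (simp_all add: partial_def)

text \<open>Smoothness is proved by coinduction: the closure of the smooth functions under sums,
  products and exponentials is stable under partial derivatives.\<close>

inductive smooth_closure :: "(real ^ 'd) set \<Rightarrow> (real ^ 'd \<Rightarrow> complex) \<Rightarrow> bool" for V where
  base: "smooth_on V F \<Longrightarrow> smooth_closure V F"
| add: "smooth_closure V F \<Longrightarrow> smooth_closure V G \<Longrightarrow> smooth_closure V (\<lambda>y. F y + G y)"
| mult: "smooth_closure V F \<Longrightarrow> smooth_closure V G \<Longrightarrow> smooth_closure V (\<lambda>y. F y * G y)"
| exp: "smooth_closure V F \<Longrightarrow> smooth_closure V (\<lambda>y. exp (F y))"

text \<open>A derivative is known to be of the required shape only on \<open>V\<close>, hence the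
  auxiliary function that agrees with it there.\<close>

lemma smooth_closure_step:
  assumes "smooth_closure V F" and V: "open V"
  shows "(\<forall>y\<in>V. F differentiable (at y)) \<and>
         (\<exists>G. smooth_closure V G \<and> (\<forall>y\<in>V. partial a F y = G y))"
  using assms(1)
proof induction
  case (base F)
  then show ?case
    using smooth_on_imp_differentiable[OF base V] smooth_on_partial[OF base]
      smooth_closure.base by blast
next
  case (add F G)
  then obtain F' G' where "smooth_closure V F'" "\<forall>y\<in>V. partial a F y = F' y"
    "smooth_closure V G'" "\<forall>y\<in>V. partial a G y = G' y" by blast
  then show ?case using add
    by (intro conjI exI[of _ "\<lambda>y. F' y + G' y"] smooth_closure.add) (auto simp: partial_add)
next
  case (mult F G)
  then obtain F' G' where "smooth_closure V F'" "\<forall>y\<in>V. partial a F y = F' y"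
    "smooth_closure V G'" "\<forall>y\<in>V. partial a G y = G' y" by blast
  then show ?case using mult
    by (intro conjI exI[of _ "\<lambda>y. F' y * G y + F y * G' y"] smooth_closure.add smooth_closure.mult)
       (auto simp: partial_mult)
next
  case (exp F)
  then obtain F' where "smooth_closure V F'" "\<forall>y\<in>V. partial a F y = F' y" by blast
  moreover have "(\<lambda>y. exp (F y)) differentiable (at y)" if "y \<in> V" for y
    using has_derivative_exp_comp exp.IH that differentiableI by blast
  ultimately show ?case using exp
    by (intro conjI exI[of _ "\<lambda>y. exp (F y) * F' y"] smooth_closure.mult smooth_closure.exp)
       (auto simp: partial_exp)
qed

lemma smooth_closure_imp_smooth_on:
  assumes "smooth_closure V F" and V: "open V"
  shows "smooth_on V F"
  unfolding smooth_on_def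
proof
  fix as
  show "partials as F differentiable_on V"
    using assms(1)
  \<comment> \<open>\<open>partials\<close> applies the last entry of the list first, so reverse
    induction strips the innermost derivative and leaves another member of the closure.\<close>
  proof (induction as arbitrary: F rule: rev_induct)
    case Nil
    then show ?case
      using smooth_closure_step[OF Nil V] by (simp add: differentiable_at_imp_differentiable_on)
  next
    case (snoc a as)
    obtain G where G: "smooth_closure V G" "\<And>y. y \<in> V \<Longrightarrow> partial a F y = G y"
      using smooth_closure_step[OF snoc.prems V, of a] by blast
    have eq: "partials (as @ [a]) F y = partials as G y" if "y \<in> V" for y
      using partials_cong[OF V, of "partial a F" G y as] G(2) that by (simp add: partials_append)
    have "partials as G differentiable (at y within V)" if "y \<in> V" for y
      using snoc.IH[OF G(1)] that by (simp add: differentiable_on_def)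
    then show ?case unfolding differentiable_on_def
      by (auto intro: differentiable_transform_within[where d = 1 and f = "partials as G"] simp: eq)
  qed
qed

lemma smooth_on_mult:
  shows "open V \<Longrightarrow> smooth_on V F \<Longrightarrow> smooth_on V G \<Longrightarrow> smooth_on V (\<lambda>y. F y * G y)"
  by (rule smooth_closure_imp_smooth_on[OF smooth_closure.mult]) (auto intro: smooth_closure.base)

lemma smooth_on_add:
  shows "open V \<Longrightarrow> smooth_on V F \<Longrightarrow> smooth_on V G \<Longrightarrow> smooth_on V (\<lambda>y. F y + G y)"
  by (rule smooth_closure_imp_smooth_on[OF smooth_closure.add]) (auto intro: smooth_closure.base)

lemma smooth_on_exp:
  shows "open V \<Longrightarrow> smooth_on V F \<Longrightarrow> smooth_on V (\<lambda>y. exp (F y))"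
  by (rule smooth_closure_imp_smooth_on[OF smooth_closure.exp]) (auto intro: smooth_closure.base)

lemma partial_const [simp]: "partial a (\<lambda>_. c) = (\<lambda>_. 0)"
  by (rule ext) (subst partial_eqI[OF has_derivative_const], simp)

lemma partials_const: "partials as (\<lambda>_. c) = (\<lambda>_. if as = [] then c else 0)"
  by (induction as) auto

lemma smooth_on_const: "smooth_on V (\<lambda>_. c)"
  by (simp add: smooth_on_def partials_const)

lemma smooth_on_power:
  shows "open V \<Longrightarrow> smooth_on V F \<Longrightarrow> smooth_on V (\<lambda>y. F y ^ m)"
  by (induction m) (auto intro!: smooth_on_const smooth_on_mult)

lemma smooth_on_sum:
  shows "open V \<Longrightarrow> (\<And>i. i \<in> I \<Longrightarrow> smooth_on V (F i)) \<Longrightarrow> smooth_on V (\<lambda>y. \<Sum>i\<in>I. F i y)"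
  by (induction I rule: infinite_finite_induct) (auto intro!: smooth_on_const smooth_on_add)

lemma smooth_on_prod:
  shows "open V \<Longrightarrow> (\<And>i. i \<in> I \<Longrightarrow> smooth_on V (F i)) \<Longrightarrow> smooth_on V (\<lambda>y. \<Prod>i\<in>I. F i y)"
  by (induction I rule: infinite_finite_induct) (auto intro!: smooth_on_const smooth_on_mult)

lemma partials_add:
  assumes V: "open V" and F: "smooth_on V F" and G: "smooth_on V G" and "y \<in> V"
  shows "partials as (\<lambda>y. F y + G y) y = partials as F y + partials as G y"
  using assms(4)
proof (induction as arbitrary: y)
  case (Cons a as)
  then have "partial a (partials as (\<lambda>y. F y + G y)) y =
      partial a (\<lambda>y. partials as F y + partials as G y) y"
    by (intro partial_cong[OF V]) auto
  then show ?case
    by (simp add: partial_add partials_differentiable[OF _ V Cons.prems] F G)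
qed simp

lemma partials_sum:
  assumes V: "open V" and y: "y \<in> V" and "\<And>i. i \<in> I \<Longrightarrow> smooth_on V (F i)"
  shows "partials as (\<lambda>y. \<Sum>i\<in>I. F i y) y = (\<Sum>i\<in>I. partials as (F i) y)"
  using assms(3)
  by (induction I rule: infinite_finite_induct)
     (auto simp: partials_const partials_add[OF V _ smooth_on_sum[OF V] y])

lemma partials_cmult:
  assumes V: "open V" and F: "smooth_on V F" and "y \<in> V"
  shows "partials as (\<lambda>y. c * F y) y = c * partials as F y"
  using assms(3)
proof (induction as arbitrary: y)
  case (Cons a as)
  then have "partial a (partials as (\<lambda>y. c * F y)) y = partial a (\<lambda>y. c * partials as F y) y"
    by (intro partial_cong[OF V]) auto
  then show ?case
    by (simp add: partial_mult partials_differentiable[OF _ V Cons.prems] F)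
qed simp

text \<open>The factor \<open>F\<close> makes the induction go through: one derivative of \<open>exp (u g) F\<close>
  is again of the form \<open>exp (u g) F'\<close>.\<close>

lemma partials_exp_has_sum:
  assumes V: "open V" and g: "smooth_on V g" and F: "smooth_on V F" and y: "y \<in> V"
  shows "((\<lambda>m. u ^ m / fact m * partials cs (\<lambda>y. g y ^ m * F y) y) has_sum
           partials cs (\<lambda>y. exp (u * g y) * F y) y) UNIV"
  using F
proof (induction cs arbitrary: F rule: rev_induct)
  case Nil
  have "(\<lambda>m. (u * g y) ^ m /\<^sub>R fact m) sums exp (u * g y)"
    by (rule exp_converges)
  moreover have "summable (\<lambda>m. norm ((u * g y) ^ m /\<^sub>R fact m))"
    by (rule summable_norm_exp)
  ultimately have "((\<lambda>m. (u * g y) ^ m /\<^sub>R fact m) has_sum exp (u * g y)) UNIV"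
    by (rule norm_summable_imp_has_sum[rotated])
  from has_sum_cmult_left[OF this, of "F y"] show ?case
    by (simp add: power_mult_distrib scaleR_conv_of_real field_simps)
next
  case (snoc a cs)
  note d = smooth_on_imp_differentiable[OF _ V]
  \<comment> \<open>One derivative of exp (u g) F is u exp (u g) ?F1 + exp (u g) ?F2; the induction
    hypothesis is used for both new factors.\<close>
  let ?F1 = "\<lambda>y. partial a g y * F y" and ?F2 = "partial a F"
  have F1: "smooth_on V ?F1" and F2: "smooth_on V ?F2"
    using g snoc.prems by (auto intro: smooth_on_mult V smooth_on_partial)
  have ug: "smooth_on V (\<lambda>y. u * g y)"
    by (intro smooth_on_mult V smooth_on_const g)
  have pug: "partial a (\<lambda>y. u * g y) z = u * partial a g z" if "z \<in> V" for z
    using that by (simp add: partial_mult d[OF g])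
  have sm: "smooth_on V (\<lambda>y. exp (u * g y) * F y)" if "smooth_on V F" for F
    by (intro smooth_on_mult V smooth_on_exp ug that)
  have smp: "smooth_on V (\<lambda>y. g y ^ m * F y)" if "smooth_on V F" for F m
    by (intro smooth_on_mult V smooth_on_power g that)
  have "partials cs (partial a (\<lambda>y. exp (u * g y) * F y)) y =
      partials cs (\<lambda>y. u * (exp (u * g y) * ?F1 y) + exp (u * g y) * ?F2 y) y"
  proof (rule partials_cong[OF V _ y])
    fix z assume z: "z \<in> V"
    show "partial a (\<lambda>y. exp (u * g y) * F y) z = u * (exp (u * g z) * ?F1 z) + exp (u * g z) * ?F2 z"
      unfolding partial_mult[OF d[OF smooth_on_exp[OF V ug] z] d[OF snoc.prems z]]
        partial_exp[OF d[OF ug z]] pug[OF z] by (simp add: algebra_simps)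
  qed
  also have "\<dots> = u * partials cs (\<lambda>y. exp (u * g y) * ?F1 y) y + partials cs (\<lambda>y. exp (u * g y) * ?F2 y) y"
    by (simp add: partials_add[OF V _ _ y] partials_cmult[OF V _ y] sm F1 F2
          smooth_on_mult[OF V smooth_on_const])
  finally have L: "partials (cs @ [a]) (\<lambda>y. exp (u * g y) * F y) y = \<dots>"
    by (simp add: partials_append)
  have pw: "partial a (\<lambda>y. g y ^ m) z = of_nat m * g z ^ (m - 1) * partial a g z" if z: "z \<in> V" for z m
  proof (induction m)
    case (Suc m)
    then show ?case using d[OF g z] d[OF smooth_on_power[OF V g] z]
      by (cases m) (simp_all add: partial_mult algebra_simps)
  qed simp
  have R: "partials (cs @ [a]) (\<lambda>y. g y ^ m * F y) y =
      of_nat m * partials cs (\<lambda>y. g y ^ (m - 1) * ?F1 y) y + partials cs (\<lambda>y. g y ^ m * ?F2 y) y" for m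
  proof -
    have "partials cs (partial a (\<lambda>y. g y ^ m * F y)) y =
        partials cs (\<lambda>y. of_nat m * (g y ^ (m - 1) * ?F1 y) + g y ^ m * ?F2 y) y"
      by (rule partials_cong[OF V _ y])
         (simp add: partial_mult pw d[OF smooth_on_power[OF V g]] d[OF snoc.prems])
    then show ?thesis
      by (simp add: partials_append partials_add[OF V _ _ y] partials_cmult[OF V _ y] smp F1 F2
          smooth_on_mult[OF V smooth_on_const])
  qed
  \<comment> \<open>The factor m from differentiating g^m cancels against m!, so the shift of m by
    one turns this series into u times the series for ?F1. The term m = 0 vanishes.\<close>
  let ?t1 = "\<lambda>m. u ^ m / fact m * (of_nat m * partials cs (\<lambda>y. g y ^ (m - 1) * ?F1 y) y)"
  have "((\<lambda>m. ?t1 (Suc m)) has_sum u * partials cs (\<lambda>y. exp (u * g y) * ?F1 y) y) UNIV"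
  proof -
    have "?t1 (Suc m) = u * (u ^ m / fact m * partials cs (\<lambda>y. g y ^ m * ?F1 y) y)" for m
      by (simp add: field_simps del: of_nat_Suc)
    then show ?thesis
      by (simp only: has_sum_cmult_right[OF snoc.IH[OF F1]])
  qed
  then have "(?t1 has_sum u * partials cs (\<lambda>y. exp (u * g y) * ?F1 y) y) (range Suc)"
    by (subst has_sum_reindex) (simp_all add: o_def)
  moreover have "?t1 x = 0" if "x \<in> UNIV - range Suc" for x
  proof -
    have "x = 0" using that by (metis DiffE not0_implies_Suc rangeI)
    then show ?thesis by simp
  qed
  then have "(?t1 has_sum S) (range Suc) \<longleftrightarrow> (?t1 has_sum S) UNIV" for S
    by (intro has_sum_cong_neutral) blast+
  ultimately have "(?t1 has_sum u * partials cs (\<lambda>y. exp (u * g y) * ?F1 y) y) UNIV"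
    by blast
  from has_sum_add[OF this snoc.IH[OF F2]] show ?case
    unfolding L R distrib_left .
qed

subsection \<open>Symmetry of partial derivatives\<close>

lemma norm_diff_le_add: "norm x \<le> a \<Longrightarrow> norm y \<le> b \<Longrightarrow> norm (x - y) \<le> a + b"
  using norm_triangle_ineq4[of x y] by linarith

text \<open>The second difference over a square of side t equals t^2 times the mixed derivative up
  to o(t^2): the mean value theorem in direction a reduces it to increments of
  \<open>partial a F\<close>, which is totally differentiable at y. As the second difference is
  symmetric in a and b, so are the mixed derivatives.\<close>

lemma mixed_difference_approx:
  fixes F :: "real ^ 'd::finite \<Rightarrow> complex"
  assumes V: "open V" and F: "smooth_on V F" and y: "y \<in> V" and e: "e > 0"
  shows "\<exists>r>0. \<forall>t. 0 < t \<and> t < r \<longrightarrow>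
    norm (F (y + t *\<^sub>R axis a 1 + t *\<^sub>R axis b 1) - F (y + t *\<^sub>R axis a 1) - F (y + t *\<^sub>R axis b 1) + F y
          - t\<^sup>2 *\<^sub>R partial b (partial a F) y) \<le> e * t\<^sup>2"
proof -
  define A B :: "real ^ 'd" where "A = axis a 1" and "B = axis b 1"
  have AB: "norm A = 1" "norm B = 1" by (simp_all add: A_def B_def)
  define G where "G = partial a F"
  define G' where "G' = frechet_derivative G (at y)"
  have der: "(G has_derivative G') (at y)"
    unfolding G'_def G_def
    by (intro has_derivative_frechet smooth_on_imp_differentiable[OF _ V y] smooth_on_partial F)
  have lin: "linear G'" using der has_derivative_linear by blast
  have pG: "partial b G y = G' B" by (simp add: partial_def G'_def B_def)
  \<comment> \<open>The linear approximation is applied to increments of length at most 2t and t,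
    together 3t, hence a third of e.\<close>
  obtain r1 where r1: "r1 > 0" "\<And>z. norm (z - y) < r1 \<Longrightarrow> norm (G z - G y - G' (z - y)) \<le> e / 3 * norm (z - y)"
    using der e unfolding has_derivative_at_alt by (metis divide_pos_pos zero_less_numeral)
  obtain r2 where r2: "r2 > 0" "ball y r2 \<subseteq> V" using V y openE by blast
  \<comment> \<open>Halving leaves room for all points at distance at most 2t from y.\<close>
  define r where "r = min r1 r2 / 2"
  have "r > 0" using r1 r2 by (simp add: r_def)
  moreover have "norm (F (y + t *\<^sub>R A + t *\<^sub>R B) - F (y + t *\<^sub>R A) - F (y + t *\<^sub>R B) + F y
          - t\<^sup>2 *\<^sub>R G' B) \<le> e * t\<^sup>2" if t: "0 < t" "t < r" for t
  proof -
    \<comment> \<open>The linear term in s is subtracted so that \<open>p t - p 0\<close> is exactly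
      the error to be bounded and the derivative p' is small.\<close>
    define p where "p s = F (y + s *\<^sub>R A + t *\<^sub>R B) - F (y + s *\<^sub>R A) - s *\<^sub>R (t *\<^sub>R G' B)" for s
    define p' where "p' s = G (y + s *\<^sub>R A + t *\<^sub>R B) - G (y + s *\<^sub>R A) - t *\<^sub>R G' B" for s
    have n1: "norm (s *\<^sub>R A + t *\<^sub>R B) \<le> s + t" if "0 \<le> s" for s
      using norm_triangle_ineq[of "s *\<^sub>R A" "t *\<^sub>R B"] that t(1) unfolding norm_scaleR AB by simp
    have n2: "norm (s *\<^sub>R A) \<le> s" if "0 \<le> s" for s
      using that unfolding norm_scaleR AB by simp
    have tr: "2 * t < r1" "2 * t < r2" using t(2) unfolding r_def by linarith+
    have in_V: "y + s *\<^sub>R A + t *\<^sub>R B \<in> V" "y + s *\<^sub>R A \<in> V" if "0 \<le> s" "s \<le> t" for s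
    proof -
      have "norm (s *\<^sub>R A + t *\<^sub>R B) < r2" "norm (s *\<^sub>R A) < r2"
        using n1[OF that(1)] that tr n2[OF that(1)] by linarith+
      moreover have "dist y (y + z) = norm z" for z by (simp add: dist_norm)
      ultimately have "y + (s *\<^sub>R A + t *\<^sub>R B) \<in> ball y r2" "y + s *\<^sub>R A \<in> ball y r2"
        unfolding mem_ball by presburger+
      then show "y + s *\<^sub>R A + t *\<^sub>R B \<in> V" "y + s *\<^sub>R A \<in> V"
        using r2(2) by (auto simp: add.assoc)
    qed
    have dF: "((\<lambda>s. F (c + s *\<^sub>R A)) has_derivative (\<lambda>h. h *\<^sub>R G (c + s *\<^sub>R A))) (at s)"
      if "c + s *\<^sub>R A \<in> V" for c s
    proof -
      have "(F has_derivative frechet_derivative F (at (c + s *\<^sub>R A))) (at (c + s *\<^sub>R A))" (is "(F has_derivative ?F') _")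
        by (intro has_derivative_frechet smooth_on_imp_differentiable[OF F V that])
      moreover from this have "linear ?F'" using has_derivative_linear by blast
      moreover have "((\<lambda>s. c + s *\<^sub>R A) has_derivative (\<lambda>h. h *\<^sub>R A)) (at s)"
        by (auto intro!: derivative_eq_intros)
      ultimately show ?thesis
        using diff_chain_at[of "\<lambda>s. c + s *\<^sub>R A" "\<lambda>h. h *\<^sub>R A" s F ?F']
        by (simp add: o_def linear_scale G_def partial_def A_def)
    qed
    have dp: "(p has_derivative (\<lambda>h. h *\<^sub>R p' s)) (at s)" if "0 \<le> s" "s \<le> t" for s
    proof -
      have e: "y + s *\<^sub>R A + t *\<^sub>R B = (y + t *\<^sub>R B) + s *\<^sub>R A" for s by simp
      have "(y + t *\<^sub>R B) + s *\<^sub>R A \<in> V" using in_V(1)[OF that] by (simp add: algebra_simps)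
      from dF[OF this] dF[OF in_V(2)[OF that]]
      have "((\<lambda>s. F ((y + t *\<^sub>R B) + s *\<^sub>R A) - F (y + s *\<^sub>R A) - s *\<^sub>R (t *\<^sub>R G' B)) has_derivative
        (\<lambda>h. h *\<^sub>R G ((y + t *\<^sub>R B) + s *\<^sub>R A) - h *\<^sub>R G (y + s *\<^sub>R A) - h *\<^sub>R (t *\<^sub>R G' B))) (at s)"
        by (intro has_derivative_diff has_derivative_scaleR_left has_derivative_ident)
      then show ?thesis
        unfolding p_def[abs_def] p'_def e by (simp add: scaleR_diff_right)
    qed
    have "continuous_on {0..t} p"
      using dp has_derivative_continuous by (intro continuous_at_imp_continuous_on) fastforce
    then obtain s where s: "0 < s" "s < t" "norm (p t - p 0) \<le> norm ((t - 0) *\<^sub>R p' s)"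
      using mvt_general[of 0 t p "\<lambda>s h. h *\<^sub>R p' s"] dp t(1) by auto
    have small: "norm (s *\<^sub>R A + t *\<^sub>R B) < r1" "norm (s *\<^sub>R A) < r1"
      using n1[of s] n2[of s] s tr by linarith+
    have "p' s = (G (y + s *\<^sub>R A + t *\<^sub>R B) - G y - G' (s *\<^sub>R A + t *\<^sub>R B)) - (G (y + s *\<^sub>R A) - G y - G' (s *\<^sub>R A))"
      by (simp add: p'_def linear_add[OF lin] linear_scale[OF lin])
    also have "norm \<dots> \<le> e / 3 * norm (s *\<^sub>R A + t *\<^sub>R B) + e / 3 * norm (s *\<^sub>R A)"
      using r1(2)[of "y + (s *\<^sub>R A + t *\<^sub>R B)"] r1(2)[of "y + s *\<^sub>R A"] small
      by (intro norm_diff_le_add) (simp_all add: add.assoc del: norm_scaleR)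
    also have "\<dots> \<le> e / 3 * (2 * t) + e / 3 * t"
      using n1[of s] n2[of s] s e by (intro add_mono mult_left_mono) (auto simp del: norm_scaleR)
    finally have "norm (p' s) \<le> e * t" by simp
    then have "norm (p t - p 0) \<le> t * (e * t)"
      using s(3) t by (auto intro: order.trans mult_left_mono)
    moreover have "p t - p 0 = F (y + t *\<^sub>R A + t *\<^sub>R B) - F (y + t *\<^sub>R A) - F (y + t *\<^sub>R B) + F y - t\<^sup>2 *\<^sub>R G' B"
      by (simp add: p_def power2_eq_square)
    ultimately show ?thesis by (simp add: power2_eq_square mult_ac)
  qed
  ultimately show ?thesis
    unfolding A_def B_def G_def[symmetric] pG[unfolded B_def] by blast
qed

lemma partial_commute:
  fixes F :: "real ^ 'd::finite \<Rightarrow> complex"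
  assumes V: "open V" and F: "smooth_on V F" and y: "y \<in> V"
  shows "partial a (partial b F) y = partial b (partial a F) y"
proof (rule ccontr)
  define p q where "p = partial a (partial b F) y" and "q = partial b (partial a F) y"
  assume "partial a (partial b F) y \<noteq> partial b (partial a F) y"
  then have pq: "norm (p - q) > 0" by (simp add: p_def q_def)
  \<comment> \<open>The same \<open>X t\<close> lies within e t^2 of both multiples of t^2, so the
    two derivatives differ by at most 2e; a third of their distance is thus contradictory.\<close>
  define e where "e = norm (p - q) / 3"
  have e: "e > 0" using pq by (simp add: e_def)
  define X where "X t = F (y + t *\<^sub>R axis a 1 + t *\<^sub>R axis b 1) - F (y + t *\<^sub>R axis a 1)
      - F (y + t *\<^sub>R axis b 1) + F y" for t
  obtain r1 where r1: "r1 > 0" "\<And>t. 0 < t \<Longrightarrow> t < r1 \<Longrightarrow> norm (X t - t\<^sup>2 *\<^sub>R q) \<le> e * t\<^sup>2"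
    using mixed_difference_approx[OF V F y e, of a b] unfolding X_def q_def by blast
  obtain r2 where r2: "r2 > 0" "\<And>t. 0 < t \<Longrightarrow> t < r2 \<Longrightarrow> norm (X t - t\<^sup>2 *\<^sub>R p) \<le> e * t\<^sup>2"
  proof -
    have "F (y + t *\<^sub>R axis b 1 + t *\<^sub>R axis a 1) - F (y + t *\<^sub>R axis b 1)
      - F (y + t *\<^sub>R axis a 1) + F y = X t" for t
      by (simp add: X_def algebra_simps)
    then show ?thesis
      using mixed_difference_approx[OF V F y e, of b a] that unfolding p_def by auto
  qed
  define t where "t = min r1 r2 / 2"
  have t: "0 < t" "t < r1" "t < r2" using r1 r2 by (auto simp: t_def)
  have "t\<^sup>2 * norm (p - q) = norm ((X t - t\<^sup>2 *\<^sub>R q) - (X t - t\<^sup>2 *\<^sub>R p))"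
    by (simp flip: scaleR_diff_right)
  also have "\<dots> \<le> e * t\<^sup>2 + e * t\<^sup>2"
    by (rule norm_diff_le_add[OF r1(2)[OF t(1,2)] r2(2)[OF t(1,3)]])
  finally have "t\<^sup>2 * norm (p - q) \<le> t\<^sup>2 * (2 * e)" by (simp add: algebra_simps)
  then have "norm (p - q) \<le> 2 * e" using t(1) by simp
  then show False using pq by (simp add: e_def)
qed

lemma partials_move_front:
  assumes V: "open V" and F: "smooth_on V F" and "y \<in> V"
  shows "partials (as @ a # bs) F y = partials (a # as @ bs) F y"
  using assms(3)
proof (induction as arbitrary: y)
  case (Cons b as)
  have "partials ((b # as) @ a # bs) F y = partial b (partials (a # as @ bs) F) y"
    using Cons.IH Cons.prems by (simp del: partials_Cons add: partials_Cons[of b]) (rule partial_cong[OF V], auto)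
  then show ?case
    using partial_commute[OF V smooth_on_partials[OF F] Cons.prems, of b a "as @ bs"] by simp
qed simp

lemma partials_mset_eq:
  assumes V: "open V" and F: "smooth_on V F" and "y \<in> V" and "mset as = mset bs"
  shows "partials as F y = partials bs F y"
  using assms(3,4)
proof (induction as arbitrary: bs y)
  case (Cons a as)
  then have "a \<in> set bs" by (metis list.set_intros(1) set_mset_mset)
  then obtain b1 b2 where bs: "bs = b1 @ a # b2" by (meson split_list)
  then have "mset as = mset (b1 @ b2)" using Cons.prems by simp
  then have "partials (a # as) F y = partials (a # b1 @ b2) F y"
    using Cons.IH Cons.prems(1) by simp (rule partial_cong[OF V], auto)
  then show ?case unfolding bs using partials_move_front[OF V F Cons.prems(1)] by simp
qed simp

subsection \<open>Evaluation at a formal point\<close>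

definition disp :: "('d::finite \<Rightarrow> formal) \<Rightarrow> 'd \<Rightarrow> formal" where
  "disp c a = c a - cst (of_real (base_point c $ a))"

text \<open>With no term of order \<epsilon>^0 in any t-degree, a product of n displacements is
  divisible by \<epsilon>^n, which is what \<open>vanish n\<close> expresses. Every coefficient of
  the Taylor sum is then a finite sum.\<close>

definition infinitesimal_disp :: "('d::finite \<Rightarrow> formal) \<Rightarrow> bool" where
  "infinitesimal_disp c \<longleftrightarrow> (\<forall>a D. cf D 0 (disp c a) = 0)"

definition vanish :: "nat \<Rightarrow> formal \<Rightarrow> bool" where
  "vanish n F \<longleftrightarrow> (\<forall>D. \<forall>k<n. cf D k F = 0)"

lemma vanish_mult:
  assumes "vanish n F" "vanish m G"
  shows "vanish (n + m) (F * G)"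
  unfolding vanish_def
proof (intro allI impI)
  fix D k assume k: "k < n + m"
  have "cf i j F * cf (D - i) (k - j) G = 0" if "j \<le> k" for i j
  proof -
    have "j < n \<or> k - j < m" using k that by arith
    then show ?thesis using assms unfolding vanish_def by auto
  qed
  then show "cf D k (F * G) = 0"
    unfolding cf_mult by (simp add: sum.neutral)
qed

lemma vanish_sum: "(\<And>i. i \<in> I \<Longrightarrow> vanish n (F i)) \<Longrightarrow> vanish n (\<Sum>i\<in>I. F i)"
  unfolding vanish_def cf_sum by simp

lemma vanish_cst: "vanish n F \<Longrightarrow> vanish n (cst z * F)"
  unfolding vanish_def by simp

lemma vanish_disp: "infinitesimal_disp c \<Longrightarrow> vanish (length as) (\<Prod>a\<leftarrow>as. disp c a)"
proof (induction as)
  case (Cons a as)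
  have "vanish 1 (disp c a)"
    using Cons.prems unfolding infinitesimal_disp_def vanish_def by simp
  from vanish_mult[OF this Cons.IH[OF Cons.prems]] show ?case by simp
qed (simp add: vanish_def)

lemma cf_eval_at:
  fixes c :: "'d::finite \<Rightarrow> formal"
  assumes "infinitesimal_disp c"
  shows "cf D k (eval_at F c) = (\<Sum>as | length as \<le> k.
    partials as F (base_point c) / fact (length as) * cf D k (\<Prod>a\<leftarrow>as. disp c a))"
proof -
  have fin: "finite {as :: 'd list. length as \<le> k}"
    using finite_lists_length_le[of "UNIV :: 'd set" k] by simp
  have "cf D k (eval_at F c) = (\<Sum>\<^sub>\<infinity>as. cf D k (cst (partials as F (base_point c) / fact (length as)) * (\<Prod>a\<leftarrow>as. disp c a)))"
    by (simp add: eval_at_def formal_sum_def cf_def disp_def)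
  also have "\<dots> = (\<Sum>\<^sub>\<infinity>as\<in>{as. length as \<le> k}. partials as F (base_point c) / fact (length as) * cf D k (\<Prod>a\<leftarrow>as. disp c a))"
    by (rule infsum_cong_neutral) (use vanish_disp[OF assms] in \<open>auto simp: vanish_def\<close>)
  finally show ?thesis using fin by simp
qed

text \<open>This is the n-th power of the derivation \<Sum>a. \<open>disp c a\<close> \<partial>_a,
  with the displacement held constant. The factor 1/n! is left out so that products obey the plain
  binomial rule.\<close>

definition taylor_term :: "('d::finite \<Rightarrow> formal) \<Rightarrow> nat \<Rightarrow> (real ^ 'd \<Rightarrow> complex) \<Rightarrow> real ^ 'd \<Rightarrow> formal" where
  "taylor_term c n F y = (\<Sum>as | length as = n. cst (partials as F y) * (\<Prod>a\<leftarrow>as. disp c a))"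

lemma vanish_taylor_term: "infinitesimal_disp c \<Longrightarrow> vanish n (taylor_term c n F y)"
  unfolding taylor_term_def by (intro vanish_sum vanish_cst) (use vanish_disp in auto)

lemma finite_length_eq: "finite {as :: 'd::finite list. length as = n}"
  using finite_lists_length_eq[of "UNIV :: 'd set" n] by simp

text \<open>Any truncation level from k upwards gives the same coefficient, so that one level can
  serve all coefficients of index at most k at once.\<close>

lemma cf_eval_at_taylor:
  fixes c :: "'d::finite \<Rightarrow> formal"
  assumes "infinitesimal_disp c" "k \<le> N"
  shows "cf D k (eval_at F c) = cf D k (\<Sum>n\<le>N. cst (1 / fact n) * taylor_term c n F (base_point c))"
proof -
  let ?t = "\<lambda>as. partials as F (base_point c) / fact (length as) * cf D k (\<Prod>a\<leftarrow>as. disp c a)"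
  have "cf D k (\<Sum>n\<le>N. cst (1 / fact n) * taylor_term c n F (base_point c)) =
      (\<Sum>n\<le>N. cf D k (cst (1 / fact n) * taylor_term c n F (base_point c)))"
    by (simp add: cf_sum)
  also have "\<dots> = (\<Sum>n\<le>k. cf D k (cst (1 / fact n) * taylor_term c n F (base_point c)))"
    using assms(2) vanish_taylor_term[OF assms(1), of _ F "base_point c"] unfolding vanish_def
    by (intro sum.mono_neutral_right) auto
  also have "\<dots> = (\<Sum>n\<le>k. \<Sum>as | length as = n. ?t as)"
    unfolding taylor_term_def cf_sum cf_cst_mult sum_distrib_left by (intro sum.cong refl) auto
  also have "\<dots> = sum ?t (\<Union>n\<in>{..k}. {as. length as = n})"
    by (rule sum.UNION_disjoint[symmetric]) (auto simp: finite_length_eq)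
  also have "(\<Union>n\<in>{..k}. {as :: 'd list. length as = n}) = {as. length as \<le> k}" by auto
  finally show ?thesis using cf_eval_at[OF assms(1)] by simp
qed

text \<open>The last entry is the derivative applied first; cutting it off replaces F by
  \<open>partial a F\<close>, which yields the recursion for \<open>taylor_term\<close>.\<close>

lemma sum_length_Suc_snoc:
  fixes f :: "'d::finite list \<Rightarrow> 'b::comm_monoid_add"
  shows "(\<Sum>as | length as = Suc n. f as) = (\<Sum>a\<in>UNIV. \<Sum>as | length as = n. f (as @ [a]))"
proof -
  have "(\<Sum>a\<in>UNIV. \<Sum>as | length as = n. f (as @ [a])) =
      (\<Sum>(a, as)\<in>UNIV \<times> {as. length as = n}. f (as @ [a]))"
    by (simp add: sum.cartesian_product)
  also have "\<dots> = (\<Sum>as | length as = Suc n. f as)"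
    by (rule sum.reindex_bij_witness[where i = "\<lambda>as. (last as, butlast as)" and j = "\<lambda>(a, as). as @ [a]"])
       (auto, metis append_butlast_last_id length_0_conv nat.distinct(1))
  finally show ?thesis by simp
qed

lemma taylor_term_0: "taylor_term c 0 F y = cst (F y)"
  by (simp add: taylor_term_def)

lemma taylor_term_Suc:
  "taylor_term c (Suc n) F y = (\<Sum>a\<in>UNIV. disp c a * taylor_term c n (partial a F) y)"
  unfolding taylor_term_def sum_length_Suc_snoc sum_distrib_left
  by (intro sum.cong refl) (simp add: partials_append mult_ac)

lemma taylor_term_cong:
  assumes "open V" "\<And>y. y \<in> V \<Longrightarrow> F y = G y" "y \<in> V"
  shows "taylor_term c n F y = taylor_term c n G y"
  unfolding taylor_term_def using partials_cong[OF assms] by simp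

lemma taylor_term_add:
  assumes "open V" "smooth_on V F" "smooth_on V G" "y \<in> V"
  shows "taylor_term c n (\<lambda>y. F y + G y) y = taylor_term c n F y + taylor_term c n G y"
  unfolding taylor_term_def partials_add[OF assms] cst_add distrib_right sum.distrib ..

text \<open>Pascal's rule as it arises when a derivation acts on a binomial sum: each application
  raises the index of exactly one of the two factors.\<close>

lemma pascal_convolution:
  fixes A B :: "nat \<Rightarrow> 'a::comm_ring_1"
  shows "(\<Sum>k\<le>n. of_nat (n choose k) * (A (Suc k) * B (n - k) + A k * B (Suc (n - k)))) =
         (\<Sum>k\<le>Suc n. of_nat (Suc n choose k) * (A k * B (Suc n - k)))"
proof -
  have "(\<Sum>k\<le>Suc n. of_nat (Suc n choose k) * (A k * B (Suc n - k))) =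
      A 0 * B (Suc n) + (\<Sum>k\<le>n. of_nat (n choose Suc k) * (A (Suc k) * B (n - k))) +
      (\<Sum>k\<le>n. of_nat (n choose k) * (A (Suc k) * B (n - k)))"
    by (subst sum.atMost_Suc_shift) (simp add: sum.distrib algebra_simps)
  also have "A 0 * B (Suc n) + (\<Sum>k\<le>n. of_nat (n choose Suc k) * (A (Suc k) * B (n - k))) =
      (\<Sum>k\<le>Suc n. of_nat (n choose k) * (A k * B (Suc n - k)))"
    by (subst sum.atMost_Suc_shift) simp
  also have "\<dots> = (\<Sum>k\<le>n. of_nat (n choose k) * (A k * B (Suc (n - k))))"
    by (simp add: Suc_diff_le binomial_eq_0)
  finally show ?thesis by (simp add: sum.distrib algebra_simps)
qed

lemma taylor_term_mult:
  assumes V: "open V" and F: "smooth_on V F" and G: "smooth_on V G" and y: "y \<in> V"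
  shows "taylor_term c n (\<lambda>y. F y * G y) y =
    (\<Sum>k\<le>n. of_nat (n choose k) * (taylor_term c k F y * taylor_term c (n - k) G y))"
  using F G
proof (induction n arbitrary: F G)
  case 0
  then show ?case by (simp add: taylor_term_0 cst_mult)
next
  case (Suc n)
  note d = smooth_on_imp_differentiable[OF _ V] and sp = smooth_on_partial
  let ?T = "\<lambda>n F. taylor_term c n F y"
  have "?T n (partial a (\<lambda>y. F y * G y)) =
      (\<Sum>k\<le>n. of_nat (n choose k) * (?T k (partial a F) * ?T (n - k) G + ?T k F * ?T (n - k) (partial a G)))" for a
  proof -
    have "?T n (partial a (\<lambda>y. F y * G y)) = ?T n (\<lambda>y. partial a F y * G y + F y * partial a G y)"
      using Suc.prems by (intro taylor_term_cong[OF V _ y] partial_mult d)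
    also have "\<dots> = ?T n (\<lambda>y. partial a F y * G y) + ?T n (\<lambda>y. F y * partial a G y)"
      using Suc.prems by (intro taylor_term_add[OF V _ _ y] smooth_on_mult V sp)
    finally show ?thesis
      using Suc.prems by (simp add: Suc.IH sp sum.distrib distrib_left)
  qed
  then have "?T (Suc n) (\<lambda>y. F y * G y) = (\<Sum>a\<in>UNIV. disp c a *
      (\<Sum>k\<le>n. of_nat (n choose k) * (?T k (partial a F) * ?T (n - k) G + ?T k F * ?T (n - k) (partial a G))))"
    by (simp add: taylor_term_Suc)
  also have "\<dots> = (\<Sum>k\<le>n. \<Sum>a\<in>UNIV. disp c a * (of_nat (n choose k) * (?T k (partial a F) * ?T (n - k) G + ?T k F * ?T (n - k) (partial a G))))"
    unfolding sum_distrib_left by (rule sum.swap)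
  also have "\<dots> = (\<Sum>k\<le>n. of_nat (n choose k) * (?T (Suc k) F * ?T (n - k) G + ?T k F * ?T (Suc (n - k)) G))"
    by (intro sum.cong refl)
       (simp add: taylor_term_Suc sum_distrib_left sum_distrib_right sum.distrib algebra_simps)
  also have "\<dots> = (\<Sum>k\<le>Suc n. of_nat (Suc n choose k) * (?T k F * ?T (Suc n - k) G))"
    by (rule pascal_convolution)
  finally show ?case .
qed

lemma eval_at_mult:
  assumes V: "open V" and F: "smooth_on V F" and G: "smooth_on V G"
    and c: "infinitesimal_disp c" "base_point c \<in> V"
  shows "eval_at (\<lambda>y. F y * G y) c = eval_at F c * eval_at G c"
proof (rule formal_eqI)
  fix D k
  let ?T = "\<lambda>n F. taylor_term c n F (base_point c)"
  let ?t = "\<lambda>n m. cst (1 / (fact n * fact m)) * (?T n F * ?T m G)"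
  have "cf D k (eval_at (\<lambda>y. F y * G y) c) = cf D k (\<Sum>n\<le>k. cst (1 / fact n) * ?T n (\<lambda>y. F y * G y))"
    by (rule cf_eval_at_taylor[OF c(1) order_refl])
  also have "(\<Sum>n\<le>k. cst (1 / fact n) * ?T n (\<lambda>y. F y * G y)) = (\<Sum>n\<le>k. \<Sum>m\<le>n. ?t m (n - m))"
  proof -
    have "cst (1 / fact n) * (of_nat (n choose m) * X) = cst (1 / (fact m * fact (n - m))) * X" if "m \<le> n" for n m X
      using that by (simp add: cst_of_nat[symmetric] cst_mult_assoc binomial_fact)
    then show ?thesis
      unfolding taylor_term_mult[OF V F G c(2)] sum_distrib_left by (intro sum.cong refl) auto
  qed
  also have "\<dots> = (\<Sum>(n, m)\<in>{(n, m). n + m \<le> k}. ?t n m)"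
    by (rule sum.triangle_reindex_eq[symmetric])
  also have "cf D k \<dots> = (\<Sum>(n, m)\<in>{(n, m). n + m \<le> k}. cf D k (?t n m))"
    by (simp add: cf_sum case_prod_unfold)
  \<comment> \<open>The added pairs have n + m > k, and their products are divisible by
    \<epsilon>^(n + m), so they do not contribute to the coefficient of \<epsilon>^k.\<close>
  also have "\<dots> = (\<Sum>(n, m)\<in>{..k} \<times> {..k}. cf D k (?t n m))"
  proof (rule sum.mono_neutral_left)
    show "\<forall>p\<in>{..k} \<times> {..k} - {(n, m). n + m \<le> k}. (case p of (n, m) \<Rightarrow> cf D k (?t n m)) = 0"
    proof
      fix p assume "p \<in> {..k} \<times> {..k} - {(n, m). n + m \<le> k}"
      then obtain n m where p: "p = (n, m)" "\<not> n + m \<le> k" by auto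
      moreover have "vanish (n + m) (?T n F * ?T m G)"
        by (intro vanish_mult vanish_taylor_term c(1))
      ultimately show "(case p of (n, m) \<Rightarrow> cf D k (?t n m)) = 0"
        by (simp add: vanish_def)
    qed
  qed auto
  also have "\<dots> = cf D k ((\<Sum>n\<le>k. cst (1 / fact n) * ?T n F) * (\<Sum>n\<le>k. cst (1 / fact n) * ?T n G))"
  proof -
    have pull: "cst a * X * (cst b * Y) = cst (a * b) * (X * Y)" for a b X Y
      by (simp only: cst_mult ac_simps)
    have "cst (1 / fact n) * ?T n F * (cst (1 / fact m) * ?T m G) = ?t n m" for n m
      by (simp only: pull times_divide_times_eq mult_1)
    then show ?thesis
      by (simp only: sum_product sum.cartesian_product cf_sum case_prod_unfold)
  qed
  also have "\<dots> = cf D k (eval_at F c * eval_at G c)"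
    unfolding cf_mult by (intro sum.cong refl) (simp add: cf_eval_at_taylor[OF c(1), where N = k])
  finally show "cf D k (eval_at (\<lambda>y. F y * G y) c) = cf D k (eval_at F c * eval_at G c)" .
qed

lemma eval_at_cong:
  assumes V: "open V" and "base_point c \<in> V" and "\<And>y. y \<in> V \<Longrightarrow> F y = G y"
  shows "eval_at F c = eval_at G c"
  unfolding eval_at_def using partials_cong[OF V assms(3,2)] by simp

lemma eval_at_sum:
  assumes V: "open V" and c: "infinitesimal_disp c" "base_point c \<in> V"
    and "\<And>i. i \<in> I \<Longrightarrow> smooth_on V (F i)"
  shows "eval_at (\<lambda>y. \<Sum>i\<in>I. F i y) c = (\<Sum>i\<in>I. eval_at (F i) c)"
proof (rule formal_eqI)
  fix D k
  show "cf D k (eval_at (\<lambda>y. \<Sum>i\<in>I. F i y) c) = cf D k (\<Sum>i\<in>I. eval_at (F i) c)"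
    unfolding cf_sum cf_eval_at[OF c(1)]
    by (subst sum.swap) (simp add: partials_sum[OF V c(2) assms(4)] sum_divide_distrib sum_distrib_right)
qed

lemma eval_at_1:
  fixes c :: "'d::finite \<Rightarrow> formal"
  assumes "infinitesimal_disp c"
  shows "eval_at (\<lambda>_. 1) c = 1"
proof (rule formal_eqI)
  fix D k
  have "cf D k (eval_at (\<lambda>_. 1) c) = (\<Sum>as :: 'd list | length as \<le> k. if as = [] then cf D k 1 else 0)"
    unfolding cf_eval_at[OF assms] by (intro sum.cong refl) (simp add: partials_const)
  also have "\<dots> = cf D k 1"
    using finite_lists_length_le[of "UNIV :: 'd set" k] by simp
  finally show "cf D k (eval_at (\<lambda>_. 1) c) = cf D k 1" .
qed

lemma eval_at_prod:
  assumes V: "open V" and c: "infinitesimal_disp c" "base_point c \<in> V" and "finite I"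
    and "\<And>i. i \<in> I \<Longrightarrow> smooth_on V (F i)"
  shows "eval_at (\<lambda>y. \<Prod>i\<in>I. F i y) c = (\<Prod>i\<in>I. eval_at (F i) c)"
  using assms(4,5)
  by (induction I rule: finite_induct) (auto simp: eval_at_1[OF c(1)] eval_at_mult[OF V _ smooth_on_prod[OF V] c])

text \<open>A coefficient of \<open>eval_at\<close> is a finite combination of derivatives at the
  base point, so the convergent series for these derivatives can be summed inside it.\<close>

lemma eval_at_partials_exp:
  assumes V: "open V" and c: "infinitesimal_disp c" "base_point c \<in> V" and g: "smooth_on V g"
  shows "has_formal_sum (\<lambda>m. cst (u ^ m / fact m) * eval_at (partials bs (\<lambda>y. g y ^ m)) c)
           (eval_at (partials bs (\<lambda>y. exp (u * g y))) c) UNIV"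
  unfolding has_formal_sum_def
proof (intro allI)
  fix D k
  let ?y = "base_point c"
  have hs: "((\<lambda>m. u ^ m / fact m * partials cs (\<lambda>y. g y ^ m) ?y) has_sum partials cs (\<lambda>y. exp (u * g y)) ?y) UNIV" for cs
    using partials_exp_has_sum[OF V g smooth_on_const[of V 1] c(2), of u cs] by simp
  have "((\<lambda>m. \<Sum>as | length as \<le> k. cf D k (\<Prod>a\<leftarrow>as. disp c a) / fact (length as) *
            (u ^ m / fact m * partials (as @ bs) (\<lambda>y. g y ^ m) ?y)) has_sum
        (\<Sum>as | length as \<le> k. cf D k (\<Prod>a\<leftarrow>as. disp c a) / fact (length as) *
            partials (as @ bs) (\<lambda>y. exp (u * g y)) ?y)) UNIV"
    by (intro has_sum_sum has_sum_cmult_right hs)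
  then show "((\<lambda>m. cf D k (cst (u ^ m / fact m) * eval_at (partials bs (\<lambda>y. g y ^ m)) c)) has_sum
         cf D k (eval_at (partials bs (\<lambda>y. exp (u * g y))) c)) UNIV"
    unfolding cf_cst_mult cf_eval_at[OF c(1)] partials_append sum_distrib_left
    by (simp add: mult_ac)
qed

subsection \<open>The Leibniz rule\<close>

text \<open>Position by position, \<open>f\<close> names the factor of a product that is hit by the
  corresponding derivative in \<open>bs\<close>; these are the derivatives that fall on the factor
  \<open>w\<close>.\<close>

definition selected :: "'w list \<Rightarrow> 'd list \<Rightarrow> 'w \<Rightarrow> 'd list" where
  "selected f bs w = map snd (filter (\<lambda>p. fst p = w) (zip f bs))"

lemma selected_Nil [simp]: "selected [] [] w = []"
  and selected_Cons [simp]: "selected (v # f) (b # bs) w = (if v = w then [b] else []) @ selected f bs w"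
  by (simp_all add: selected_def)

lemma sum_lists_Suc:
  fixes h :: "'w list \<Rightarrow> 'b::comm_monoid_add"
  shows "(\<Sum>f | length f = Suc n \<and> set f \<subseteq> W. h f) = (\<Sum>f | length f = n \<and> set f \<subseteq> W. \<Sum>w\<in>W. h (w # f))"
proof -
  have "(\<Sum>f | length f = n \<and> set f \<subseteq> W. \<Sum>w\<in>W. h (w # f)) =
      (\<Sum>(f, w)\<in>{f. length f = n \<and> set f \<subseteq> W} \<times> W. h (w # f))"
    by (simp add: sum.cartesian_product)
  also have "\<dots> = (\<Sum>f | length f = Suc n \<and> set f \<subseteq> W. h f)"
    by (rule sum.reindex_bij_witness[where i = "\<lambda>f. (tl f, hd f)" and j = "\<lambda>(f, w). w # f"])
       (auto simp: length_Suc_conv)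
  finally show ?thesis by simp
qed

lemma partial_sum_prod:
  assumes V: "open V" and y: "y \<in> V" and W: "finite W"
    and "\<And>w. w \<in> W \<Longrightarrow> smooth_on V (G w)"
  shows "partial a (\<lambda>y. \<Prod>w\<in>W. G w y) y = (\<Sum>w\<in>W. \<Prod>v\<in>W. if v = w then partial a (G v) y else G v y)"
  using W assms(4)
proof (induction W rule: finite_induct)
  case (insert x W)
  then have "partial a (\<lambda>y. \<Prod>w\<in>insert x W. G w y) y = partial a (\<lambda>y. G x y * (\<Prod>w\<in>W. G w y)) y"
    by simp
  also have "\<dots> = partial a (G x) y * (\<Prod>w\<in>W. G w y) + G x y * partial a (\<lambda>y. \<Prod>w\<in>W. G w y) y"
    using insert.prems by (intro partial_mult smooth_on_imp_differentiable[OF _ V y] smooth_on_prod V) auto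
  also have "\<dots> = (\<Sum>w\<in>insert x W. \<Prod>v\<in>insert x W. if v = w then partial a (G v) y else G v y)"
  proof -
    have "(\<Prod>v\<in>W. if v = x then partial a (G v) y else G v y) = (\<Prod>w\<in>W. G w y)"
      using insert.hyps by (intro prod.cong) auto
    moreover have "(\<Sum>w\<in>W. (if x = w then partial a (G x) y else G x y) * (\<Prod>v\<in>W. if v = w then partial a (G v) y else G v y))
      = (\<Sum>w\<in>W. G x y * (\<Prod>v\<in>W. if v = w then partial a (G v) y else G v y))"
      using insert.hyps by (intro sum.cong) auto
    ultimately show ?thesis
      using insert by (simp add: sum_distrib_left)
  qed
  finally show ?case .
qed simp

lemma finite_lists_over: "finite W \<Longrightarrow> finite {f. length f = n \<and> set f \<subseteq> W}"
  using finite_lists_length_eq[of W n] by (simp add: conj_commute)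

text \<open>Each derivative independently chooses the factor it acts on, so the Leibniz rule is a
  sum over maps from positions to factors, all with coefficient 1.\<close>

lemma partials_prod:
  assumes V: "open V" and W: "finite W" and G: "\<And>w. w \<in> W \<Longrightarrow> smooth_on V (G w)" and "y \<in> V"
  shows "partials bs (\<lambda>y. \<Prod>w\<in>W. G w y) y =
    (\<Sum>f | length f = length bs \<and> set f \<subseteq> W. \<Prod>w\<in>W. partials (selected f bs w) (G w) y)"
  using assms(4)
proof (induction bs arbitrary: y)
  case Nil
  have "{f. length f = length [] \<and> set f \<subseteq> W} = {[]}" by auto
  then show ?case by simp
next
  case (Cons b bs)
  let ?L = "{f. length f = length bs \<and> set f \<subseteq> W}"
  let ?P = "\<lambda>f w. partials (selected f bs w) (G w)"
  have sm: "smooth_on V (?P f w)" if "w \<in> W" for f w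
    using smooth_on_partials[OF G[OF that]] .
  have "partials (b # bs) (\<lambda>y. \<Prod>w\<in>W. G w y) y = partial b (\<lambda>y. \<Sum>f\<in>?L. \<Prod>w\<in>W. ?P f w y) y"
    using Cons by (auto intro: partial_cong[OF V])
  also have "\<dots> = (\<Sum>f\<in>?L. partial b (\<lambda>y. \<Prod>w\<in>W. ?P f w y) y)"
    using partials_sum[OF V Cons.prems, of ?L "\<lambda>f y. \<Prod>w\<in>W. ?P f w y" "[b]"]
    by (simp add: smooth_on_prod[OF V sm])
  also have "\<dots> = (\<Sum>f\<in>?L. \<Sum>w\<in>W. \<Prod>v\<in>W. if v = w then partial b (?P f v) y else ?P f v y)"
    by (intro sum.cong refl partial_sum_prod[OF V Cons.prems W sm])
  also have "\<dots> = (\<Sum>f\<in>?L. \<Sum>w\<in>W. \<Prod>v\<in>W. partials (selected (w # f) (b # bs) v) (G v) y)"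
    by (intro sum.cong prod.cong refl) (auto simp: partials_append)
  also have "\<dots> = (\<Sum>f | length f = length (b # bs) \<and> set f \<subseteq> W. \<Prod>w\<in>W. partials (selected f (b # bs) w) (G w) y)"
    by (simp only: sum_lists_Suc length_Cons)
  finally show ?case .
qed

text \<open>The m equal factors are named by the elements of a set. With white vertices as names,
  the factor chosen by a derivative becomes the white end of an edge.\<close>

lemma eval_at_partials_power:
  assumes V: "open V" and c: "infinitesimal_disp c" "base_point c \<in> V" and g: "smooth_on V g"
    and W: "finite W" "card W = m"
  shows "eval_at (partials bs (\<lambda>y. g y ^ m)) c =
    (\<Sum>f | length f = length bs \<and> set f \<subseteq> W. \<Prod>w\<in>W. eval_at (partials (selected f bs w) g) c)"
proof -
  have "eval_at (partials bs (\<lambda>y. g y ^ m)) c =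
      eval_at (\<lambda>y. \<Sum>f | length f = length bs \<and> set f \<subseteq> W. \<Prod>w\<in>W. partials (selected f bs w) g y) c"
    using partials_prod[OF V W(1), of "\<lambda>_. g"] g W(2) by (intro eval_at_cong[OF V c(2)]) simp
  also have "\<dots> = (\<Sum>f | length f = length bs \<and> set f \<subseteq> W. eval_at (\<lambda>y. \<Prod>w\<in>W. partials (selected f bs w) g y) c)"
    by (intro eval_at_sum[OF V c] smooth_on_prod V smooth_on_partials g)
  also have "\<dots> = (\<Sum>f | length f = length bs \<and> set f \<subseteq> W. \<Prod>w\<in>W. eval_at (partials (selected f bs w) g) c)"
    by (intro sum.cong refl eval_at_prod[OF V c W(1)] smooth_on_partials g)
  finally show ?thesis .
qed

lemma eval_at_partials_mset_eq:
  assumes V: "open V" and c: "base_point c \<in> V" and g: "smooth_on V g" and "mset as = mset bs"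
  shows "eval_at (partials as g) c = eval_at (partials bs g) c"
  by (rule eval_at_cong[OF V c]) (rule partials_mset_eq[OF V g _ assms(4)])

section \<open>The exponential formula for bipartite graphs\<close>

text \<open>Components of a standard graph are not labelled by initial segments, so vertex sets are
  allowed to be arbitrary finite sets of nonzero integers, and the sign alone records the
  colour.\<close>

definition pos :: "int set \<Rightarrow> int set" where "pos V = {v \<in> V. 0 < v}"
definition neg :: "int set \<Rightarrow> int set" where "neg V = {v \<in> V. v < 0}"

definition standard_verts :: "nat \<Rightarrow> nat \<Rightarrow> int set" where
  "standard_verts n m = {1..int n} \<union> {- int m..-1}"

definition relabel :: "(int \<Rightarrow> int) \<Rightarrow> (int \<times> int) multiset \<Rightarrow> (int \<times> int) multiset" where
  "relabel \<pi> E = image_mset (map_prod \<pi> \<pi>) E"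

definition admissible :: "int set \<Rightarrow> (int \<times> int) multiset \<Rightarrow> bool" where
  "admissible V E \<longleftrightarrow> set_mset E \<subseteq> pos V \<times> neg V \<and>
     (\<forall>v\<in>pos V. size (filter_mset (attached v) E) \<noteq> 1)"

definition sign_bij :: "(int \<Rightarrow> int) \<Rightarrow> int set \<Rightarrow> int set \<Rightarrow> bool" where
  "sign_bij \<pi> V V' \<longleftrightarrow> bij_betw \<pi> V V' \<and> (\<forall>v\<in>V. sgn (\<pi> v) = sgn v)"

lemma pos_subset: "pos V \<subseteq> V" and neg_subset: "neg V \<subseteq> V"
  by (auto simp: pos_def neg_def)

lemma pos_neg_disjoint: "pos V \<inter> neg V' = {}"
  by (auto simp: pos_def neg_def)

lemma pos_Un: "pos (V \<union> V') = pos V \<union> pos V'" and neg_Un: "neg (V \<union> V') = neg V \<union> neg V'"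
  by (auto simp: pos_def neg_def)

lemma pos_standard [simp]: "pos (standard_verts n m) = {1..int n}"
  and neg_standard [simp]: "neg (standard_verts n m) = {- int m..-1}"
  by (auto simp: pos_def neg_def standard_verts_def)

lemma finite_standard [simp]: "finite (standard_verts n m)"
  by (simp add: standard_verts_def)

lemma verts_BGraph [simp]: "verts (BGraph n m E) = standard_verts n m"
  by (simp add: verts_def blacks_def whites_def standard_verts_def)

lemma blacks_eq_pos: "blacks G = pos (verts G)" and whites_eq_neg: "whites G = neg (verts G)"
  by (cases G; simp add: blacks_def whites_def)+

lemma sgn_pos_iff: "sgn (a::int) = sgn b \<Longrightarrow> (0 < a \<longleftrightarrow> 0 < b) \<and> (a < 0 \<longleftrightarrow> b < 0)"
  by (metis sgn_less sgn_greater)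

lemma sign_bij_pos: "sign_bij \<pi> V V' \<Longrightarrow> \<pi> ` pos V = pos V'"
  and sign_bij_neg: "sign_bij \<pi> V V' \<Longrightarrow> \<pi> ` neg V = neg V'"
proof -
  assume "sign_bij \<pi> V V'"
  then have V': "V' = \<pi> ` V" and "\<And>v. v \<in> V \<Longrightarrow> (0 < \<pi> v \<longleftrightarrow> 0 < v) \<and> (\<pi> v < 0 \<longleftrightarrow> v < 0)"
    using sgn_pos_iff unfolding sign_bij_def bij_betw_def by blast+
  then show "\<pi> ` pos V = pos V'" "\<pi> ` neg V = neg V'"
    unfolding V' pos_def neg_def by auto
qed

lemma sign_bij_inv: 
  assumes "sign_bij \<pi> V V'" shows "sign_bij (inv_into V \<pi>) V' V"
  unfolding sign_bij_def
proof
  show "bij_betw (inv_into V \<pi>) V' V"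
    using assms bij_betw_inv_into unfolding sign_bij_def by blast
  show "\<forall>v\<in>V'. sgn (inv_into V \<pi> v) = sgn v"
  proof
    fix v assume "v \<in> V'"
    then have "inv_into V \<pi> v \<in> V" "\<pi> (inv_into V \<pi> v) = v"
      using assms unfolding sign_bij_def bij_betw_def by (auto intro: inv_into_into f_inv_into_f)
    then show "sgn (inv_into V \<pi> v) = sgn v"
      using assms unfolding sign_bij_def by metis
  qed
qed

lemma sign_bij_exists:
  assumes "finite V" "0 \<notin> V"
  shows "\<exists>\<pi>. sign_bij \<pi> (standard_verts (card (pos V)) (card (neg V))) V"
proof -
  have fin: "finite (pos V)" "finite (neg V)" using assms by (auto simp: pos_def neg_def)
  have "card {1..int (card (pos V))} = card (pos V)" "card {- int (card (neg V))..-1} = card (neg V)"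
    by simp_all
  then obtain f g where f: "bij_betw f {1..int (card (pos V))} (pos V)"
    and g: "bij_betw g {- int (card (neg V))..-1} (neg V)"
    using fin finite_same_card_bij by (metis finite_atLeastAtMost_int)
  define \<pi> where "\<pi> v = (if 0 < v then f v else g v)" for v :: int
  have "bij_betw \<pi> {1..int (card (pos V))} (pos V)"
    using f by (subst bij_betw_cong[where g = f]) (auto simp: \<pi>_def)
  moreover have "bij_betw \<pi> {- int (card (neg V))..-1} (neg V)"
    using g by (subst bij_betw_cong[where g = g]) (auto simp: \<pi>_def)
  moreover have V: "pos V \<union> neg V = V" using assms(2) by (auto simp: pos_def neg_def) (metis linorder_neqE_linordered_idom)
  ultimately have "bij_betw \<pi> (standard_verts (card (pos V)) (card (neg V))) V"
    using bij_betw_combine[of \<pi> "{1..int (card (pos V))}" "pos V" "{- int (card (neg V))..-1}" "neg V"]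
      pos_neg_disjoint[of V V] unfolding standard_verts_def by simp
  moreover have "sgn (\<pi> v) = sgn v" if "v \<in> standard_verts (card (pos V)) (card (neg V))" for v
  proof (cases "0 < v")
    case True
    then have "v \<in> {1..int (card (pos V))}" using that by (simp add: standard_verts_def)
    then have "f v \<in> pos V" using bij_betwE[OF f] by blast
    then show ?thesis using True by (simp add: \<pi>_def pos_def)
  next
    case False
    then have v: "v \<in> {- int (card (neg V))..-1}" using that by (simp add: standard_verts_def)
    then have "g v \<in> neg V" "v < 0" using bij_betwE[OF g] by (blast, simp)
    then show ?thesis by (simp add: \<pi>_def neg_def)
  qed
  ultimately show ?thesis unfolding sign_bij_def by blast
qed

text \<open>The choice is arbitrary; it only has to depend on the vertex set alone, so that merging
  two graphs and splitting them again use the same relabelling.\<close>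

definition standard_map :: "int set \<Rightarrow> int \<Rightarrow> int" where
  "standard_map V = (SOME \<pi>. sign_bij \<pi> (standard_verts (card (pos V)) (card (neg V))) V)"

lemma sign_bij_standard_map:
  "finite V \<Longrightarrow> 0 \<notin> V \<Longrightarrow>
     sign_bij (standard_map V) (standard_verts (card (pos V)) (card (neg V))) V"
  unfolding standard_map_def using sign_bij_exists by (rule someI_ex)

lemma edges_in_verts: "set_mset E \<subseteq> pos V \<times> neg V \<Longrightarrow> set_mset E \<subseteq> V \<times> V"
  using pos_subset neg_subset by blast

lemma relabel_id: "(\<And>e. e \<in># E \<Longrightarrow> map_prod \<pi> \<pi> (map_prod \<rho> \<rho> e) = e) \<Longrightarrow> relabel \<pi> (relabel \<rho> E) = E"
  unfolding relabel_def multiset.map_comp by (simp add: multiset.map_ident_strong)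

lemma relabel_relabel_inv:
  assumes "sign_bij \<pi> V V'" "set_mset E \<subseteq> pos V' \<times> neg V'"
  shows "relabel \<pi> (relabel (inv_into V \<pi>) E) = E"
proof (rule relabel_id)
  fix e assume "e \<in># E"
  then have "e \<in> V' \<times> V'" using edges_in_verts[OF assms(2)] by blast
  moreover have "V' = \<pi> ` V" using assms(1) by (simp add: sign_bij_def bij_betw_def)
  ultimately show "map_prod \<pi> \<pi> (map_prod (inv_into V \<pi>) (inv_into V \<pi>) e) = e"
    by (cases e) (simp add: f_inv_into_f)
qed

lemma relabel_inv_relabel:
  assumes "sign_bij \<pi> V V'" "set_mset E \<subseteq> pos V \<times> neg V"
  shows "relabel (inv_into V \<pi>) (relabel \<pi> E) = E"
proof (rule relabel_id)
  fix e assume "e \<in># E"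
  then have "e \<in> V \<times> V" using edges_in_verts[OF assms(2)] by blast
  moreover have "inj_on \<pi> V" using assms(1) by (simp add: sign_bij_def bij_betw_def)
  ultimately show "map_prod (inv_into V \<pi>) (inv_into V \<pi>) (map_prod \<pi> \<pi> e) = e"
    by (cases e) simp
qed

lemma filter_attached_relabel:
  assumes "inj_on \<pi> V" "set_mset E \<subseteq> V \<times> V" "v \<in> V"
  shows "filter_mset (attached (\<pi> v)) (relabel \<pi> E) = relabel \<pi> (filter_mset (attached v) E)"
proof -
  have "attached (\<pi> v) (map_prod \<pi> \<pi> e) \<longleftrightarrow> attached v e" if "e \<in># E" for e
    using that assms by (cases e) (auto simp: attached_def inj_on_eq_iff)
  then show ?thesis
    unfolding relabel_def filter_mset_image_mset by (metis (mono_tags, lifting) comp_apply filter_mset_cong)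
qed

lemma admissible_relabel:
  assumes \<pi>: "sign_bij \<pi> V V'" and E: "admissible V E"
  shows "admissible V' (relabel \<pi> E)"
  unfolding admissible_def
proof
  show "set_mset (relabel \<pi> E) \<subseteq> pos V' \<times> neg V'"
    using E unfolding admissible_def relabel_def sign_bij_pos[OF \<pi>, symmetric] sign_bij_neg[OF \<pi>, symmetric]
    by auto
  have inj: "inj_on \<pi> V" using \<pi> by (simp add: sign_bij_def bij_betw_def)
  have EV: "set_mset E \<subseteq> V \<times> V" using E edges_in_verts unfolding admissible_def by blast
  show "\<forall>v\<in>pos V'. size (filter_mset (attached v) (relabel \<pi> E)) \<noteq> 1"
    using E filter_attached_relabel[OF inj EV] pos_subset
    unfolding sign_bij_pos[OF \<pi>, symmetric] admissible_def
    by (auto simp: relabel_def) (metis filter_attached_relabel[OF inj EV] One_nat_def relabel_def size_image_mset subsetD)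
qed

lemma filter_attached_outside:
  assumes "set_mset E \<subseteq> V \<times> V" "v \<notin> V"
  shows "filter_mset (attached v) E = {#}"
  using assms by (auto simp: filter_mset_eq_mempty_iff attached_def)

lemma admissible_Un:
  assumes "V1 \<inter> V2 = {}" "admissible V1 E1" "admissible V2 E2"
  shows "admissible (V1 \<union> V2) (E1 + E2)"
proof -
  have sub: "set_mset E1 \<subseteq> V1 \<times> V1" "set_mset E2 \<subseteq> V2 \<times> V2"
    using assms edges_in_verts unfolding admissible_def by blast+
  have "size (filter_mset (attached v) (E1 + E2)) \<noteq> 1" if "v \<in> pos V1 \<union> pos V2" for v
  proof (cases "v \<in> V1")
    case True
    then have "filter_mset (attached v) E2 = {#}" "v \<in> pos V1"
      using filter_attached_outside[OF sub(2)] assms(1) that pos_subset by (auto simp: pos_def)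
    then show ?thesis using assms(2) unfolding admissible_def filter_union_mset by (metis add_0_right)
  next
    case False
    then have "filter_mset (attached v) E1 = {#}" "v \<in> pos V2"
      using filter_attached_outside[OF sub(1)] that by (auto simp: pos_def)
    then show ?thesis using assms(3) unfolding admissible_def filter_union_mset by (metis add_0_left)
  qed
  then show ?thesis
    using assms(2,3) unfolding admissible_def pos_Un neg_Un by auto
qed

subsection \<open>Connected components\<close>

definition adj :: "(int \<times> int) multiset \<Rightarrow> (int \<times> int) set" where
  "adj E = set_mset E \<union> (set_mset E)\<inverse>"

text \<open>The classes are generated by vertices and not by edges, so an isolated vertex is a
  component and the empty graph has none.\<close>

definition components :: "int set \<Rightarrow> (int \<times> int) multiset \<Rightarrow> int set set" where
  "components V E = (\<lambda>v. (adj E)\<^sup>* `` {v}) ` V"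

lemma sym_adj: "sym ((adj E)\<^sup>*)"
  by (rule sym_rtrancl) (auto simp: adj_def sym_def)

lemma adj_rtrancl_invariant:
  assumes "(u, v) \<in> (adj E)\<^sup>*" "\<And>a b. (a, b) \<in># E \<Longrightarrow> a \<in> K \<longleftrightarrow> b \<in> K" "u \<in> K"
  shows "v \<in> K"
  using assms(1,3) by (induction rule: rtrancl_induct) (use assms(2) in \<open>auto simp: adj_def\<close>)

lemma component_subset:
  assumes "K \<in> components V E" "set_mset E \<subseteq> V \<times> V"
  shows "K \<subseteq> V" "K \<noteq> {}"
proof -
  obtain v where v: "v \<in> V" "K = (adj E)\<^sup>* `` {v}" using assms(1) by (auto simp: components_def)
  then show "K \<noteq> {}" by auto
  show "K \<subseteq> V"
    using adj_rtrancl_invariant[of v _ E V] v assms(2) by blast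
qed

lemma components_disjoint:
  assumes "K \<in> components V E" "K' \<in> components V E" "v \<in> K" "v \<in> K'"
  shows "K = K'"
proof -
  obtain a b where ab: "K = (adj E)\<^sup>* `` {a}" "K' = (adj E)\<^sup>* `` {b}"
    using assms by (auto simp: components_def)
  then have "(a, v) \<in> (adj E)\<^sup>*" "(b, v) \<in> (adj E)\<^sup>*" using assms by auto
  then have "(a, b) \<in> (adj E)\<^sup>*" "(b, a) \<in> (adj E)\<^sup>*"
    using sym_adj[of E] by (meson rtrancl_trans symD)+
  then show ?thesis unfolding ab by (auto intro: rtrancl_trans)
qed

lemma component_closed:
  assumes "K \<in> components V E" "(a, b) \<in># E"
  shows "a \<in> K \<longleftrightarrow> b \<in> K"
proof -
  have "(a, b) \<in> adj E" "(b, a) \<in> adj E" using assms(2) by (auto simp: adj_def)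
  then show ?thesis using assms(1) by (auto simp: components_def intro: rtrancl_into_rtrancl)
qed

lemma components_Un:
  assumes "V1 \<inter> V2 = {}" "set_mset E1 \<subseteq> V1 \<times> V1" "set_mset E2 \<subseteq> V2 \<times> V2"
  shows "components (V1 \<union> V2) (E1 + E2) = components V1 E1 \<union> components V2 E2"
proof -
  \<comment> \<open>A path that starts in \<open>V1\<close> never leaves it, because no edge of
    \<open>E2\<close> has an end there. The claim is kept general so that it also applies with the
    two pieces exchanged.\<close>
  have *: "(adj (E1 + E2))\<^sup>* `` {v} = (adj E1)\<^sup>* `` {v}"
    if "V1 \<inter> V2 = {}" "set_mset E1 \<subseteq> V1 \<times> V1" "set_mset E2 \<subseteq> V2 \<times> V2" "v \<in> V1" for v V1 V2 E1 E2
  proof -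
    have "(v, w) \<in> (adj E1)\<^sup>* \<and> w \<in> V1" if "(v, w) \<in> (adj (E1 + E2))\<^sup>*" for w
      using that
    proof (induction rule: rtrancl_induct)
      case (step y z)
      then have "(y, z) \<in> adj E1"
        using \<open>V1 \<inter> V2 = {}\<close> \<open>set_mset E2 \<subseteq> V2 \<times> V2\<close> by (auto simp: adj_def)
      then show ?case using step \<open>set_mset E1 \<subseteq> V1 \<times> V1\<close> by (auto simp: adj_def intro: rtrancl_into_rtrancl)
    qed (use \<open>v \<in> V1\<close> in auto)
    moreover have "(v, w) \<in> (adj (E1 + E2))\<^sup>*" if "(v, w) \<in> (adj E1)\<^sup>*" for w
      using that rtrancl_mono[of "adj E1" "adj (E1 + E2)"] by (auto simp: adj_def)
    ultimately show ?thesis by auto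
  qed
  have "(adj (E1 + E2))\<^sup>* `` {v} = (adj E2)\<^sup>* `` {v}" if "v \<in> V2" for v
    using *[of V2 V1 E2 E1 v] assms that by (simp add: add.commute Int_commute)
  then show ?thesis
    using *[OF assms] unfolding components_def image_Un by simp
qed

lemma components_relabel:
  assumes "inj_on \<pi> V" "set_mset E \<subseteq> V \<times> V"
  shows "components (\<pi> ` V) (relabel \<pi> E) = (`) \<pi> ` components V E"
proof -
  have "(adj (relabel \<pi> E))\<^sup>* `` {\<pi> v} = \<pi> ` ((adj E)\<^sup>* `` {v})" if v: "v \<in> V" for v
  proof (intro equalityI subsetI)
    fix w assume "w \<in> (adj (relabel \<pi> E))\<^sup>* `` {\<pi> v}"
    then have "(\<pi> v, w) \<in> (adj (relabel \<pi> E))\<^sup>*" by simp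
    then show "w \<in> \<pi> ` ((adj E)\<^sup>* `` {v})"
    proof (induction rule: rtrancl_induct)
      case (step y z)
      then obtain y' where y': "y = \<pi> y'" "(v, y') \<in> (adj E)\<^sup>*" by auto
      have "y' \<in> V" using adj_rtrancl_invariant[OF y'(2), of V] assms(2) v by blast
      moreover obtain a b where ab: "(a, b) \<in> adj E" "y = \<pi> a" "z = \<pi> b"
        using step(2) by (auto simp: adj_def relabel_def)
      moreover have "a \<in> V" "b \<in> V" using ab(1) assms(2) by (auto simp: adj_def)
      ultimately have "(y', b) \<in> adj E" using y'(1) assms(1) by (metis inj_on_eq_iff)
      then show ?case using y'(2) ab(3) by (auto intro: rtrancl_into_rtrancl)
    qed auto
  next
    fix w assume "w \<in> \<pi> ` ((adj E)\<^sup>* `` {v})"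
    then obtain w' where w': "w = \<pi> w'" "(v, w') \<in> (adj E)\<^sup>*" by auto
    have "(\<pi> v, \<pi> w') \<in> (adj (relabel \<pi> E))\<^sup>*"
      using w'(2)
    proof (induction rule: rtrancl_induct)
      case (step y z)
      then have "(\<pi> y, \<pi> z) \<in> adj (relabel \<pi> E)"
        by (auto simp: adj_def relabel_def image_iff) (force+)
      then show ?case using step by (auto intro: rtrancl_into_rtrancl)
    qed auto
    then show "w \<in> (adj (relabel \<pi> E))\<^sup>* `` {\<pi> v}" using w' by simp
  qed
  then show ?thesis
    unfolding components_def image_image by (intro image_cong refl) simp
qed

lemma card_components_relabel:
  assumes "inj_on \<pi> V" "set_mset E \<subseteq> V \<times> V"
  shows "card (components (\<pi> ` V) (relabel \<pi> E)) = card (components V E)"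
  unfolding components_relabel[OF assms]
  using component_subset(1)[OF _ assms(2)] inj_on_image_Pow[OF assms(1)]
  by (intro card_image) (meson PowI inj_on_subset subsetI)

text \<open>Testing the black end suffices: a union of components contains both ends of an edge or
  neither.\<close>

definition restrict_edges :: "int set \<Rightarrow> (int \<times> int) multiset \<Rightarrow> (int \<times> int) multiset" where
  "restrict_edges K E = filter_mset (\<lambda>e. fst e \<in> K) E"

text \<open>No edge joins the component to the rest, so every black vertex keeps its valence and the
  leaf condition passes to both pieces.\<close>

lemma split_at_component:
  assumes E: "admissible V E" and K: "K \<in> components V E"
  defines "E1 \<equiv> restrict_edges K E" and "E2 \<equiv> restrict_edges (V - K) E"
  shows "E = E1 + E2" "admissible K E1" "admissible (V - K) E2"
    "components K E1 = {K}" "components (V - K) E2 = components V E - {K}"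
proof -
  have sub: "set_mset E \<subseteq> V \<times> V" using E edges_in_verts unfolding admissible_def by blast
  have KV: "K \<subseteq> V" "K \<noteq> {}" using component_subset[OF K sub] by auto
  have "E = filter_mset (\<lambda>e. fst e \<in> K) E + filter_mset (\<lambda>e. \<not> fst e \<in> K) E"
    by (rule multiset_partition)
  also have "filter_mset (\<lambda>e. \<not> fst e \<in> K) E = E2"
    unfolding E2_def restrict_edges_def using sub by (intro filter_mset_cong) auto
  finally show EE: "E = E1 + E2" by (simp add: E1_def restrict_edges_def)
  have s1: "set_mset E1 \<subseteq> pos K \<times> neg K"
    using E component_closed[OF K] KV unfolding E1_def restrict_edges_def admissible_def
    by (auto simp: pos_def neg_def)
  have s2: "set_mset E2 \<subseteq> pos (V - K) \<times> neg (V - K)"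
    using E component_closed[OF K] KV unfolding E2_def restrict_edges_def admissible_def
    by (auto simp: pos_def neg_def)
  note s1' = edges_in_verts[OF s1] and s2' = edges_in_verts[OF s2]
  show "admissible K E1"
    unfolding admissible_def
  proof (intro conjI ballI s1)
    fix v assume v: "v \<in> pos K"
    then have "filter_mset (attached v) E2 = {#}"
      using filter_attached_outside[OF s2'] by (auto simp: pos_def)
    then show "size (filter_mset (attached v) E1) \<noteq> 1"
      using E v KV unfolding EE admissible_def by (auto simp: pos_def)
  qed
  show "admissible (V - K) E2"
    unfolding admissible_def
  proof (intro conjI ballI s2)
    fix v assume v: "v \<in> pos (V - K)"
    then have "filter_mset (attached v) E1 = {#}"
      using filter_attached_outside[OF s1'] by (auto simp: pos_def)
    then show "size (filter_mset (attached v) E2) \<noteq> 1"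
      using E v KV unfolding EE admissible_def by (auto simp: pos_def)
  qed
  have U: "components V E = components K E1 \<union> components (V - K) E2"
  proof -
    have "K \<union> (V - K) = V" using KV by auto
    then show ?thesis using components_Un[OF _ s1' s2'] EE by simp
  qed
  have "X = K" if "X \<in> components K E1" for X
    using components_disjoint[OF _ K, of X] component_subset[OF that s1'] that U by blast
  moreover have "components K E1 \<noteq> {}" using KV by (simp add: components_def)
  ultimately show C1: "components K E1 = {K}" by blast
  have "K \<notin> components (V - K) E2" using component_subset(1)[OF _ s2', of K] KV by auto
  then show "components (V - K) E2 = components V E - {K}" using U C1 by blast
qed

lemma split_at_component_inverse:
  assumes "K \<inter> L = {}" "admissible K E1" "admissible L E2" "components K E1 = {K}"
  shows "restrict_edges K (E1 + E2) = E1" "restrict_edges L (E1 + E2) = E2"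
    "components (K \<union> L) (E1 + E2) = insert K (components L E2)" "K \<notin> components L E2"
proof -
  have s: "set_mset E1 \<subseteq> K \<times> K" "set_mset E2 \<subseteq> L \<times> L"
    using assms edges_in_verts unfolding admissible_def by blast+
  have "filter_mset (\<lambda>e. fst e \<in> X) E = {#}" if "set_mset E \<subseteq> Y \<times> Y" "X \<inter> Y = {}" for E X and Y :: "int set"
    using that by (auto simp: filter_mset_eq_mempty_iff)
  moreover have "filter_mset (\<lambda>e. fst e \<in> X) E = E" if "set_mset E \<subseteq> X \<times> X" for E and X :: "int set"
    using that by (auto simp: filter_mset_eq_conv)
  ultimately show "restrict_edges K (E1 + E2) = E1" "restrict_edges L (E1 + E2) = E2"
    using s assms(1) unfolding restrict_edges_def by (simp_all add: Int_commute)
  show "components (K \<union> L) (E1 + E2) = insert K (components L E2)"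
    using components_Un[OF assms(1) s] assms(4) by simp
  have "K \<noteq> {}" using assms(4) by (auto simp: components_def)
  then show "K \<notin> components L E2" using component_subset(1)[OF _ s(2)] assms(1) by blast
qed

lemma all_graphs_iff: "G \<in> all_graphs \<longleftrightarrow> admissible (verts G) (edges G)"
proof -
  have "v \<in> whites G \<longleftrightarrow> v \<notin> blacks G" if "v \<in> verts G" for v
    using that by (auto simp: verts_def blacks_def whites_def)
  then show ?thesis
    unfolding all_graphs_def admissible_def bipartite_def valence_def blacks_eq_pos[symmetric] whites_eq_neg[symmetric]
    by (auto simp: verts_def)
qed

lemma adjacent_eq_adj: "adjacent G = adj (edges G)"
  by (simp add: adjacent_def adj_def)

text \<open>The empty vertex set has no component at all, so the equation on the right excludes the
  empty graph, as \<open>connected_graph\<close> does.\<close>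

lemma connected_graphs_iff:
  "G \<in> connected_graphs \<longleftrightarrow>
     admissible (verts G) (edges G) \<and> components (verts G) (edges G) = {verts G}"
proof -
  have "connected_graph G \<longleftrightarrow> components (verts G) (edges G) = {verts G}"
    if E: "admissible (verts G) (edges G)"
  proof
    assume c: "connected_graph G"
    have sub: "(adj (edges G))\<^sup>* `` {v} \<subseteq> verts G" if "v \<in> verts G" for v
      using component_subset(1)[of _ "verts G" "edges G"] that edges_in_verts E
      unfolding components_def admissible_def by blast
    then have "(adj (edges G))\<^sup>* `` {v} = verts G" if "v \<in> verts G" for v
      using that c unfolding connected_graph_def adjacent_eq_adj by blast
    then show "components (verts G) (edges G) = {verts G}"
      using c unfolding components_def connected_graph_def by auto
  next
    assume c: "components (verts G) (edges G) = {verts G}"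
    then have "(adj (edges G))\<^sup>* `` {v} = verts G" if "v \<in> verts G" for v
      using that by (metis components_def image_eqI singletonD)
    moreover have "verts G \<noteq> {}" using c by (auto simp: components_def)
    ultimately show "connected_graph G"
      unfolding connected_graph_def adjacent_eq_adj by blast
  qed
  then show ?thesis unfolding connected_graphs_def all_graphs_iff by blast
qed

section \<open>Splitting off a marked component\<close>

definition graphs_with :: "nat \<Rightarrow> bgraph set" where
  "graphs_with k = {G \<in> all_graphs. card (components (verts G) (edges G)) = k}"

lemma finite_verts [simp]: "finite (verts G)"
  by (cases G) simp

lemma finite_components: "finite V \<Longrightarrow> finite (components V E)"
  by (simp add: components_def)

text \<open>The label set \<open>K\<close> of the first graph is the only freedom in merging two
  standard graphs, since \<open>standard_map\<close> then fixes both relabellings. Black and white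
  labels are chosen separately, which gives a product of two binomial coefficients.\<close>

definition pair_labellings :: "bgraph \<times> bgraph \<Rightarrow> int set set" where
  "pair_labellings = (\<lambda>(G1, G2).
     {K. K \<subseteq> standard_verts (num_black G1 + num_black G2) (num_white G1 + num_white G2) \<and>
         card (pos K) = num_black G1 \<and> card (neg K) = num_white G1})"

lemma card_pos_neg_subsets:
  "card {K. K \<subseteq> standard_verts n m \<and> card (pos K) = i \<and> card (neg K) = j} = (n choose i) * (m choose j)"
proof -
  let ?X = "{K. K \<subseteq> standard_verts n m \<and> card (pos K) = i \<and> card (neg K) = j}"
  let ?Y = "{A. A \<subseteq> {1..int n} \<and> card A = i} \<times> {B. B \<subseteq> {- int m..-1} \<and> card B = j}"
  have "bij_betw (\<lambda>K. (pos K, neg K)) ?X ?Y"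
  proof (rule bij_betwI[where g = "\<lambda>(A, B). A \<union> B"])
    show "(\<lambda>(A, B). A \<union> B) \<in> ?Y \<rightarrow> ?X"
    proof
      fix p assume "p \<in> ?Y"
      then obtain A B where p: "p = (A, B)" "A \<subseteq> {1..int n}" "card A = i" "B \<subseteq> {- int m..-1}" "card B = j"
        by auto
      have "pos (A \<union> B) = A" "neg (A \<union> B) = B" using p by (force simp: pos_def neg_def)+
      then show "(case p of (A, B) \<Rightarrow> A \<union> B) \<in> ?X"
        using p by (auto simp: standard_verts_def)
    qed
    show "(case (pos K, neg K) of (A, B) \<Rightarrow> A \<union> B) = K" if "K \<in> ?X" for K
      using that by (force simp: pos_def neg_def standard_verts_def)
    show "(pos (case p of (A, B) \<Rightarrow> A \<union> B), neg (case p of (A, B) \<Rightarrow> A \<union> B)) = p" if "p \<in> ?Y" for p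
      using that by (force simp: pos_def neg_def)
    show "(\<lambda>K. (pos K, neg K)) \<in> ?X \<rightarrow> ?Y"
      by (force simp: pos_def neg_def standard_verts_def)
  qed
  then have "card ?X = card ?Y"
    by (rule bij_betw_same_card)
  then show ?thesis
    unfolding card_cartesian_product n_subsets[OF finite_atLeastAtMost_int] by simp
qed

lemma card_pair_labellings:
  "card (pair_labellings (G1, G2)) =
     (num_black G1 + num_black G2 choose num_black G1) * (num_white G1 + num_white G2 choose num_white G1)"
  by (simp only: pair_labellings_def prod.case card_pos_neg_subsets)

lemma finite_pair_labellings: "finite (pair_labellings p)"
proof -
  have "finite {K. K \<subseteq> standard_verts n m \<and> P K}" for n m P
    by (rule finite_subset[of _ "Pow (standard_verts n m)"]) auto
  then show ?thesis by (simp only: pair_labellings_def case_prod_unfold)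
qed

lemma card_pos_neg_Diff:
  assumes "K \<subseteq> standard_verts n m"
  shows "card (pos (standard_verts n m - K)) = n - card (pos K)" "card (neg (standard_verts n m - K)) = m - card (neg K)"
    "card (pos K) \<le> n" "card (neg K) \<le> m"
proof -
  have e: "pos (standard_verts n m - K) = {1..int n} - pos K" "neg (standard_verts n m - K) = {- int m..-1} - neg K"
    using pos_standard[of n m] neg_standard[of n m] unfolding pos_def neg_def by auto
  have s: "pos K \<subseteq> {1..int n}" "neg K \<subseteq> {- int m..-1}"
    using assms pos_standard[of n m] neg_standard[of n m] unfolding pos_def neg_def by auto
  have fin: "finite (pos K)" "finite (neg K)"
    by (rule finite_subset[OF s(1)], simp) (rule finite_subset[OF s(2)], simp)
  show "card (pos (standard_verts n m - K)) = n - card (pos K)" "card (neg (standard_verts n m - K)) = m - card (neg K)"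
    unfolding e card_Diff_subset[OF fin(1) s(1)] card_Diff_subset[OF fin(2) s(2)] by simp_all
  show "card (pos K) \<le> n" "card (neg K) \<le> m"
  proof -
    have "card (pos K) \<le> card {1..int n}" "card (neg K) \<le> card {- int m..-1}"
      by (rule card_mono[OF _ s(1)], simp) (rule card_mono[OF _ s(2)], simp)
    then show "card (pos K) \<le> n" "card (neg K) \<le> m" by simp_all
  qed
qed

text \<open>Pairs of a graph and one of its components correspond to pairs of a connected graph and a
  graph with one component less, together with a choice of the labels of the former.\<close>

definition merge :: "(bgraph \<times> bgraph) \<times> int set \<Rightarrow> bgraph \<times> int set" where
  "merge = (\<lambda>((G1, G2), K).
     let n = num_black G1 + num_black G2; m = num_white G1 + num_white G2 in
     (BGraph n m (relabel (standard_map K) (edges G1) +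
                  relabel (standard_map (standard_verts n m - K)) (edges G2)), K))"

definition standard_graph :: "int set \<Rightarrow> (int \<times> int) multiset \<Rightarrow> bgraph" where
  "standard_graph K E = (let n = card (pos K); m = card (neg K) in
     BGraph n m (relabel (inv_into (standard_verts n m) (standard_map K)) (restrict_edges K E)))"

definition unmerge :: "bgraph \<times> int set \<Rightarrow> (bgraph \<times> bgraph) \<times> int set" where
  "unmerge = (\<lambda>(G, K). ((standard_graph K (edges G), standard_graph (verts G - K) (edges G)), K))"

lemma sign_bij_standard_map':
  assumes "K \<subseteq> standard_verts n m"
  shows "sign_bij (standard_map K) (standard_verts (card (pos K)) (card (neg K))) K"
proof (rule sign_bij_standard_map)
  show "finite K" by (rule finite_subset[OF assms finite_standard])
  show "0 \<notin> K" using assms by (auto simp: standard_verts_def)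
qed

lemma sign_bij_components:
  assumes "sign_bij \<pi> V V'" "admissible V E"
  shows "components V' (relabel \<pi> E) = (`) \<pi> ` components V E"
    "card (components V' (relabel \<pi> E)) = card (components V E)"
proof -
  have \<pi>: "inj_on \<pi> V" "V' = \<pi> ` V" using assms(1) by (auto simp: sign_bij_def bij_betw_def)
  have E: "set_mset E \<subseteq> V \<times> V" using assms(2) edges_in_verts unfolding admissible_def by blast
  show "components V' (relabel \<pi> E) = (`) \<pi> ` components V E"
    unfolding \<pi>(2) by (rule components_relabel[OF \<pi>(1) E])
  show "card (components V' (relabel \<pi> E)) = card (components V E)"
    unfolding \<pi>(2) by (rule card_components_relabel[OF \<pi>(1) E])
qed

lemma merge_obtain:
  assumes "G1 \<in> all_graphs" "G2 \<in> all_graphs" and K: "K \<in> pair_labellings (G1, G2)"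
  obtains n m L E1 E2 where "n = num_black G1 + num_black G2" "m = num_white G1 + num_white G2"
    "merge ((G1, G2), K) = (BGraph n m (E1 + E2), K)"
    "K \<inter> L = {}" "K \<union> L = standard_verts n m" "L = standard_verts n m - K" "finite K" "finite L"
    "sign_bij (standard_map K) (verts G1) K" "sign_bij (standard_map L) (verts G2) L"
    "E1 = relabel (standard_map K) (edges G1)" "E2 = relabel (standard_map L) (edges G2)"
    "admissible K E1" "admissible L E2"
    "standard_verts (card (pos K)) (card (neg K)) = verts G1"
    "standard_verts (card (pos L)) (card (neg L)) = verts G2"
    "card (pos K) = num_black G1" "card (neg K) = num_white G1"
    "card (pos L) = num_black G2" "card (neg L) = num_white G2"
proof -
  define n where "n = num_black G1 + num_black G2"
  define m where "m = num_white G1 + num_white G2"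
  define L where "L = standard_verts n m - K"
  define E1 where "E1 = relabel (standard_map K) (edges G1)"
  define E2 where "E2 = relabel (standard_map L) (edges G2)"
  have merge: "merge ((G1, G2), K) = (BGraph n m (E1 + E2), K)"
    by (simp add: merge_def Let_def n_def m_def L_def E1_def E2_def)
  have KV: "K \<subseteq> standard_verts n m" and cK: "card (pos K) = num_black G1" "card (neg K) = num_white G1"
    using K by (auto simp: pair_labellings_def n_def m_def)
  have LV: "L \<subseteq> standard_verts n m" and KL: "K \<inter> L = {}" "K \<union> L = standard_verts n m"
    using KV by (auto simp: L_def)
  have cL: "card (pos L) = num_black G2" "card (neg L) = num_white G2"
    using card_pos_neg_Diff[OF KV] cK by (auto simp: L_def n_def m_def)
  have v: "standard_verts (card (pos K)) (card (neg K)) = verts G1" "standard_verts (card (pos L)) (card (neg L)) = verts G2"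
    unfolding cK cL by (metis bgraph.collapse verts_BGraph)+
  note s1 = sign_bij_standard_map'[OF KV, unfolded v] and s2 = sign_bij_standard_map'[OF LV, unfolded v]
  have "admissible K E1" "admissible L E2"
    unfolding E1_def E2_def using admissible_relabel[OF s1] admissible_relabel[OF s2] assms(1,2) all_graphs_iff by blast+
  then show ?thesis
    using that[OF n_def m_def merge KL L_def finite_subset[OF KV finite_standard] finite_subset[OF LV finite_standard]
      s1 s2 E1_def E2_def] v cK cL by blast
qed

lemma merge_props:
  assumes G1: "G1 \<in> connected_graphs" and G2: "G2 \<in> graphs_with k" and K: "K \<in> pair_labellings (G1, G2)"
  defines "G \<equiv> fst (merge ((G1, G2), K))"
  shows "G \<in> graphs_with (Suc k)" "K \<in> components (verts G) (edges G)"
    "unmerge (merge ((G1, G2), K)) = ((G1, G2), K)"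
proof -
  have a1: "admissible (verts G1) (edges G1)" and c1: "components (verts G1) (edges G1) = {verts G1}"
    using G1 connected_graphs_iff by auto
  have a2: "admissible (verts G2) (edges G2)" and c2: "card (components (verts G2) (edges G2)) = k"
    using G2 all_graphs_iff by (auto simp: graphs_with_def)
  obtain n m L E1 E2 where merge: "merge ((G1, G2), K) = (BGraph n m (E1 + E2), K)"
    and KL: "K \<inter> L = {}" "K \<union> L = standard_verts n m" and L: "L = standard_verts n m - K" and "finite L"
    and s1: "sign_bij (standard_map K) (verts G1) K" and s2: "sign_bij (standard_map L) (verts G2) L"
    and E1: "E1 = relabel (standard_map K) (edges G1)" and E2: "E2 = relabel (standard_map L) (edges G2)"
    and A1: "admissible K E1" and A2: "admissible L E2"
    and v: "standard_verts (card (pos K)) (card (neg K)) = verts G1" "standard_verts (card (pos L)) (card (neg L)) = verts G2"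
    and cc: "card (pos K) = num_black G1" "card (neg K) = num_white G1" "card (pos L) = num_black G2" "card (neg L) = num_white G2"
    using merge_obtain[OF _ _ K] a1 a2 all_graphs_iff by metis
  have G: "G = BGraph n m (E1 + E2)" by (simp add: G_def merge)
  have C1: "components K E1 = {K}"
    using sign_bij_components(1)[OF s1 a1] c1 s1 unfolding E1 sign_bij_def bij_betw_def by simp
  have C2: "card (components L E2) = k"
    using sign_bij_components(2)[OF s2 a2] c2 unfolding E2 by simp
  note inv = split_at_component_inverse[OF KL(1) A1 A2 C1]
  have comp: "components (verts G) (edges G) = insert K (components L E2)"
    using inv(3) KL by (simp add: G)
  then show "K \<in> components (verts G) (edges G)" by simp
  have "card (components (verts G) (edges G)) = Suc k"
    unfolding comp using C2 inv(4) finite_components[OF \<open>finite L\<close>] by simp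
  moreover have "admissible (verts G) (edges G)"
    using admissible_Un[OF KL(1) A1 A2] KL by (simp add: G)
  ultimately show "G \<in> graphs_with (Suc k)" by (simp add: graphs_with_def all_graphs_iff)
  have "relabel (inv_into (verts G1) (standard_map K)) E1 = edges G1"
    unfolding E1 using relabel_inv_relabel[OF s1] a1 by (simp add: admissible_def)
  then have "standard_graph K (edges G) = G1"
    using inv(1) cc by (simp add: standard_graph_def G v(1)[unfolded cc])
  moreover have "relabel (inv_into (verts G2) (standard_map L)) E2 = edges G2"
    unfolding E2 using relabel_inv_relabel[OF s2] a2 by (simp add: admissible_def)
  then have "standard_graph L (edges G) = G2"
    using inv(2) cc by (simp add: standard_graph_def G v(2)[unfolded cc])
  moreover have "verts G - K = L" by (simp add: G L)
  ultimately show "unmerge (merge ((G1, G2), K)) = ((G1, G2), K)"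
    unfolding merge[folded G] by (simp only: unmerge_def prod.case)
qed

lemma unmerge_props:
  assumes G: "G \<in> graphs_with (Suc k)" and K: "K \<in> components (verts G) (edges G)"
  defines "L \<equiv> verts G - K"
  defines "G1 \<equiv> standard_graph K (edges G)" and "G2 \<equiv> standard_graph L (edges G)"
  shows "G1 \<in> connected_graphs" "G2 \<in> graphs_with k" "K \<in> pair_labellings (G1, G2)"
    "merge ((G1, G2), K) = (G, K)"
proof -
  obtain n m E where g: "G = BGraph n m E" by (cases G)
  have a: "admissible (standard_verts n m) E" and ck: "card (components (standard_verts n m) E) = Suc k"
    using G all_graphs_iff by (auto simp: graphs_with_def g)
  have K': "K \<in> components (standard_verts n m) E" using K by (simp add: g)
  have L: "L = standard_verts n m - K" by (simp add: L_def g)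
  note sp = split_at_component[OF a K', folded L]
  have "set_mset E \<subseteq> standard_verts n m \<times> standard_verts n m"
    using a edges_in_verts unfolding admissible_def by blast
  then have KV: "K \<subseteq> standard_verts n m" using component_subset(1)[OF K'] by blast
  have LV: "L \<subseteq> standard_verts n m" using L by auto
  let ?K = "standard_verts (card (pos K)) (card (neg K))" and ?L = "standard_verts (card (pos L)) (card (neg L))"
  note s1 = sign_bij_standard_map'[OF KV] and s2 = sign_bij_standard_map'[OF LV]
  note i1 = sign_bij_inv[OF s1] and i2 = sign_bij_inv[OF s2]
  have g1: "G1 = BGraph (card (pos K)) (card (neg K)) (relabel (inv_into ?K (standard_map K)) (restrict_edges K E))"
    by (simp add: G1_def standard_graph_def Let_def g)
  have g2: "G2 = BGraph (card (pos L)) (card (neg L)) (relabel (inv_into ?L (standard_map L)) (restrict_edges L E))"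
    by (simp add: G2_def standard_graph_def Let_def g)
  have "admissible (verts G1) (edges G1)" unfolding g1 using admissible_relabel[OF i1 sp(2)] by simp
  moreover have "components (verts G1) (edges G1) = {verts G1}"
    using sign_bij_components(1)[OF i1 sp(2)] sp(4) i1 unfolding g1 sign_bij_def bij_betw_def by simp
  ultimately show "G1 \<in> connected_graphs" using connected_graphs_iff by blast
  have "admissible (verts G2) (edges G2)" unfolding g2 using admissible_relabel[OF i2 sp(3)] by simp
  moreover have "card (components (verts G2) (edges G2)) = k"
    using sign_bij_components(2)[OF i2 sp(3)] sp(5) ck K' finite_components[OF finite_standard] unfolding g2 by simp
  ultimately show "G2 \<in> graphs_with k" by (simp add: graphs_with_def all_graphs_iff)
  have nm: "card (pos K) + card (pos L) = n" "card (neg K) + card (neg L) = m"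
    using card_pos_neg_Diff[OF KV] unfolding L by simp_all
  show "K \<in> pair_labellings (G1, G2)"
    using KV by (simp add: pair_labellings_def g1 g2 nm)
  have "relabel (standard_map K) (edges G1) = restrict_edges K E"
    using relabel_relabel_inv[OF s1] sp(2) unfolding g1 admissible_def by simp
  moreover have "relabel (standard_map L) (edges G2) = restrict_edges L E"
    using relabel_relabel_inv[OF s2] sp(3) unfolding g2 admissible_def by simp
  ultimately show "merge ((G1, G2), K) = (G, K)"
    using sp(1) nm by (simp add: merge_def Let_def g1 g2 g L)
qed

lemma bij_betw_merge:
  "bij_betw merge (Sigma (connected_graphs \<times> graphs_with k) pair_labellings)
     (SIGMA G:graphs_with (Suc k). components (verts G) (edges G))"
proof (rule bij_betwI[where g = unmerge])
  show "merge \<in> Sigma (connected_graphs \<times> graphs_with k) pair_labellings \<rightarrow>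
     (SIGMA G:graphs_with (Suc k). components (verts G) (edges G))"
  proof clarify
    fix G1 G2 K assume *: "G1 \<in> connected_graphs" "G2 \<in> graphs_with k" "K \<in> pair_labellings (G1, G2)"
    have "merge ((G1, G2), K) = (fst (merge ((G1, G2), K)), K)" by (simp add: merge_def Let_def)
    then show "merge ((G1, G2), K) \<in> (SIGMA G:graphs_with (Suc k). components (verts G) (edges G))"
      using merge_props(1,2)[OF *] by (metis SigmaI)
  qed
  show "unmerge \<in> (SIGMA G:graphs_with (Suc k). components (verts G) (edges G)) \<rightarrow>
     Sigma (connected_graphs \<times> graphs_with k) pair_labellings"
    using unmerge_props by (auto simp: unmerge_def)
  show "unmerge (merge p) = p" if "p \<in> Sigma (connected_graphs \<times> graphs_with k) pair_labellings" for p
    using that merge_props(3) by auto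
  show "merge (unmerge p) = p" if "p \<in> (SIGMA G:graphs_with (Suc k). components (verts G) (edges G))" for p
    using that unmerge_props(4) by (auto simp: unmerge_def)
qed

text \<open>The exponential formula needs only a weight that is invariant under relabelling and
  multiplicative over disjoint unions.\<close>

locale graph_weight =
  fixes wt :: "int set \<Rightarrow> (int \<times> int) multiset \<Rightarrow> formal"
  assumes wt_empty: "wt {} {#} = 1"
    and wt_relabel: "\<And>\<pi> V V' E. finite V \<Longrightarrow> 0 \<notin> V \<Longrightarrow> sign_bij \<pi> V V' \<Longrightarrow> admissible V E \<Longrightarrow>
          wt V' (relabel \<pi> E) = wt V E"
    and wt_Un: "\<And>V1 V2 E1 E2. finite V1 \<Longrightarrow> finite V2 \<Longrightarrow> V1 \<inter> V2 = {} \<Longrightarrow> 0 \<notin> V1 \<union> V2 \<Longrightarrow>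
          admissible V1 E1 \<Longrightarrow> admissible V2 E2 \<Longrightarrow> wt (V1 \<union> V2) (E1 + E2) = wt V1 E1 * wt V2 E2"
begin

text \<open>The factorials are those of an exponential generating function in two colours; on
  summing over an isomorphism class they become the reciprocal of the order of the automorphism
  group.\<close>

definition labelled_term :: "bgraph \<Rightarrow> formal" where
  "labelled_term G = cst (1 / (fact (num_black G) * fact (num_white G))) * wt (verts G) (edges G)"

lemma zero_notin_standard: "0 \<notin> standard_verts n m"
  by (auto simp: standard_verts_def)

text \<open>Passing from the factorials of the two parts to those of the union divides by the two
  binomial coefficients, that is, by the number of labellings. Every merged graph thus receives an
  equal share of the product.\<close>

lemma wt_merge:
  assumes G1: "G1 \<in> connected_graphs" and G2: "G2 \<in> graphs_with k" and K: "K \<in> pair_labellings (G1, G2)"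
  shows "labelled_term (fst (merge ((G1, G2), K))) =
     cst (1 / of_nat (card (pair_labellings (G1, G2)))) * (labelled_term G1 * labelled_term G2)"
proof -
  have a1: "admissible (verts G1) (edges G1)" using G1 connected_graphs_iff by auto
  have a2: "admissible (verts G2) (edges G2)" using G2 all_graphs_iff by (auto simp: graphs_with_def)
  obtain n m L E1 E2 where n: "n = num_black G1 + num_black G2" and m: "m = num_white G1 + num_white G2"
    and merge: "merge ((G1, G2), K) = (BGraph n m (E1 + E2), K)"
    and KL: "K \<inter> L = {}" "K \<union> L = standard_verts n m" and fin: "finite K" "finite L"
    and s1: "sign_bij (standard_map K) (verts G1) K" and s2: "sign_bij (standard_map L) (verts G2) L"
    and E1: "E1 = relabel (standard_map K) (edges G1)" and E2: "E2 = relabel (standard_map L) (edges G2)"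
    and A1: "admissible K E1" and A2: "admissible L E2"
    and v: "standard_verts (card (pos K)) (card (neg K)) = verts G1" "standard_verts (card (pos L)) (card (neg L)) = verts G2"
    using merge_obtain[OF _ _ K] a1 a2 all_graphs_iff by metis
  have z: "0 \<notin> verts G1" "0 \<notin> verts G2" unfolding v[symmetric] using zero_notin_standard by auto
  have "wt (standard_verts n m) (E1 + E2) = wt K E1 * wt L E2"
    using wt_Un[OF fin KL(1) _ A1 A2] KL(2) zero_notin_standard by simp
  also have "wt K E1 = wt (verts G1) (edges G1)"
    unfolding E1 by (rule wt_relabel[OF finite_verts z(1) s1 a1])
  also have "wt L E2 = wt (verts G2) (edges G2)"
    unfolding E2 by (rule wt_relabel[OF finite_verts z(2) s2 a2])
  finally have W: "wt (standard_verts n m) (E1 + E2) = wt (verts G1) (edges G1) * wt (verts G2) (edges G2)" .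
  have "1 / (fact n * fact m :: complex) = 1 / of_nat ((n choose num_black G1) * (m choose num_white G1)) *
      (1 / (fact (num_black G1) * fact (num_white G1)) * (1 / (fact (num_black G2) * fact (num_white G2))))"
    by (simp add: n m binomial_fact)
  then have "cst (1 / (fact n * fact m)) = cst (1 / of_nat ((n choose num_black G1) * (m choose num_white G1))) *
      (cst (1 / (fact (num_black G1) * fact (num_white G1))) * cst (1 / (fact (num_black G2) * fact (num_white G2))))"
    by (simp only: cst_mult)
  then show ?thesis
    unfolding merge fst_conv labelled_term_def card_pair_labellings n[symmetric] m[symmetric] verts_BGraph bgraph.sel W
    by (simp only: ac_simps)
qed

lemma graphs_with_0: "graphs_with 0 = {BGraph 0 0 {#}}"
proof
  show "{BGraph 0 0 {#}} \<subseteq> graphs_with 0"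
    by (simp add: graphs_with_def all_graphs_iff admissible_def components_def standard_verts_def pos_def)
  show "graphs_with 0 \<subseteq> {BGraph 0 0 {#}}"
  proof
    fix G assume g: "G \<in> graphs_with 0"
    obtain n m E where G: "G = BGraph n m E" by (cases G)
    have a: "admissible (standard_verts n m) E" "card (components (standard_verts n m) E) = 0"
      using g by (auto simp: graphs_with_def all_graphs_iff G)
    then have "standard_verts n m = {}"
      using finite_components[OF finite_standard, of n m E] by (simp add: components_def)
    then have "n = 0" "m = 0" by (auto simp: standard_verts_def)
    moreover have "E = {#}" using a(1) \<open>standard_verts n m = {}\<close> by (auto simp: admissible_def pos_def)
    ultimately show "G \<in> {BGraph 0 0 {#}}" by (simp add: G)
  qed
qed

lemma has_formal_sum_graphs_with:
  assumes F: "has_formal_sum labelled_term F connected_graphs"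
  shows "has_formal_sum labelled_term (cst (1 / fact k) * F ^ k) (graphs_with k)"
proof (induction k)
  case 0
  have "labelled_term (BGraph 0 0 {#}) = 1"
    by (simp add: labelled_term_def standard_verts_def wt_empty)
  then show ?case
    using has_formal_sum_finite[of "graphs_with 0" labelled_term] by (simp add: graphs_with_0)
next
  case (Suc k)
  let ?X = "F * (cst (1 / fact k) * F ^ k)"
  let ?P = "SIGMA G:graphs_with (Suc k). components (verts G) (edges G)"
  have "has_formal_sum (\<lambda>q. labelled_term (fst (merge q))) ?X (Sigma (connected_graphs \<times> graphs_with k) pair_labellings)"
  proof (rule has_formal_sum_Sigma_average[OF has_formal_sum_Times[OF F Suc.IH] finite_pair_labellings])
    fix p assume p: "p \<in> connected_graphs \<times> graphs_with k"
    obtain G1 G2 where p': "p = (G1, G2)" by (cases p)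
    have "card (pair_labellings p) > 0" unfolding p' card_pair_labellings by simp
    then show "pair_labellings p \<noteq> {}" by auto
    show "labelled_term (fst (merge (p, K))) = cst (1 / of_nat (card (pair_labellings p))) *
         (case p of (a, b) \<Rightarrow> labelled_term a * labelled_term b)" if "K \<in> pair_labellings p" for K
      using wt_merge[of G1 G2 k K] that p unfolding p' by simp
  qed
  then have "has_formal_sum (\<lambda>q. labelled_term (fst q)) ?X ?P"
    using has_formal_sum_reindex[OF bij_betw_merge, of "\<lambda>q. labelled_term (fst q)"] by simp
  \<comment> \<open>Each graph occurs once for each of its k + 1 components.\<close>
  then have "has_formal_sum (\<lambda>G. of_nat (Suc k) * labelled_term G) ?X (graphs_with (Suc k))"
  proof (rule has_formal_sum_SigmaD)
    fix G assume "G \<in> graphs_with (Suc k)"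
    then have "card (components (verts G) (edges G)) = Suc k" by (simp add: graphs_with_def)
    then show "has_formal_sum (\<lambda>b. labelled_term (fst (G, b))) (of_nat (Suc k) * labelled_term G) (components (verts G) (edges G))"
      using has_formal_sum_finite[OF finite_components[OF finite_verts], of "\<lambda>b. labelled_term (fst (G, b))" G "edges G"]
      by simp
  qed
  from has_formal_sum_mult[OF this, of "cst (1 / of_nat (Suc k))"]
  have h: "has_formal_sum (\<lambda>G. cst (1 / of_nat (Suc k)) * (of_nat (Suc k) * labelled_term G))
      (cst (1 / of_nat (Suc k)) * ?X) (graphs_with (Suc k))" .
  have e1: "cst (1 / of_nat (Suc k)) * (of_nat (Suc k) * labelled_term G) = labelled_term G" for G
    unfolding cst_of_nat[symmetric] cst_mult_assoc by (simp del: of_nat_Suc)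
  have "1 / fact (Suc k) = 1 / of_nat (Suc k) * (1 / fact k :: complex)" by (simp del: of_nat_Suc)
  then have e2: "cst (1 / of_nat (Suc k)) * ?X = cst (1 / fact (Suc k)) * F ^ Suc k"
    by (simp only: cst_mult power_Suc ac_simps)
  show ?case using h unfolding e1 e2 .
qed

theorem exponential_formula:
  assumes "has_formal_sum labelled_term s all_graphs"
  shows "formal_exp (formal_sum labelled_term connected_graphs) = s"
proof -
  have "connected_graphs \<subseteq> all_graphs" by (auto simp: connected_graphs_def)
  then have F: "has_formal_sum labelled_term (formal_sum labelled_term connected_graphs) connected_graphs"
    using has_formal_sum_imp(1)[OF assms] formal_summable_subset formal_summable_imp by blast
  have "has_formal_sum (\<lambda>k. cst (1 / fact k) * formal_sum labelled_term connected_graphs ^ k) s UNIV"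
  \<comment> \<open>Convergence of the exponential series comes from the graph side: its terms are
    the sums of the groups with a fixed number of components.\<close>
  proof (rule has_formal_sum_group[OF assms, where h = "\<lambda>G. card (components (verts G) (edges G))"])
    show "has_formal_sum labelled_term (cst (1 / fact k) * formal_sum labelled_term connected_graphs ^ k)
        {G \<in> all_graphs. card (components (verts G) (edges G)) = k}" for k
      using has_formal_sum_graphs_with[OF F, of k] by (simp add: graphs_with_def)
  qed auto
  from has_formal_sum_imp(2)[OF this] show ?thesis by (simp add: formal_exp_def)
qed

end

section \<open>Isomorphism classes\<close>

definition perm_pairs :: "bgraph \<Rightarrow> ((int \<Rightarrow> int) \<times> (int \<Rightarrow> int)) set" where
  "perm_pairs G = {\<sigma>. \<sigma> permutes blacks G} \<times> {\<tau>. \<tau> permutes whites G}"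

definition act :: "(int \<Rightarrow> int) \<times> (int \<Rightarrow> int) \<Rightarrow> bgraph \<Rightarrow> bgraph" where
  "act p G = BGraph (num_black G) (num_white G) (image_mset (map_prod (fst p) (snd p)) (edges G))"

lemma blacks_eq_iff: "blacks G = blacks G' \<longleftrightarrow> num_black G = num_black G'"
  and whites_eq_iff: "whites G = whites G' \<longleftrightarrow> num_white G = num_white G'"
proof -
  have "card (blacks G) = num_black G" "card (whites G) = num_white G" for G
    by (simp_all add: blacks_def whites_def)
  then show "blacks G = blacks G' \<longleftrightarrow> num_black G = num_black G'"
    "whites G = whites G' \<longleftrightarrow> num_white G = num_white G'"
    by (metis blacks_def) (metis \<open>\<And>G. card (whites G) = num_white G\<close> whites_def)
qed

lemma isos_iff_act: "p \<in> isos G G' \<longleftrightarrow> p \<in> perm_pairs G \<and> act p G = G'"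
proof -
  obtain n m E where G': "G' = BGraph n m E" by (cases G')
  show ?thesis
    by (cases p) (auto simp: isos_def perm_pairs_def act_def blacks_eq_iff whites_eq_iff G')
qed

lemma isos_eq: "isos G G' = {p \<in> perm_pairs G. act p G = G'}"
  using isos_iff_act by (intro set_eqI) simp

lemma finite_perm_pairs: "finite (perm_pairs G)"
  by (simp add: perm_pairs_def finite_permutations blacks_def whites_def)

lemma card_perm_pairs: "card (perm_pairs G) = fact (num_black G) * fact (num_white G)"
proof -
  have "card {\<sigma>. \<sigma> permutes blacks G} = fact (num_black G)" "card {\<tau>. \<tau> permutes whites G} = fact (num_white G)"
    by (rule card_permutations; simp add: blacks_def whites_def)+
  then show ?thesis by (simp add: perm_pairs_def card_cartesian_product)
qed

lemma perm_pairs_act [simp]: "perm_pairs (act p G) = perm_pairs G"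
  by (simp add: perm_pairs_def act_def blacks_def whites_def)

lemma verts_act [simp]: "verts (act p G) = verts G"
  by (simp add: act_def verts_def blacks_def whites_def)

lemma act_act: "act p (act q G) = act (fst p \<circ> fst q, snd p \<circ> snd q) G"
  by (simp add: act_def multiset.map_comp map_prod_compose)

lemma perm_pairs_compose:
  "p \<in> perm_pairs G \<Longrightarrow> q \<in> perm_pairs G \<Longrightarrow> (fst p \<circ> fst q, snd p \<circ> snd q) \<in> perm_pairs G"
  by (auto simp: perm_pairs_def intro: permutes_compose)

lemma perm_pairs_inv: "p \<in> perm_pairs G \<Longrightarrow> (inv (fst p), inv (snd p)) \<in> perm_pairs G"
  by (auto simp: perm_pairs_def intro: permutes_inv)

lemma act_id: "act (id, id) G = G"
  by (simp add: act_def map_prod.id)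

lemma act_inv:
  assumes "p \<in> perm_pairs G"
  shows "act (inv (fst p), inv (snd p)) (act p G) = G" "act p (act (inv (fst p), inv (snd p)) G) = G"
proof -
  have "inv (fst p) \<circ> fst p = id" "inv (snd p) \<circ> snd p = id" "fst p \<circ> inv (fst p) = id" "snd p \<circ> inv (snd p) = id"
    using assms permutes_inv_o unfolding perm_pairs_def by auto
  then show "act (inv (fst p), inv (snd p)) (act p G) = G" "act p (act (inv (fst p), inv (snd p)) G) = G"
    unfolding act_act by (simp_all add: act_id)
qed

text \<open>Isomorphisms are pairs of permutations, whereas weights are invariant under a single
  colour-preserving map; this turns the former into the latter.\<close>

definition glue_map :: "(int \<Rightarrow> int) \<times> (int \<Rightarrow> int) \<Rightarrow> int \<Rightarrow> int" where
  "glue_map p v = (if 0 < v then fst p v else snd p v)"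

lemma sign_bij_glue:
  assumes "p \<in> perm_pairs G" shows "sign_bij (glue_map p) (verts G) (verts G)"
proof -
  have \<sigma>: "fst p permutes blacks G" and \<tau>: "snd p permutes whites G"
    using assms by (auto simp: perm_pairs_def)
  have b: "0 < v" if "v \<in> blacks G" for v using that by (simp add: blacks_def)
  have w: "v < 0" if "v \<in> whites G" for v using that by (simp add: whites_def)
  have "bij_betw (glue_map p) (blacks G) (blacks G)"
    using permutes_imp_bij[OF \<sigma>] b by (subst bij_betw_cong[where g = "fst p"]) (auto simp: glue_map_def)
  moreover have "bij_betw (glue_map p) (whites G) (whites G)"
    using permutes_imp_bij[OF \<tau>] w by (subst bij_betw_cong[where g = "snd p"]) (force simp: glue_map_def)+
  moreover have "blacks G \<inter> whites G = {}" using b w by force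
  ultimately have "bij_betw (glue_map p) (verts G) (verts G)"
    unfolding verts_def by (rule bij_betw_combine)
  moreover have "sgn (glue_map p v) = sgn v" if "v \<in> verts G" for v
  proof (cases "v \<in> blacks G")
    case True
    then have "fst p v \<in> blacks G" using \<sigma> by (simp add: permutes_in_image)
    then show ?thesis using True b by (simp add: glue_map_def)
  next
    case False
    then have "v \<in> whites G" using that by (simp add: verts_def)
    moreover from this have "snd p v \<in> whites G" using \<tau> by (simp add: permutes_in_image)
    ultimately show ?thesis using w[of v] w[of "snd p v"] by (simp add: glue_map_def)
  qed
  ultimately show ?thesis by (simp add: sign_bij_def)
qed

lemma edges_act:
  assumes "bipartite G"
  shows "edges (act p G) = relabel (glue_map p) (edges G)"
proof -
  have "map_prod (fst p) (snd p) e = map_prod (glue_map p) (glue_map p) e" if "e \<in># edges G" for e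
    using assms that unfolding bipartite_def blacks_def whites_def
    by (cases e) (force simp: glue_map_def)
  then show ?thesis by (simp add: act_def relabel_def cong: image_mset_cong)
qed

lemma bipartite_act:
  assumes "p \<in> perm_pairs G" "bipartite G" shows "bipartite (act p G)"
  using assms unfolding bipartite_def perm_pairs_def
  by (auto simp: act_def blacks_def whites_def permutes_in_image simp del: atLeastAtMost_iff)

lemma graph_iso_iff: "(G, G') \<in> graph_iso \<longleftrightarrow> bipartite G \<and> (\<exists>p\<in>perm_pairs G. G' = act p G)"
proof -
  have "isos G G' \<noteq> {} \<longleftrightarrow> (\<exists>p\<in>perm_pairs G. G' = act p G)"
    unfolding isos_eq by auto
  then show ?thesis unfolding graph_iso_def using bipartite_act by auto
qed

lemma graph_iso_sym: "(G, G') \<in> graph_iso \<Longrightarrow> (G', G) \<in> graph_iso"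
  unfolding graph_iso_iff using bipartite_act act_inv(1) perm_pairs_inv perm_pairs_act by metis

lemma graph_iso_trans: "(G, G') \<in> graph_iso \<Longrightarrow> (G', G'') \<in> graph_iso \<Longrightarrow> (G, G'') \<in> graph_iso"
  unfolding graph_iso_iff using perm_pairs_compose act_act perm_pairs_act by metis

lemma graph_iso_refl: "bipartite G \<Longrightarrow> (G, G) \<in> graph_iso"
  unfolding graph_iso_iff
  by (metis (no_types, lifting) SigmaI act_id mem_Collect_eq perm_pairs_def permutes_id)

lemma bipartite_of_all_graphs: "G \<in> all_graphs \<Longrightarrow> bipartite G"
  by (simp add: all_graphs_def)

lemma all_graphs_iso: "(G, G') \<in> graph_iso \<Longrightarrow> G \<in> all_graphs \<Longrightarrow> G' \<in> all_graphs"
  unfolding graph_iso_iff all_graphs_iff using edges_act admissible_relabel sign_bij_glue verts_act by metis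

lemma connected_graphs_iso:
  assumes "(G, G') \<in> graph_iso" "G \<in> connected_graphs" shows "G' \<in> connected_graphs"
proof -
  obtain p where p: "bipartite G" "p \<in> perm_pairs G" "G' = act p G"
    using assms(1) graph_iso_iff by blast
  have a: "admissible (verts G) (edges G)" and c: "components (verts G) (edges G) = {verts G}"
    using assms(2) connected_graphs_iff by auto
  note s = sign_bij_glue[OF p(2)]
  have "components (verts G') (edges G') = {verts G'}"
    using sign_bij_components(1)[OF s a] c s unfolding p(3) edges_act[OF p(1)] verts_act sign_bij_def bij_betw_def
    by simp
  moreover have "admissible (verts G') (edges G')"
    using admissible_relabel[OF s a] unfolding p(3) edges_act[OF p(1)] by simp
  ultimately show ?thesis using connected_graphs_iff by blast
qed

lemma iso_class_eq_act:
  "bipartite G \<Longrightarrow> graph_iso `` {G} = (\<lambda>p. act p G) ` perm_pairs G"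
  using graph_iso_iff by auto

text \<open>Composition with one fixed isomorphism identifies the isomorphisms onto
  \<open>G'\<close> with the automorphisms of \<open>G\<close>, like a coset with its
  subgroup.\<close>

lemma card_isos:
  assumes "p0 \<in> isos G G'" shows "card (isos G G') = card (sym_group G)"
proof -
  have p0: "p0 \<in> perm_pairs G" "act p0 G = G'" using assms isos_iff_act by auto
  let ?q = "(inv (fst p0), inv (snd p0))"
  have q: "?q \<in> perm_pairs G" by (rule perm_pairs_inv[OF p0(1)])
  have i: "inv (fst p0) \<circ> fst p0 = id" "inv (snd p0) \<circ> snd p0 = id" "fst p0 \<circ> inv (fst p0) = id" "snd p0 \<circ> inv (snd p0) = id"
    using p0(1) permutes_inv_o unfolding perm_pairs_def by auto
  have "bij_betw (\<lambda>p. (fst p0 \<circ> fst p, snd p0 \<circ> snd p)) (isos G G) (isos G G')"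
  proof (rule bij_betwI[where g = "\<lambda>p. (inv (fst p0) \<circ> fst p, inv (snd p0) \<circ> snd p)"])
    show "(\<lambda>p. (fst p0 \<circ> fst p, snd p0 \<circ> snd p)) \<in> isos G G \<rightarrow> isos G G'"
    proof
      fix p assume "p \<in> isos G G"
      then have "p \<in> perm_pairs G" "act p G = G" using isos_iff_act by auto
      then show "(fst p0 \<circ> fst p, snd p0 \<circ> snd p) \<in> isos G G'"
        using perm_pairs_compose[OF p0(1)] act_act[of p0 p G] p0(2) by (simp add: isos_iff_act)
    qed
    show "(\<lambda>p. (inv (fst p0) \<circ> fst p, inv (snd p0) \<circ> snd p)) \<in> isos G G' \<rightarrow> isos G G"
    proof
      fix p assume "p \<in> isos G G'"
      then have "p \<in> perm_pairs G" "act p G = G'" using isos_iff_act by auto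
      then show "(inv (fst p0) \<circ> fst p, inv (snd p0) \<circ> snd p) \<in> isos G G"
        using perm_pairs_compose[OF q] act_act[of ?q p G] act_inv(1)[OF p0(1)] p0(2) by (simp add: isos_iff_act)
    qed
  qed (simp_all add: i comp_assoc[symmetric])
  then show ?thesis using bij_betw_same_card unfolding sym_group_def by fastforce
qed

lemma card_sym_group:
  assumes "bipartite G"
  shows "card (graph_iso `` {G}) * card (sym_group G) = fact (num_black G) * fact (num_white G)"
    "finite (graph_iso `` {G})" "card (sym_group G) > 0"
proof -
  have C: "graph_iso `` {G} = (\<lambda>p. act p G) ` perm_pairs G" by (rule iso_class_eq_act[OF assms])
  show fin: "finite (graph_iso `` {G})" unfolding C using finite_perm_pairs by simp
  \<comment> \<open>All pairs of permutations are sorted by the graph to which they carry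
    \<open>G\<close>; every part has as many elements as the automorphism group.\<close>
  have U: "perm_pairs G = (\<Union>G'\<in>graph_iso `` {G}. isos G G')"
    unfolding C using isos_iff_act by auto
  have "card (perm_pairs G) = (\<Sum>G'\<in>graph_iso `` {G}. card (isos G G'))"
  proof -
    have "finite (isos G G')" for G'
      unfolding isos_eq using finite_perm_pairs by simp
    moreover have "isos G G1 \<inter> isos G G2 = {}" if "G1 \<noteq> G2" for G1 G2
      unfolding isos_eq using that by auto
    ultimately show ?thesis unfolding U using fin by (intro card_UN_disjoint) auto
  qed
  also have "\<dots> = (\<Sum>G'\<in>graph_iso `` {G}. card (sym_group G))"
    using card_isos by (intro sum.cong refl) (auto simp: graph_iso_def)
  finally show m: "card (graph_iso `` {G}) * card (sym_group G) = fact (num_black G) * fact (num_white G)"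
    by (simp add: card_perm_pairs)
  show "card (sym_group G) > 0"
    using m by (metis fact_nonzero gr_zeroI mult_is_0)
qed

context graph_weight
begin

lemma labelled_term_iso:
  assumes "(G, G') \<in> graph_iso" "G \<in> all_graphs"
  shows "labelled_term G' = labelled_term G"
proof -
  obtain p where p: "bipartite G" "p \<in> perm_pairs G" "G' = act p G"
    using assms(1) graph_iso_iff by blast
  have "wt (verts G) (relabel (glue_map p) (edges G)) = wt (verts G) (edges G)"
    using assms(2) sign_bij_glue[OF p(2)] by (intro wt_relabel) (auto simp: all_graphs_iff verts_def blacks_def whites_def)
  then show ?thesis unfolding labelled_term_def p(3) verts_act edges_act[OF p(1)] by (simp add: act_def)
qed

text \<open>For any isomorphism-invariant set of graphs, all members of a class have equal terms,
  and their number cancels the factorials down to 1/|sym|. The set is kept variable so that both all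
  graphs and the connected ones are covered.\<close>

lemma has_formal_sum_classes:
  assumes "has_formal_sum labelled_term s X" and X: "X \<subseteq> all_graphs"
    and iso: "\<And>G G'. (G, G') \<in> graph_iso \<Longrightarrow> G \<in> X \<Longrightarrow> G' \<in> X"
  shows "has_formal_sum (\<lambda>C. cst (1 / of_nat (card (sym_group (rep C)))) * wt (verts (rep C)) (edges (rep C))) s (X // graph_iso)"
proof (rule has_formal_sum_group[OF assms(1), where h = "\<lambda>G. graph_iso `` {G}"])
  show "(\<lambda>G. graph_iso `` {G}) ` X \<subseteq> X // graph_iso" by (auto simp: quotient_def)
  fix C assume "C \<in> X // graph_iso"
  then obtain G0 where G0: "G0 \<in> X" "C = graph_iso `` {G0}" by (auto simp: quotient_def)
  define G where "G = rep C"
  have "G0 \<in> C" using G0 X graph_iso_refl bipartite_of_all_graphs by auto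
  then have "G \<in> C" unfolding G_def rep_def by (rule someI)
  then have i0: "(G0, G) \<in> graph_iso" using G0 by auto
  then have G: "G \<in> X" "G \<in> all_graphs" using iso G0(1) X by blast+
  then have bip: "bipartite G" using bipartite_of_all_graphs by blast
  have C: "C = graph_iso `` {G}"
    unfolding G0(2) using i0 graph_iso_sym graph_iso_trans by blast
  have fib: "{G' \<in> X. graph_iso `` {G'} = C} = C"
  proof (intro equalityI subsetI)
    fix G' assume "G' \<in> {G' \<in> X. graph_iso `` {G'} = C}"
    then show "G' \<in> C" using X graph_iso_refl bipartite_of_all_graphs by auto
  next
    fix G' assume "G' \<in> C"
    then have i: "(G, G') \<in> graph_iso" unfolding C by simp
    then have "graph_iso `` {G'} = C" unfolding C using graph_iso_sym graph_iso_trans by blast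
    then show "G' \<in> {G' \<in> X. graph_iso `` {G'} = C}" using iso[OF i] G by simp
  qed
  note cs = card_sym_group[OF bip, folded C]
  have "(\<Sum>G'\<in>C. labelled_term G') = (\<Sum>G'\<in>C. labelled_term G)"
    unfolding C using labelled_term_iso[OF _ G(2)] by (intro sum.cong refl) auto
  also have "\<dots> = of_nat (card C) * labelled_term G" by simp
  also have "\<dots> = cst (of_nat (card C) * (1 / (fact (num_black G) * fact (num_white G)))) * wt (verts G) (edges G)"
    unfolding labelled_term_def cst_of_nat[symmetric] cst_mult_assoc ..
  also have "of_nat (card C) * (1 / (fact (num_black G) * fact (num_white G))) = (1 / of_nat (card (sym_group G)) :: complex)"
  proof -
    have "(of_nat (card C) * of_nat (card (sym_group G)) :: complex) = fact (num_black G) * fact (num_white G)"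
      using arg_cong[OF cs(1), of "of_nat :: nat \<Rightarrow> complex"] by simp
    moreover have "(of_nat (card (sym_group G)) :: complex) \<noteq> 0" using cs(3) by simp
    ultimately show ?thesis by (simp add: field_simps)
  qed
  finally have "sum labelled_term C = cst (1 / of_nat (card (sym_group G))) * wt (verts G) (edges G)" .
  then show "has_formal_sum labelled_term (cst (1 / of_nat (card (sym_group (rep C)))) * wt (verts (rep C)) (edges (rep C)))
      {G' \<in> X. graph_iso `` {G'} = C}"
    unfolding fib using has_formal_sum_finite[OF cs(2), of labelled_term] G_def by simp
qed

end

section \<open>The weight of a graph\<close>

definition edge_indices :: "(int \<times> int) list \<Rightarrow> 'd list \<Rightarrow> int \<Rightarrow> 'd list" where
  "edge_indices es as v = map snd (filter (\<lambda>(e, a). attached v e) (zip es as))"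

lemma edge_indices_append:
  "length es1 = length as1 \<Longrightarrow> edge_indices (es1 @ es2) (as1 @ as2) v = edge_indices es1 as1 v @ edge_indices es2 as2 v"
  by (simp add: edge_indices_def)

lemma edge_indices_not_attached:
  assumes "\<And>e. e \<in> set es \<Longrightarrow> \<not> attached v e" shows "edge_indices es as v = []"
proof -
  have "filter (\<lambda>(e, a). attached v e) (zip es as) = []"
    using assms by (auto simp: filter_empty_conv dest: set_zip_leftD)
  then show ?thesis by (simp add: edge_indices_def)
qed

lemma edge_indices_relabel:
  assumes "inj_on \<pi> V" "set es \<subseteq> V \<times> V" "v \<in> V"
  shows "edge_indices (map (map_prod \<pi> \<pi>) es) as (\<pi> v) = edge_indices es as v"
  using assms(2)
proof (induction es arbitrary: as)
  case (Cons e es)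
  have "attached (\<pi> v) (map_prod \<pi> \<pi> e) \<longleftrightarrow> attached v e"
    using Cons.prems assms(1,3) by (cases e) (auto simp: attached_def inj_on_eq_iff)
  then show ?case using Cons by (cases as) (auto simp: edge_indices_def)
qed (simp add: edge_indices_def)

text \<open>A product of multinomial coefficients, one per black vertex: the ways to distribute its
  edge positions among its white neighbours. It equals the product of the
  \<open>vertex_factor\<close>s.\<close>

definition multiplicity_factor :: "int set \<Rightarrow> int set \<Rightarrow> (int \<times> int) multiset \<Rightarrow> complex" where
  "multiplicity_factor A B E =
     (\<Prod>v\<in>A. fact (size (filter_mset (attached v) E)) / (\<Prod>w\<in>B. fact (count E (v, w))))"

lemma count_relabel:
  assumes "inj_on \<pi> V" "set_mset E \<subseteq> V \<times> V" "v \<in> V" "w \<in> V"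
  shows "count (relabel \<pi> E) (\<pi> v, \<pi> w) = count E (v, w)"
proof -
  have "filter_mset (\<lambda>e. map_prod \<pi> \<pi> e = (\<pi> v, \<pi> w)) E = filter_mset (\<lambda>e. e = (v, w)) E"
    using assms by (intro filter_mset_cong refl) (auto simp: inj_on_eq_iff)
  moreover have "count (relabel \<pi> E) (\<pi> v, \<pi> w) = size (filter_mset (\<lambda>e. map_prod \<pi> \<pi> e = (\<pi> v, \<pi> w)) E)"
    unfolding relabel_def count_conv_size_mset by (simp add: filter_mset_image_mset comp_def eq_commute)
  moreover have "count E (v, w) = size (filter_mset (\<lambda>e. e = (v, w)) E)"
    unfolding count_conv_size_mset by (simp add: eq_commute)
  ultimately show ?thesis by simp
qed

lemma multiplicity_factor_relabel:
  assumes \<pi>: "sign_bij \<pi> V V'" and E: "admissible V E"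
  shows "multiplicity_factor (pos V') (neg V') (relabel \<pi> E) = multiplicity_factor (pos V) (neg V) E"
proof -
  have inj: "inj_on \<pi> V" using \<pi> by (simp add: sign_bij_def bij_betw_def)
  have inj': "inj_on \<pi> (pos V)" "inj_on \<pi> (neg V)" by (rule inj_on_subset[OF inj pos_subset], rule inj_on_subset[OF inj neg_subset])
  have sub: "set_mset E \<subseteq> V \<times> V" using E edges_in_verts unfolding admissible_def by blast
  have "size (filter_mset (attached (\<pi> v)) (relabel \<pi> E)) = size (filter_mset (attached v) E)" if "v \<in> pos V" for v
    using filter_attached_relabel[OF inj sub, of v] that pos_subset by (simp add: relabel_def subset_iff)
  moreover have "count (relabel \<pi> E) (\<pi> v, \<pi> w) = count E (v, w)" if "v \<in> pos V" "w \<in> neg V" for v w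
    using count_relabel[OF inj sub] that pos_subset neg_subset by blast
  ultimately show ?thesis
    unfolding multiplicity_factor_def sign_bij_pos[OF \<pi>, symmetric] sign_bij_neg[OF \<pi>, symmetric]
      prod.reindex[OF inj'(1)] prod.reindex[OF inj'(2)] comp_def
    by (intro prod.cong refl arg_cong2[where f = "(/)"]) auto
qed

lemma multiplicity_factor_Un:
  assumes "finite V1" "finite V2" "V1 \<inter> V2 = {}" "admissible V1 E1" "admissible V2 E2"
  shows "multiplicity_factor (pos (V1 \<union> V2)) (neg (V1 \<union> V2)) (E1 + E2) =
    multiplicity_factor (pos V1) (neg V1) E1 * multiplicity_factor (pos V2) (neg V2) E2"
proof -
  have fin: "finite (pos V1)" "finite (pos V2)" "finite (neg V1)" "finite (neg V2)"
    using assms(1,2) finite_subset[OF pos_subset] finite_subset[OF neg_subset] by blast+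
  have dis: "pos V1 \<inter> pos V2 = {}" "neg V1 \<inter> neg V2 = {}"
    using assms(3) by (auto simp: pos_def neg_def)
  have sub: "set_mset E1 \<subseteq> V1 \<times> V1" "set_mset E2 \<subseteq> V2 \<times> V2"
    using assms(4,5) edges_in_verts unfolding admissible_def by blast+
  \<comment> \<open>Only edges of the first piece meet its vertices, and pairs without an edge
    contribute 0! = 1. The claim is general in both pieces so that it also yields the second
    half.\<close>
  have half: "(\<Prod>v\<in>pos V1. fact (size (filter_mset (attached v) (E1 + E2))) / (\<Prod>w\<in>neg V1 \<union> neg V2. fact (count (E1 + E2) (v, w))) :: complex)
      = multiplicity_factor (pos V1) (neg V1) E1"
    if fin: "finite (neg V1)" "finite (neg V2)" and dis: "V1 \<inter> V2 = {}" "neg V1 \<inter> neg V2 = {}"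
      and sub: "set_mset E1 \<subseteq> V1 \<times> V1" "set_mset E2 \<subseteq> V2 \<times> V2" for V1 V2 E1 E2
    unfolding multiplicity_factor_def
  proof (intro prod.cong refl)
    fix v assume v: "v \<in> pos V1"
    then have v': "v \<notin> V2" "v \<in> V1" using dis by (auto simp: pos_def)
    have "filter_mset (attached v) E2 = {#}" by (rule filter_attached_outside[OF sub(2) v'(1)])
    moreover have c2: "count E2 (v, w) = 0" for w using v' sub(2) by (auto simp: count_eq_zero_iff)
    moreover have "count E1 (v, w) = 0" if "w \<in> neg V2" for w
      using that sub(1) dis by (auto simp: count_eq_zero_iff neg_def)
    then have "(\<Prod>w\<in>neg V2. fact (count E1 (v, w)) :: complex) = 1" by (intro prod.neutral) auto
    ultimately show "fact (size (filter_mset (attached v) (E1 + E2))) / (\<Prod>w\<in>neg V1 \<union> neg V2. fact (count (E1 + E2) (v, w))) =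
       (fact (size (filter_mset (attached v) E1)) / (\<Prod>w\<in>neg V1. fact (count E1 (v, w))) :: complex)"
      unfolding prod.union_disjoint[OF fin dis(2)] filter_union_mset by (simp only: count_union c2 add_0_right mult_1_right)
  qed
  have h1: "(\<Prod>v\<in>pos V1. fact (size (filter_mset (attached v) (E1 + E2))) / (\<Prod>w\<in>neg V1 \<union> neg V2. fact (count (E1 + E2) (v, w))) :: complex)
      = multiplicity_factor (pos V1) (neg V1) E1"
    by (rule half[OF fin(3,4) assms(3) dis(2) sub])
  have h2: "(\<Prod>v\<in>pos V2. fact (size (filter_mset (attached v) (E1 + E2))) / (\<Prod>w\<in>neg V1 \<union> neg V2. fact (count (E1 + E2) (v, w))) :: complex)
      = multiplicity_factor (pos V2) (neg V2) E2"
    using half[OF fin(4,3) _ _ sub(2,1)] assms(3) dis(2)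
    by (simp only: Un_commute[of "neg V1"] add.commute[of E1] Int_commute)
  show ?thesis
    unfolding pos_Un neg_Un h1[symmetric] h2[symmetric]
    unfolding multiplicity_factor_def[of "pos V1 \<union> pos V2"]
    by (rule prod.union_disjoint[OF fin(1,2) dis(1)])
qed

text \<open>\<open>CF\<close> stands for the coefficients of the generating function,
  \<open>EV\<close> for the derivatives of g at the formal point and \<open>u\<close> for the
  quotient of the imaginary unit by \<open>h\<close>. Only the symmetry in the indices matters
  here.\<close>

locale amplitude =
  fixes CF EV :: "'d::finite list \<Rightarrow> formal" and u :: complex
  assumes CF_mset: "\<And>as bs. mset as = mset bs \<Longrightarrow> CF as = CF bs"
    and EV_mset: "\<And>as bs. mset as = mset bs \<Longrightarrow> EV as = EV bs"
begin

definition amp :: "int set \<Rightarrow> int set \<Rightarrow> (int \<times> int) list \<Rightarrow> formal" where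
  "amp A B es = (\<Sum>as | length as = length es.
     (\<Prod>v\<in>A. CF (edge_indices es as v)) * (\<Prod>w\<in>B. EV (edge_indices es as w)))"

text \<open>Reordering the edges is undone by reordering the list of dummy indices in the same way;
  at each vertex this only permutes the arguments of symmetric functions.\<close>

lemma amp_mset_eq:
  assumes "mset es = mset es'" shows "amp A B es = amp A B es'"
proof -
  obtain p where p: "p permutes {..<length es'}" "permute_list p es' = es"
    using mset_eq_permutation[OF assms] by blast
  have len: "length es = length es'" by (rule mset_eq_length[OF assms])
  have mz: "mset (edge_indices es (permute_list p as) v) = mset (edge_indices es' as v)"
    if "length as = length es'" for as :: "'d list" and v
  proof -
    have "zip es (permute_list p as) = permute_list p (zip es' as)"
      unfolding permute_list_zip[OF p(1) refl that[symmetric]] p(2) ..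
    then have "mset (zip es (permute_list p as)) = mset (zip es' as)"
      using mset_permute_list[of p "zip es' as"] p that by simp
    then show ?thesis unfolding edge_indices_def by (simp add: mset_filter)
  qed
  have "amp A B es' = (\<Sum>as | length as = length es'.
     (\<Prod>v\<in>A. CF (edge_indices es (permute_list p as) v)) * (\<Prod>w\<in>B. EV (edge_indices es (permute_list p as) w)))"
    unfolding amp_def
    by (intro sum.cong refl arg_cong2[where f = "(*)"] prod.cong CF_mset EV_mset) (simp_all add: mz)
  also have "\<dots> = amp A B es"
    unfolding amp_def
  proof (rule sum.reindex_bij_witness[where i = "permute_list (inv p)" and j = "permute_list p"])
    fix as :: "'d list" assume "as \<in> {as. length as = length es'}"
    then have l: "length as = length es'" by simp
    then have p': "p permutes {..<length as}" "inv p permutes {..<length as}" using p permutes_inv by auto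
    show "permute_list (inv p) (permute_list p as) = as"
      using permute_list_compose[OF p'(2), of p] permutes_inv_o[OF p'(1)] by simp
    show "permute_list p as \<in> {as. length as = length es}" using l len by simp
  next
    fix as :: "'d list" assume "as \<in> {as. length as = length es}"
    then have l: "length as = length es'" using len by simp
    then have p': "p permutes {..<length as}" "inv p permutes {..<length as}" using p permutes_inv by auto
    show "permute_list p (permute_list (inv p) as) = as"
      using permute_list_compose[OF p'(1), of "inv p"] permutes_inv_o[OF p'(1)] by simp
    show "permute_list (inv p) as \<in> {as. length as = length es'}" using l by simp
  qed simp
  finally show ?thesis by simp
qed

lemma amp_relabel:
  assumes \<pi>: "sign_bij \<pi> V V'" and es: "set es \<subseteq> V \<times> V"
  shows "amp (pos V') (neg V') (map (map_prod \<pi> \<pi>) es) = amp (pos V) (neg V) es"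
proof -
  have inj: "inj_on \<pi> V" using \<pi> by (simp add: sign_bij_def bij_betw_def)
  have inj': "inj_on \<pi> (pos V)" "inj_on \<pi> (neg V)" by (rule inj_on_subset[OF inj pos_subset], rule inj_on_subset[OF inj neg_subset])
  have "edge_indices (map (map_prod \<pi> \<pi>) es) as (\<pi> v) = edge_indices es as v" if "v \<in> pos V \<or> v \<in> neg V"
    for as :: "'d list" and v
    using edge_indices_relabel[OF inj es] that pos_subset neg_subset by blast
  then show ?thesis
    unfolding amp_def sign_bij_pos[OF \<pi>, symmetric] sign_bij_neg[OF \<pi>, symmetric]
      prod.reindex[OF inj'(1)] prod.reindex[OF inj'(2)] comp_def length_map
    by (intro sum.cong prod.cong refl arg_cong2[where f = "(*)"]) auto
qed

lemma amp_append:
  assumes fin: "finite V1" "finite V2" and dis: "V1 \<inter> V2 = {}"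
    and es: "set es1 \<subseteq> V1 \<times> V1" "set es2 \<subseteq> V2 \<times> V2"
  shows "amp (pos (V1 \<union> V2)) (neg (V1 \<union> V2)) (es1 @ es2) = amp (pos V1) (neg V1) es1 * amp (pos V2) (neg V2) es2"
proof -
  let ?t = "\<lambda>V es as. (\<Prod>v\<in>pos V. CF (edge_indices es as v)) * (\<Prod>w\<in>neg V. EV (edge_indices es as w))"
  have fin': "finite (pos V1)" "finite (pos V2)" "finite (neg V1)" "finite (neg V2)"
    using fin finite_subset[OF pos_subset] finite_subset[OF neg_subset] by blast+
  have dis': "pos V1 \<inter> pos V2 = {}" "neg V1 \<inter> neg V2 = {}"
    using dis by (auto simp: pos_def neg_def)
  have t: "?t (V1 \<union> V2) (es1 @ es2) (as1 @ as2) = ?t V1 es1 as1 * ?t V2 es2 as2"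
    if l: "length as1 = length es1" for as1 as2
  proof -
    have "edge_indices es2 as2 v = []" if "v \<in> V1" for v
      using that es dis by (intro edge_indices_not_attached) (auto simp: attached_def)
    then have 1: "edge_indices (es1 @ es2) (as1 @ as2) v = edge_indices es1 as1 v" if "v \<in> V1" for v
      using that l by (simp add: edge_indices_append)
    have "edge_indices es1 as1 v = []" if "v \<in> V2" for v
      using that es dis by (intro edge_indices_not_attached) (auto simp: attached_def)
    then have 2: "edge_indices (es1 @ es2) (as1 @ as2) v = edge_indices es2 as2 v" if "v \<in> V2" for v
      using that l by (simp add: edge_indices_append)
    have "(\<Prod>v\<in>pos V1 \<union> pos V2. CF (edge_indices (es1 @ es2) (as1 @ as2) v)) =
        (\<Prod>v\<in>pos V1. CF (edge_indices es1 as1 v)) * (\<Prod>v\<in>pos V2. CF (edge_indices es2 as2 v))"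
      unfolding prod.union_disjoint[OF fin'(1,2) dis'(1)]
      by (intro arg_cong2[where f = "(*)"] prod.cong refl) (auto simp: pos_def 1 2)
    moreover have "(\<Prod>v\<in>neg V1 \<union> neg V2. EV (edge_indices (es1 @ es2) (as1 @ as2) v)) =
        (\<Prod>v\<in>neg V1. EV (edge_indices es1 as1 v)) * (\<Prod>v\<in>neg V2. EV (edge_indices es2 as2 v))"
      unfolding prod.union_disjoint[OF fin'(3,4) dis'(2)]
      by (intro arg_cong2[where f = "(*)"] prod.cong refl) (auto simp: neg_def 1 2)
    ultimately show ?thesis unfolding pos_Un neg_Un by (simp only: ac_simps)
  qed
  have "amp (pos V1) (neg V1) es1 * amp (pos V2) (neg V2) es2 =
      (\<Sum>(as1, as2)\<in>{as. length as = length es1} \<times> {as. length as = length es2}. ?t V1 es1 as1 * ?t V2 es2 as2)"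
    unfolding amp_def sum_product sum.cartesian_product ..
  also have "\<dots> = (\<Sum>(as1, as2)\<in>{as. length as = length es1} \<times> {as. length as = length es2}. ?t (V1 \<union> V2) (es1 @ es2) (as1 @ as2))"
    by (intro sum.cong refl) (auto simp: t)
  also have "\<dots> = amp (pos (V1 \<union> V2)) (neg (V1 \<union> V2)) (es1 @ es2)"
    unfolding amp_def
    by (rule sum.reindex_bij_witness[where i = "\<lambda>as. (take (length es1) as, drop (length es1) as)" and j = "\<lambda>(as1, as2). as1 @ as2"])
       auto
  finally show ?thesis by simp
qed

definition some_list :: "(int \<times> int) multiset \<Rightarrow> (int \<times> int) list" where
  "some_list E = (SOME es. mset es = E)"

lemma mset_some_list [simp]: "mset (some_list E) = E"
  unfolding some_list_def using ex_mset by (rule someI_ex)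

text \<open>One factor u per vertex and one factor 1/u per edge make up the power of h in the graph
  expansion.\<close>

definition wt :: "int set \<Rightarrow> (int \<times> int) multiset \<Rightarrow> formal" where
  "wt V E = cst (u ^ card V * inverse u ^ size E * multiplicity_factor (pos V) (neg V) E) * amp (pos V) (neg V) (some_list E)"

lemma wt_eq_amp:
  "mset es = E \<Longrightarrow> wt V E =
    cst (u ^ card V * inverse u ^ size E * multiplicity_factor (pos V) (neg V) E) * amp (pos V) (neg V) es"
  unfolding wt_def using amp_mset_eq[of "some_list E" es] by simp

sublocale graph_weight wt
proof
  have "pos {} = {}" "neg {} = {}" by (auto simp: pos_def neg_def)
  then show "wt {} {#} = 1"
    using wt_eq_amp[of "[]" "{#}" "{}"] by (simp add: multiplicity_factor_def amp_def)
next
  fix \<pi> :: "int \<Rightarrow> int" and V V' E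
  assume "finite V" and \<pi>: "sign_bij \<pi> V V'" and E: "admissible V E"
  have es: "set (some_list E) \<subseteq> V \<times> V"
    using E edges_in_verts unfolding admissible_def by (metis mset_some_list set_mset_mset)
  have "card V' = card V" using \<pi> bij_betw_same_card unfolding sign_bij_def by metis
  moreover have "mset (map (map_prod \<pi> \<pi>) (some_list E)) = relabel \<pi> E" by (simp add: relabel_def)
  moreover have "size (relabel \<pi> E) = size E" by (simp add: relabel_def)
  ultimately show "wt V' (relabel \<pi> E) = wt V E"
    using wt_eq_amp[of "map (map_prod \<pi> \<pi>) (some_list E)" "relabel \<pi> E" V'] amp_relabel[OF \<pi> es]
      multiplicity_factor_relabel[OF \<pi> E] by (simp add: wt_def)
next
  fix V1 V2 E1 E2
  assume fin: "finite V1" "finite V2" and dis: "V1 \<inter> V2 = {}" and E: "admissible V1 E1" "admissible V2 E2"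
  have es: "set (some_list E1) \<subseteq> V1 \<times> V1" "set (some_list E2) \<subseteq> V2 \<times> V2"
    using E edges_in_verts unfolding admissible_def by (metis mset_some_list set_mset_mset)+
  have "wt (V1 \<union> V2) (E1 + E2) = cst (u ^ (card V1 + card V2) * inverse u ^ (size E1 + size E2) *
      (multiplicity_factor (pos V1) (neg V1) E1 * multiplicity_factor (pos V2) (neg V2) E2)) *
      (amp (pos V1) (neg V1) (some_list E1) * amp (pos V2) (neg V2) (some_list E2))"
    using wt_eq_amp[of "some_list E1 @ some_list E2" "E1 + E2" "V1 \<union> V2"] amp_append[OF fin dis es]
      multiplicity_factor_Un[OF fin dis E] card_Un_disjoint[OF fin dis] by simp
  then show "wt (V1 \<union> V2) (E1 + E2) = wt V1 E1 * wt V2 E2"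
    unfolding wt_def power_add by (simp only: cst_mult ac_simps)
qed

end

section \<open>Configurations\<close>

fun split_blocks :: "nat list \<Rightarrow> 'a list \<Rightarrow> 'a list list" where
  "split_blocks [] bs = []"
| "split_blocks (l # ls) bs = take l bs # split_blocks ls (drop l bs)"

lemma split_blocks_concat: "split_blocks (map length xs) (concat xs) = xs"
  by (induction xs) auto

lemma concat_split_blocks: "length bs = sum_list ls \<Longrightarrow> concat (split_blocks ls bs) = bs"
  by (induction ls arbitrary: bs) auto

lemma map_length_split_blocks: "length bs = sum_list ls \<Longrightarrow> map length (split_blocks ls bs) = ls"
  by (induction ls arbitrary: bs) auto

text \<open>For consecutive index lists of the given lengths, this names the black vertex to which
  each position of their concatenation belongs. Zipped with the white ends it is the edge list of
  the graph.\<close>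

fun block_labels :: "int \<Rightarrow> nat list \<Rightarrow> int list" where
  "block_labels j [] = []"
| "block_labels j (l # ls) = replicate l j @ block_labels (j + 1) ls"

lemma length_block_labels [simp]: "length (block_labels j ls) = sum_list ls"
  by (induction ls arbitrary: j) auto

lemma set_block_labels: "set (block_labels j ls) \<subseteq> {j..<j + int (length ls)}"
proof (induction ls arbitrary: j)
  case (Cons l ls)
  have "set (replicate l j) \<subseteq> {j..<j + int (length (l # ls))}" by (auto simp: set_replicate_conv_if)
  moreover have "set (block_labels (j + 1) ls) \<subseteq> {j..<j + int (length (l # ls))}"
    by (rule subset_trans[OF Cons[of "j + 1"]]) auto
  ultimately show ?case unfolding block_labels.simps set_append by (rule Un_least)
qed simp

lemma count_block_labels:
  "i < length ls \<Longrightarrow> count_list (block_labels j ls) (j + int i) = ls ! i"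
proof (induction ls arbitrary: i j)
  case (Cons l ls)
  have rep: "count_list (replicate l j) x = (if x = j then l else 0)" for x
    by (induction l) auto
  show ?case
  proof (cases i)
    case 0
    have "j \<notin> set (block_labels (j + 1) ls)" using set_block_labels[of "j + 1" ls] by auto
    then show ?thesis using 0 by (simp add: rep)
  next
    case (Suc i')
    then show ?thesis using Cons.IH[of i' "j + 1"] Cons.prems by (simp add: rep algebra_simps)
  qed
qed simp

lemma counts_block_labels:
  "map (\<lambda>i. count_list (block_labels j ls) (j + int i)) [0..<length ls] = ls"
  by (rule nth_equalityI) (simp_all add: count_block_labels)

lemma selected_eq_edge_indices:
  assumes "length bl = length f" "length f = length bs" "\<forall>v\<in>set bl. v \<noteq> w"
  shows "edge_indices (zip bl f) bs w = selected f bs w"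
  using assms by (induction bl f bs rule: list_induct3) (auto simp: edge_indices_def selected_def attached_def)

lemma edge_indices_block:
  assumes "length f1 = length a"
  shows "edge_indices (zip (replicate (length a) j) f1) a j = a"
  using assms by (induction f1 a rule: list_induct2) (auto simp: edge_indices_def attached_def)

text \<open>White labels below \<open>j\<close> cannot be confused with block labels, so the edges
  at the i-th black vertex carry precisely the i-th index list, in its original order.\<close>

lemma prod_edge_indices_blocks:
  fixes CF :: "'d list \<Rightarrow> 'r::comm_monoid_mult"
  assumes "length f = length (concat xs)" "\<forall>w\<in>set f. w < j" 
  shows "(\<Prod>v\<in>{j..<j + int (length xs)}. CF (edge_indices (zip (block_labels j (map length xs)) f) (concat xs) v)) = (\<Prod>a\<leftarrow>xs. CF a)"
  using assms
proof (induction xs arbitrary: j f)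
  case (Cons a xs)
  define f1 f2 where "f1 = take (length a) f" and "f2 = drop (length a) f"
  have f: "f = f1 @ f2" and l1: "length f1 = length a" and l2: "length f2 = length (concat xs)"
    using Cons.prems(1) by (auto simp: f1_def f2_def)
  let ?es1 = "zip (replicate (length a) j) f1" and ?es2 = "zip (block_labels (j + 1) (map length xs)) f2"
  have es: "zip (block_labels j (map length (a # xs))) f = ?es1 @ ?es2"
    by (simp add: f l1 zip_append1)
  have split: "edge_indices (?es1 @ ?es2) (concat (a # xs)) v = edge_indices ?es1 a v @ edge_indices ?es2 (concat xs) v" for v
    using l1 by (simp add: edge_indices_append)
  have neg: "w < j" if "w \<in> set f" for w using Cons.prems(2) that by blast
  have "edge_indices ?es2 (concat xs) j = []"
    using set_block_labels[of "j + 1" "map length xs"] neg f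
    by (intro edge_indices_not_attached) (force simp: attached_def dest: set_zip_leftD set_zip_rightD)
  then have 1: "edge_indices (?es1 @ ?es2) (concat (a # xs)) j = a"
    unfolding split by (simp add: edge_indices_block[OF l1])
  have "edge_indices ?es1 a v = []" if "v \<in> {j + 1..<j + 1 + int (length xs)}" for v
    using neg that f
    by (intro edge_indices_not_attached) (force simp: attached_def dest: set_zip_leftD set_zip_rightD)
  then have 2: "edge_indices (?es1 @ ?es2) (concat (a # xs)) v = edge_indices ?es2 (concat xs) v" if "v \<in> {j + 1..<j + 1 + int (length xs)}" for v
    unfolding split using that by simp
  have "{j..<j + int (length (a # xs))} = insert j {j + 1..<j + 1 + int (length xs)}" by auto
  then have "(\<Prod>v\<in>{j..<j + int (length (a # xs))}. CF (edge_indices (zip (block_labels j (map length (a # xs))) f) (concat (a # xs)) v))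
      = CF a * (\<Prod>v\<in>{j + 1..<j + 1 + int (length xs)}. CF (edge_indices ?es2 (concat xs) v))"
    unfolding es using 1 2 by (simp del: concat.simps)
  also have "(\<Prod>v\<in>{j + 1..<j + 1 + int (length xs)}. CF (edge_indices ?es2 (concat xs) v)) = (\<Prod>a\<leftarrow>xs. CF a)"
    using neg f by (intro Cons.IH[OF l2]) force
  finally show ?case by simp
qed simp

text \<open>The positions and their black ends are fixed; these are the ways to attach white ends so
  that the edges form the multiset \<open>E\<close>.\<close>

definition edge_endings :: "'v list \<Rightarrow> ('v \<times> 'w) multiset \<Rightarrow> 'w list set" where
  "edge_endings bl E = {f. length f = length bl \<and> mset (zip bl f) = E}"

lemma set_edge_endings: "f \<in> edge_endings bl E \<Longrightarrow> set f \<subseteq> snd ` set_mset E"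
  unfolding edge_endings_def by (metis (mono_tags, lifting) image_set map_snd_zip mem_Collect_eq order_refl set_mset_mset)

lemma finite_edge_endings: "finite (edge_endings bl E)"
proof (rule finite_subset)
  show "edge_endings bl E \<subseteq> {f. length f = length bl \<and> set f \<subseteq> snd ` set_mset E}"
    using set_edge_endings unfolding edge_endings_def by fastforce
  show "finite {f. length f = length bl \<and> set f \<subseteq> snd ` set_mset E}"
    by (rule finite_lists_over) simp
qed

lemma sum_count_fst:
  assumes "finite B" "set_mset E \<subseteq> A \<times> B"
  shows "(\<Sum>w\<in>B. count E (v, w)) = count (image_mset fst E) v"
  using assms(2)
proof (induction E)
  case (add e E)
  then have "snd e \<in> B" by (cases e) auto
  have "(\<Sum>w\<in>B. count (add_mset e E) (v, w)) = (\<Sum>w\<in>B. if w = snd e then if fst e = v then 1 else 0 else 0) + (\<Sum>w\<in>B. count E (v, w))"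
    unfolding sum.distrib[symmetric] by (intro sum.cong refl) (cases e, auto)
  also have "(\<Sum>w\<in>B. if w = snd e then if fst e = v then 1 else 0 else 0) = (if fst e = v then 1 else (0::nat))"
    using assms(1) \<open>snd e \<in> B\<close> by simp
  finally show ?case using add by simp
qed simp

text \<open>A product of multinomial coefficients, written without division to stay in the natural
  numbers. The induction removes the first position, whose white end can be any neighbour of its
  black end.\<close>

lemma card_edge_endings:
  assumes "finite A" "finite B" "set_mset E \<subseteq> A \<times> B" "image_mset fst E = mset bl"
  shows "card (edge_endings bl E) * (\<Prod>v\<in>A. \<Prod>w\<in>B. fact (count E (v, w))) = (\<Prod>v\<in>A. fact (count (mset bl) v))"
  using assms(3,4)
proof (induction bl arbitrary: E)
  case Nil
  then have "E = {#}" by simp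
  moreover from this have "edge_endings [] E = {[]}" by (auto simp: edge_endings_def)
  ultimately show ?case by simp
next
  case (Cons v0 bl)
  let ?P = "\<lambda>E. \<Prod>v\<in>A. \<Prod>w\<in>B. (fact (count E (v, w)) :: nat)"
  let ?Q = "\<lambda>bl. \<Prod>v\<in>A. (fact (count (mset bl) v) :: nat)"
  let ?W = "{w \<in> B. (v0, w) \<in># E}"
  have v0: "v0 \<in> A"
  proof -
    have "v0 \<in># image_mset fst E" using Cons.prems(2) by simp
    then show ?thesis using Cons.prems(1) by auto
  qed
  have "edge_endings (v0 # bl) E = (\<Union>w\<in>?W. (#) w ` edge_endings bl (E - {#(v0, w)#}))"
  proof (intro equalityI subsetI)
    fix f assume "f \<in> edge_endings (v0 # bl) E"
    then obtain w f' where f: "f = w # f'" "length f' = length bl" "add_mset (v0, w) (mset (zip bl f')) = E"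
      unfolding edge_endings_def by (cases f) auto
    then have "(v0, w) \<in># E" by auto
    moreover from this have "w \<in> B" using Cons.prems(1) by auto
    moreover have "f' \<in> edge_endings bl (E - {#(v0, w)#})" using f by (auto simp: edge_endings_def)
    ultimately show "f \<in> (\<Union>w\<in>?W. (#) w ` edge_endings bl (E - {#(v0, w)#}))" using f(1) by blast
  qed (auto simp: edge_endings_def)
  then have "card (edge_endings (v0 # bl) E) = (\<Sum>w\<in>?W. card ((#) w ` edge_endings bl (E - {#(v0, w)#})))"
    using assms(2) by (subst card_UN_disjoint[symmetric]) (auto intro: finite_edge_endings)
  also have "\<dots> = (\<Sum>w\<in>?W. card (edge_endings bl (E - {#(v0, w)#})))"
    by (intro sum.cong refl card_image) simp
  finally have N: "card (edge_endings (v0 # bl) E) = \<dots>" .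
  \<comment> \<open>Deleting one copy of an edge changes a single factorial, by the factor
    \<open>count E (v0, w)\<close>. Summed over w, these factors give the number of positions
    belonging to \<open>v0\<close>.\<close>
  have step: "card (edge_endings bl (E - {#(v0, w)#})) * ?P E = ?Q bl * count E (v0, w)" if w: "w \<in> ?W" for w
  proof -
    let ?E' = "E - {#(v0, w)#}"
    have E: "E = add_mset (v0, w) ?E'" using w by simp
    have IH: "card (edge_endings bl ?E') * ?P ?E' = ?Q bl"
    proof (rule Cons.IH)
      show "set_mset ?E' \<subseteq> A \<times> B" using Cons.prems(1) by (meson in_diffD subset_iff)
      have "image_mset fst E = add_mset v0 (image_mset fst ?E')" by (subst E) simp
      then show "image_mset fst ?E' = mset bl" using Cons.prems(2) by simp
    qed
    have r1: "?P E = (\<Prod>p\<in>A \<times> B. fact (count E p))" for E :: "('a \<times> 'b) multiset"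
      by (simp add: prod.cartesian_product case_prod_unfold)
    have r2: "(\<Prod>p\<in>A \<times> B. fact (count E p) :: nat) = fact (count E (v0, w)) * (\<Prod>p\<in>A \<times> B - {(v0, w)}. fact (count E p))"
      using assms(1,2) v0 w by (intro prod.remove) auto
    have r3: "(\<Prod>p\<in>A \<times> B. fact (count ?E' p) :: nat) = fact (count ?E' (v0, w)) * (\<Prod>p\<in>A \<times> B - {(v0, w)}. fact (count ?E' p))"
      using assms(1,2) v0 w by (intro prod.remove) auto
    have r4: "(\<Prod>p\<in>A \<times> B - {(v0, w)}. fact (count ?E' p) :: nat) = (\<Prod>p\<in>A \<times> B - {(v0, w)}. fact (count E p))"
      by (intro prod.cong) auto
    have r5: "(fact (count E (v0, w)) :: nat) = count E (v0, w) * fact (count ?E' (v0, w))"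
      by (subst (1 2) E) simp
    have "?P E = count E (v0, w) * ?P ?E'"
      by (simp only: r1 r2 r3 r4 r5 mult.assoc)
    then show ?thesis using IH by (simp add: mult_ac)
  qed
  have "card (edge_endings (v0 # bl) E) * ?P E = (\<Sum>w\<in>?W. ?Q bl * count E (v0, w))"
    unfolding N sum_distrib_right by (intro sum.cong refl step)
  also have "\<dots> = ?Q bl * (\<Sum>w\<in>B. count E (v0, w))"
    unfolding sum_distrib_left
    using assms(2) by (intro sum.mono_neutral_left) (auto simp: not_in_iff)
  also have "(\<Sum>w\<in>B. count E (v0, w)) = Suc (count (mset bl) v0)"
    using sum_count_fst[OF assms(2) Cons.prems(1)] Cons.prems(2) by simp
  also have "?Q bl * Suc (count (mset bl) v0) = ?Q (v0 # bl)"
  proof -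
    have "?Q (v0 # bl) = fact (count (mset (v0 # bl)) v0) * (\<Prod>v\<in>A - {v0}. fact (count (mset (v0 # bl)) v))"
      by (rule prod.remove[OF assms(1) v0])
    also have "(\<Prod>v\<in>A - {v0}. (fact (count (mset (v0 # bl)) v) :: nat)) = (\<Prod>v\<in>A - {v0}. fact (count (mset bl) v))"
      by (intro prod.cong) auto
    also have "?Q bl = fact (count (mset bl) v0) * (\<Prod>v\<in>A - {v0}. fact (count (mset bl) v))"
      by (rule prod.remove[OF assms(1) v0])
    ultimately show ?thesis by (simp add: algebra_simps)
  qed
  finally show ?case .
qed

lemma valence_eq_count_fst:
  assumes "set_mset E \<subseteq> pos V \<times> neg V" "0 < v"
  shows "size (filter_mset (attached v) E) = count (image_mset fst E) v"
proof -
  have "filter_mset (attached v) E = filter_mset (\<lambda>e. fst e = v) E"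
    using assms by (intro filter_mset_cong) (force simp: attached_def neg_def)+
  then show ?thesis
    by (simp add: count_conv_size_mset filter_mset_image_mset comp_def eq_commute)
qed

lemma card_edge_endings_eq_factor:
  assumes E: "set_mset E \<subseteq> pos V \<times> neg V" and "finite V" and bl: "image_mset fst E = mset bl"
  shows "of_nat (card (edge_endings bl E)) = multiplicity_factor (pos V) (neg V) E"
proof -
  have fin: "finite (pos V)" "finite (neg V)"
    using assms(2) finite_subset[OF pos_subset] finite_subset[OF neg_subset] by blast+
  have "(of_nat (card (edge_endings bl E)) :: complex) * (\<Prod>v\<in>pos V. \<Prod>w\<in>neg V. fact (count E (v, w))) = (\<Prod>v\<in>pos V. fact (count (mset bl) v))"
    using arg_cong[OF card_edge_endings[OF fin E bl], of "of_nat :: nat \<Rightarrow> complex"] by (simp add: of_nat_prod)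
  also have "\<dots> = (\<Prod>v\<in>pos V. fact (size (filter_mset (attached v) E)))"
    using valence_eq_count_fst[OF E] bl by (intro prod.cong refl) (simp add: pos_def)
  finally have "(of_nat (card (edge_endings bl E)) :: complex) * (\<Prod>v\<in>pos V. \<Prod>w\<in>neg V. fact (count E (v, w))) = \<dots>" .
  moreover have "(\<Prod>v\<in>pos V. \<Prod>w\<in>neg V. fact (count E (v, w)) :: complex) \<noteq> 0" using fin by simp
  ultimately show ?thesis unfolding multiplicity_factor_def prod_dividef by (simp add: field_simps)
qed

definition white_labels :: "nat \<Rightarrow> int set" where
  "white_labels m = {- int m..-1}"

text \<open>A term of the fully expanded integral: the index lists of the black vertices (an empty
  list stands for S^0), the number of factors g, and the factor hit by each derivative.\<close>

type_synonym 'd config = "'d list list \<times> nat \<times> int list"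

definition configurations :: "'d config set" where
  "configurations = {(xs, m, f). (\<forall>as\<in>set xs. length as \<noteq> 1) \<and> length f = length (concat xs) \<and> set f \<subseteq> white_labels m}"

definition config_graph :: "'d config \<Rightarrow> bgraph" where
  "config_graph = (\<lambda>(xs, m, f). BGraph (length xs) m (mset (zip (block_labels 1 (map length xs)) f)))"

lemma config_graph_in_all_graphs:
  assumes "c \<in> configurations" shows "config_graph c \<in> all_graphs"
proof -
  obtain xs m f where c: "c = (xs, m, f)" by (cases c)
  have xs: "\<forall>as\<in>set xs. length as \<noteq> 1" and f: "length f = length (concat xs)" "set f \<subseteq> white_labels m"
    using assms by (auto simp: c configurations_def)
  let ?bl = "block_labels 1 (map length xs)"
  have len: "length ?bl = length f" using f by (simp add: length_concat)
  have sub: "set_mset (mset (zip ?bl f)) \<subseteq> {1..int (length xs)} \<times> {- int m..-1}"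
    using set_block_labels[of 1 "map length xs"] f(2)
    by (force simp: white_labels_def dest: set_zip_leftD set_zip_rightD)
  then have sub': "set_mset (mset (zip ?bl f)) \<subseteq> pos (standard_verts (length xs) m) \<times> neg (standard_verts (length xs) m)"
    by simp
  have "size (filter_mset (attached v) (mset (zip ?bl f))) \<noteq> 1" if v: "v \<in> {1..int (length xs)}" for v
  proof -
    have "size (filter_mset (attached v) (mset (zip ?bl f))) = count (mset (map fst (zip ?bl f))) v"
      using valence_eq_count_fst[OF sub'] v by simp
    also have "\<dots> = count_list ?bl v" using len by (simp add: count_mset)
    also have "\<dots> = count_list ?bl (1 + int (nat (v - 1)))" using v by simp
    also have "\<dots> = length (xs ! nat (v - 1))"
      using count_block_labels[of "nat (v - 1)" "map length xs" 1] v by (simp add: nat_less_iff)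
    finally show ?thesis using xs v by (simp add: nat_less_iff)
  qed
  then show ?thesis
    using sub by (simp add: all_graphs_iff admissible_def config_graph_def c)
qed

context amplitude
begin

definition config_term :: "'d config \<Rightarrow> formal" where
  "config_term = (\<lambda>(xs, m, f).
     cst (u ^ (length xs + m) * inverse u ^ length (concat xs) / (fact (length xs) * fact m)) *
     ((\<Prod>as\<leftarrow>xs. CF as) * (\<Prod>w\<in>white_labels m. EV (selected f (concat xs) w))))"

text \<open>Over a fixed labelled graph, a configuration amounts to a free list of dummy indices and
  an attachment of white ends. Summing over the former gives the amplitude, the same for every
  attachment; the number of attachments is the multiplicity factor.\<close>

lemma sum_config_graph_fibre:
  assumes G: "G \<in> all_graphs"
  shows "finite {c \<in> configurations :: 'd config set. config_graph c = G}"
    and "(\<Sum>c | c \<in> configurations \<and> config_graph c = G. config_term c) = labelled_term G"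
proof -
  obtain n m E where g: "G = BGraph n m E" by (cases G)
  let ?V = "standard_verts n m"
  have adm: "admissible ?V E" using G by (simp add: all_graphs_iff g)
  have E: "set_mset E \<subseteq> {1..int n} \<times> {- int m..-1}" and E': "set_mset E \<subseteq> pos ?V \<times> neg ?V"
    using adm by (auto simp: admissible_def)
  have E_snd: "snd ` set_mset E \<subseteq> white_labels m" using E by (force simp: white_labels_def)
  \<comment> \<open>Block lengths have to be the black valences of G, so the block structure of
    every configuration over G is forced.\<close>
  define ls where "ls = map (\<lambda>i. count (image_mset fst E) (1 + int i)) [0..<n]"
  define bl where "bl = block_labels 1 ls"
  have len_ls: "length ls = n" by (simp add: ls_def)
  have bl: "mset bl = image_mset fst E"
  proof (rule multiset_eqI)
    fix v
    show "count (mset bl) v = count (image_mset fst E) v"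
    proof (cases "v \<in> {1..int n}")
      case True
      then have "nat (v - 1) < n" "v = 1 + int (nat (v - 1))" by auto
      then show ?thesis
        using count_block_labels[of "nat (v - 1)" ls 1] len_ls by (simp add: bl_def count_mset ls_def)
    next
      case False
      then have "v \<notin> set bl" using set_block_labels[of 1 ls] len_ls by (auto simp: bl_def)
      moreover have "v \<notin># image_mset fst E" using False E by auto
      ultimately show ?thesis by (metis not_in_iff set_mset_mset)
    qed
  qed
  have sz: "sum_list ls = size E" using bl by (metis bl_def length_block_labels size_image_mset size_mset)
  have ls1: "l \<noteq> 1" if l: "l \<in> set ls" for l
  proof -
    obtain i where i: "i < n" "l = count (image_mset fst E) (1 + int i)" using l by (auto simp: ls_def)
    then have "l = size (filter_mset (attached (1 + int i)) E)" using valence_eq_count_fst[OF E'] by simp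
    then show ?thesis using adm i(1) by (simp add: admissible_def)
  qed
  let ?BS = "{bs :: 'd list. length bs = size E}" and ?FS = "edge_endings bl E"
  let ?j = "\<lambda>(bs, f). (split_blocks ls bs, m, f)" and ?i = "\<lambda>(xs, m, f). (concat xs, f)"
  let ?X = "{c \<in> configurations :: 'd config set. config_graph c = G}"
  have ji: "?j (?i c) = c \<and> ?i c \<in> ?BS \<times> ?FS" if "c \<in> ?X" for c
  proof -
    obtain xs m' f where c: "c = (xs, m', f)" by (cases c)
    have conf: "length f = length (concat xs)" and cg: "length xs = n" "m' = m"
      "mset (zip (block_labels 1 (map length xs)) f) = E"
      using that by (auto simp: c configurations_def config_graph_def g)
    let ?bl = "block_labels 1 (map length xs)"
    have len: "length ?bl = length f" using conf by (simp add: length_concat)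
    have "image_mset fst E = mset (map fst (zip ?bl f))" unfolding cg(3)[symmetric] by simp
    then have "mset ?bl = image_mset fst E" using map_fst_zip[OF len] by simp
    then have "count_list ?bl v = count (image_mset fst E) v" for v by (metis count_mset)
    then have "map length xs = ls"
      using counts_block_labels[of 1 "map length xs"] cg(1) by (simp add: ls_def)
    then have "split_blocks ls (concat xs) = xs" "f \<in> ?FS" "length (concat xs) = size E"
      using split_blocks_concat[of xs] cg(3) len sz unfolding bl_def edge_endings_def
      by (auto simp: length_concat)
    then show ?thesis by (simp add: c cg)
  qed
  have ij: "?i (?j p) = p \<and> ?j p \<in> ?X" if "p \<in> ?BS \<times> ?FS" for p
  proof -
    obtain bs f where p: "p = (bs, f)" by (cases p)
    have bs: "length bs = sum_list ls" and f: "length f = length bl" "mset (zip bl f) = E" "set f \<subseteq> white_labels m"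
      using that sz set_edge_endings[of f bl E] E_snd by (auto simp: p edge_endings_def)
    note cs = concat_split_blocks[OF bs] and ml = map_length_split_blocks[OF bs]
    have "length as \<noteq> 1" if "as \<in> set (split_blocks ls bs)" for as
      using ls1 that ml by (metis image_eqI list.set_map)
    then show ?thesis
      using f bs cs ml len_ls unfolding p configurations_def config_graph_def g
      by (auto simp: bl_def) (metis length_map)+
  qed
  have bij: "bij_betw ?i ?X (?BS \<times> ?FS)"
    by (rule bij_betwI[where g = ?j]) (use ij ji in auto)
  have finX: "finite (?BS \<times> ?FS)" by (intro finite_cartesian_product finite_length_eq finite_edge_endings)
  show "finite ?X" unfolding bij_betw_finite[OF bij] by (rule finX)
  define c0 where "c0 = u ^ (n + m) * inverse u ^ size E / (fact n * fact m)"
  have ct: "config_term (?j (bs, f)) = cst c0 *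
     ((\<Prod>v\<in>pos ?V. CF (edge_indices (zip bl f) bs v)) * (\<Prod>w\<in>neg ?V. EV (edge_indices (zip bl f) bs w)))"
    if bs': "bs \<in> ?BS" and f': "f \<in> ?FS" for bs f
  proof -
    have bs: "length bs = sum_list ls" and f: "length f = length bl" "mset (zip bl f) = E" "set f \<subseteq> white_labels m"
      using bs' f' sz set_edge_endings[of f bl E] E_snd by (auto simp: edge_endings_def)
    note cs = concat_split_blocks[OF bs] and ml = map_length_split_blocks[OF bs]
    have lx: "length (split_blocks ls bs) = n" using ml len_ls by (metis length_map)
    have "w < 1" if "w \<in> set f" for w using f(3) that by (force simp: white_labels_def)
    then have "(\<Prod>v\<in>{1..<1 + int n}. CF (edge_indices (zip bl f) bs v)) = (\<Prod>as\<leftarrow>split_blocks ls bs. CF as)"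
      using prod_edge_indices_blocks[of f "split_blocks ls bs" 1 CF] f bs
      unfolding cs ml lx bl_def[symmetric] by (auto simp: bl_def)
    moreover have "{1..<1 + int n} = {1..int n}" by auto
    moreover have "edge_indices (zip bl f) bs w = selected f bs w" if "w \<in> white_labels m" for w
      using set_block_labels[of 1 ls] that f bs
      by (intro selected_eq_edge_indices) (auto simp: bl_def white_labels_def)
    ultimately show ?thesis
      using bs sz by (simp add: config_term_def c0_def lx cs white_labels_def)
  qed
  have "(\<Sum>c\<in>?X. config_term c) = (\<Sum>p\<in>?BS \<times> ?FS. config_term (?j p))"
    by (rule sum.reindex_bij_witness[where j = ?i and i = ?j]) (use ij ji in auto)
  also have "\<dots> = (\<Sum>bs\<in>?BS. \<Sum>f\<in>?FS. config_term (?j (bs, f)))"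
    unfolding sum.cartesian_product by (intro sum.cong refl) auto
  also have "\<dots> = (\<Sum>f\<in>?FS. \<Sum>bs\<in>?BS. config_term (?j (bs, f)))" by (rule sum.swap)
  also have "\<dots> = (\<Sum>f\<in>?FS. cst c0 * amp (pos ?V) (neg ?V) (zip bl f))"
  proof (intro sum.cong refl)
    fix f assume f: "f \<in> ?FS"
    then have "length (zip bl f) = size E" by (metis (mono_tags, lifting) edge_endings_def mem_Collect_eq size_mset)
    then show "(\<Sum>bs\<in>?BS. config_term (?j (bs, f))) = cst c0 * amp (pos ?V) (neg ?V) (zip bl f)"
      unfolding amp_def sum_distrib_left using ct[OF _ f] by (intro sum.cong) auto
  qed
  \<comment> \<open>All attachments list the same multiset of edges and hence have the same
    amplitude.\<close>
  also have "\<dots> = (\<Sum>f\<in>?FS. cst c0 * amp (pos ?V) (neg ?V) (some_list E))"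
    by (intro sum.cong refl arg_cong[where f = "\<lambda>x. cst c0 * x"] amp_mset_eq) (simp add: edge_endings_def)
  also have "\<dots> = of_nat (card ?FS) * (cst c0 * amp (pos ?V) (neg ?V) (some_list E))" by simp
  also have "\<dots> = cst (multiplicity_factor (pos ?V) (neg ?V) E * c0) * amp (pos ?V) (neg ?V) (some_list E)"
    unfolding card_edge_endings_eq_factor[OF E' finite_standard bl[symmetric], symmetric] cst_of_nat[symmetric] cst_mult_assoc ..
  also have "\<dots> = labelled_term G"
  proof -
    have "card ?V = n + m" unfolding standard_verts_def by (subst card_Un_disjoint) auto
    then have "multiplicity_factor (pos ?V) (neg ?V) E * c0 =
       1 / (fact n * fact m) * (u ^ card ?V * inverse u ^ size E * multiplicity_factor (pos ?V) (neg ?V) E)"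
      by (simp add: c0_def)
    then show ?thesis by (simp only: labelled_term_def wt_def g bgraph.sel verts_BGraph cst_mult_assoc)
  qed
  finally show "(\<Sum>c | c \<in> configurations \<and> config_graph c = G. config_term c) = labelled_term G" .
qed

lemma has_formal_sum_labelled_term:
  assumes "has_formal_sum config_term s configurations"
  shows "has_formal_sum labelled_term s all_graphs"
proof (rule has_formal_sum_group[OF assms, where h = config_graph])
  show "config_graph ` configurations \<subseteq> all_graphs" using config_graph_in_all_graphs by blast
  show "has_formal_sum config_term (labelled_term G) {c \<in> configurations. config_graph c = G}"
    if "G \<in> all_graphs" for G
    using has_formal_sum_finite[OF sum_config_graph_fibre(1)[OF that], of config_term]
      sum_config_graph_fibre(2)[OF that] by simp
qed

end

subsection \<open>Summability over configurations\<close>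

definition t_order_ge :: "nat \<Rightarrow> formal \<Rightarrow> bool" where
  "t_order_ge n F \<longleftrightarrow> (\<forall>D<n. \<forall>k. cf D k F = 0)"

lemma t_order_ge_0 [simp]: "t_order_ge 0 F"
  by (simp add: t_order_ge_def)

lemma t_order_ge_mult:
  assumes "t_order_ge n F" "t_order_ge m G" shows "t_order_ge (n + m) (F * G)"
  unfolding t_order_ge_def
proof (intro allI impI)
  fix D k assume D: "D < n + m"
  have "cf i j F * cf (D - i) (k - j) G = 0" if "i \<le> D" for i j
  proof -
    have "i < n \<or> D - i < m" using D that by arith
    then show ?thesis using assms unfolding t_order_ge_def by auto
  qed
  then show "cf D k (F * G) = 0" unfolding cf_mult by (simp add: sum.neutral)
qed

lemma t_order_ge_cst_mult: "t_order_ge n F \<Longrightarrow> t_order_ge n (cst z * F)"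
  by (simp add: t_order_ge_def)

lemma nrm_eq_0: "t_order_ge n F \<Longrightarrow> D < n \<Longrightarrow> nrm D k F = 0"
  unfolding nrm_def t_order_ge_def by (simp add: sum.neutral)

lemma summable_power_exp_bound:
  fixes q :: real
  assumes "q \<ge> 0"
  shows "(\<lambda>n. (1 + real n) ^ D * q ^ n / fact n) summable_on UNIV"
proof (rule summable_nonneg_imp_summable_on)
  \<comment> \<open>x^D / D! is a single term of the exponential series of x = 1 + n, so the
    polynomial factor costs no more than replacing q by e q.\<close>
  have pow: "(1 + real n) ^ D \<le> fact D * (exp 1 * exp 1 ^ n)" for n
  proof -
    let ?x = "1 + real n"
    have "(\<Sum>i\<in>{D}. ?x ^ i /\<^sub>R fact i) \<le> (\<Sum>i. ?x ^ i /\<^sub>R fact i)"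
      by (rule sum_le_suminf[OF summable_exp_generic]) auto
    also have "\<dots> = exp ?x" by (simp add: exp_def)
    finally have "?x ^ D \<le> fact D * exp ?x" by (simp add: field_simps)
    also have "exp ?x = exp 1 * exp 1 ^ n" by (simp add: exp_add exp_of_nat_mult[symmetric])
    finally show ?thesis .
  qed
  show "summable (\<lambda>n. (1 + real n) ^ D * q ^ n / fact n)"
  proof (rule summable_comparison_test'[where N = 0])
    show "summable (\<lambda>n. fact D * exp 1 * ((exp 1 * q) ^ n /\<^sub>R fact n))"
      by (intro summable_mult summable_exp_generic)
    fix n :: nat
    have "(1 + real n) ^ D * q ^ n / fact n \<le> fact D * (exp 1 * exp 1 ^ n) * q ^ n / fact n"
      using pow[of n] assms by (intro divide_right_mono mult_right_mono) auto
    also have "\<dots> = fact D * exp 1 * ((exp 1 * q) ^ n /\<^sub>R fact n)"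
      by (simp add: power_mult_distrib field_simps)
    finally show "norm ((1 + real n) ^ D * q ^ n / fact n) \<le> fact D * exp 1 * ((exp 1 * q) ^ n /\<^sub>R fact n)"
      using assms by simp
  qed
qed (use assms in auto)

lemma card_lists_le:
  assumes "finite A" shows "card {xs. set xs \<subseteq> A \<and> length xs \<le> D} \<le> Suc D * (1 + card A) ^ D"
proof -
  have "(\<Sum>i\<le>D. card A ^ i) \<le> (\<Sum>i\<le>D. (1 + card A) ^ D)"
  proof (intro sum_mono)
    fix i assume "i \<in> {..D}"
    have "card A ^ i \<le> (1 + card A) ^ i" by (rule power_mono) auto
    also have "\<dots> \<le> (1 + card A) ^ D" using \<open>i \<in> {..D}\<close> by (intro power_increasing) auto
    finally show "card A ^ i \<le> (1 + card A) ^ D" .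
  qed
  then show ?thesis by (simp add: card_lists_length_le[OF assms])
qed

definition small_configurations :: "nat \<Rightarrow> nat \<Rightarrow> nat \<Rightarrow> 'd config set" where
  "small_configurations D n m =
     {c \<in> configurations. length (fst c) = n \<and> fst (snd c) = m \<and> length (concat (fst c)) \<le> D}"

text \<open>Three lists of length at most D encode such a configuration: the black label of each
  position, its index and its white label. The alphabets have n, \<open>CARD('d)\<close> and m
  elements, and each list contributes a factor \<open>Suc D\<close> for its possible
  lengths.\<close>

lemma card_small_configurations:
  shows "finite (small_configurations D n m :: 'd::finite config set)"
    and "real (card (small_configurations D n m :: 'd config set)) \<le>
       (real (Suc D) ^ 3 * (1 + real CARD('d)) ^ D) * ((1 + real n) ^ D * (1 + real m) ^ D)"
proof -
  let ?LB = "{bl. set bl \<subseteq> {1..int n} \<and> length bl \<le> D}"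
  let ?LD = "{bs :: 'd list. set bs \<subseteq> UNIV \<and> length bs \<le> D}"
  let ?LF = "{f. set f \<subseteq> white_labels m \<and> length f \<le> D}"
  let ?\<Phi> = "\<lambda>(bl, bs :: 'd list, f). (split_blocks (map (\<lambda>i. count_list bl (1 + int i)) [0..<n]) bs, m, f)"
  have fin: "finite (?LB \<times> ?LD \<times> ?LF)"
    by (intro finite_cartesian_product finite_lists_length_le) (auto simp: white_labels_def)
  have sub: "(small_configurations D n m :: 'd config set) \<subseteq> ?\<Phi> ` (?LB \<times> ?LD \<times> ?LF)"
  proof
    fix c :: "'d config" assume c: "c \<in> small_configurations D n m"
    obtain xs f where c': "c = (xs, m, f)" "length xs = n" "length (concat xs) \<le> D"
      "length f = length (concat xs)" "set f \<subseteq> white_labels m"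
      using c by (cases c) (auto simp: small_configurations_def configurations_def)
    let ?bl = "block_labels 1 (map length xs)"
    have "set ?bl \<subseteq> {1..int n}" using set_block_labels[of 1 "map length xs"] c'(2) by auto
    moreover have "length ?bl \<le> D" using c'(3) by (simp add: length_concat)
    ultimately have "(?bl, concat xs, f) \<in> ?LB \<times> ?LD \<times> ?LF" using c' by auto
    moreover have "?\<Phi> (?bl, concat xs, f) = c"
      using counts_block_labels[of 1 "map length xs"] split_blocks_concat[of xs] c' by simp
    ultimately show "c \<in> ?\<Phi> ` (?LB \<times> ?LD \<times> ?LF)" by (metis (no_types, lifting) imageI)
  qed
  show "finite (small_configurations D n m :: 'd config set)"
    using finite_subset[OF sub] fin by blast
  have "card (small_configurations D n m :: 'd config set) \<le> card (?\<Phi> ` (?LB \<times> ?LD \<times> ?LF))"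
    using sub fin by (intro card_mono) auto
  also have "\<dots> \<le> card (?LB \<times> ?LD \<times> ?LF)" by (rule card_image_le[OF fin])
  also have "\<dots> = card ?LB * (card ?LD * card ?LF)" by (simp add: card_cartesian_product)
  also have "\<dots> \<le> (Suc D * (1 + n) ^ D) * ((Suc D * (1 + CARD('d)) ^ D) * (Suc D * (1 + m) ^ D))"
    using card_lists_le[of "{1..int n}" D] card_lists_le[of "UNIV :: 'd set" D] card_lists_le[of "white_labels m" D]
    by (intro mult_le_mono) (simp_all add: white_labels_def)
  finally have "real (card (small_configurations D n m :: 'd config set)) \<le>
      real ((Suc D * (1 + n) ^ D) * ((Suc D * (1 + CARD('d)) ^ D) * (Suc D * (1 + m) ^ D)))"
    by (rule of_nat_mono)
  also have "\<dots> = (real (Suc D) ^ 3 * (1 + real CARD('d)) ^ D) * ((1 + real n) ^ D * (1 + real m) ^ D)"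
    by (simp only: of_nat_mult of_nat_power of_nat_add of_nat_1 power3_eq_cube ac_simps)
  finally show "real (card (small_configurations D n m :: 'd config set)) \<le>
       (real (Suc D) ^ 3 * (1 + real CARD('d)) ^ D) * ((1 + real n) ^ D * (1 + real m) ^ D)" .
qed

lemma length_selected_le: "length (selected f bs w) \<le> length bs"
  unfolding selected_def by (simp add: order.trans[OF length_filter_le])

text \<open>The grading by t makes all configurations with more than D indices vanish in t-degree D,
  which leaves polynomially many for each pair n, m.\<close>

locale graded_amplitude = amplitude CF EV u for CF EV :: "'d::finite list \<Rightarrow> formal" and u +
  assumes CF_order: "\<And>as. length as \<ge> 2 \<Longrightarrow> t_order_ge (length as) (CF as)"
begin

lemma t_order_prod_CF:
  "(\<forall>as\<in>set xs. length as \<noteq> 1) \<Longrightarrow> t_order_ge (length (concat xs)) (\<Prod>as\<leftarrow>xs. CF as)"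
proof (induction xs)
  case (Cons as xs)
  have "t_order_ge (length as) (CF as)"
  proof (cases "as = []")
    case False
    moreover have "length as \<noteq> 1" using Cons.prems by auto
    ultimately have "length as \<ge> 2" by (cases as) (auto simp: Suc_le_eq)
    then show ?thesis by (rule CF_order)
  qed simp
  moreover have "t_order_ge (length (concat xs)) (\<Prod>as\<leftarrow>xs. CF as)" using Cons by simp
  ultimately show ?case using t_order_ge_mult by simp
qed simp

lemma nrm_config_term_eq_0:
  assumes "(xs, m, f) \<in> configurations" "D < length (concat xs)"
  shows "nrm D k (config_term (xs, m, f)) = 0"
proof -
  have "t_order_ge (length (concat xs)) (\<Prod>as\<leftarrow>xs. CF as)"
    using assms(1) t_order_prod_CF by (auto simp: configurations_def)
  from t_order_ge_mult[OF this t_order_ge_0] show ?thesis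
    unfolding config_term_def prod.case by (intro nrm_eq_0[OF t_order_ge_cst_mult assms(2)]) simp
qed

lemma nrm_config_term_le:
  assumes c: "(xs, m, f) \<in> configurations" and D: "length (concat xs) \<le> D"
    and M: "\<And>as. length as \<le> D \<Longrightarrow> nrm D k (CF as) \<le> M" "\<And>as. length as \<le> D \<Longrightarrow> nrm D k (EV as) \<le> M"
  defines "q \<equiv> norm u * M"
  shows "nrm D k (config_term (xs, m, f)) \<le> (1 + norm (inverse u)) ^ D * (q ^ length xs / fact (length xs) * (q ^ m / fact m))"
proof -
  define n where "n = length xs"
  have M0: "M \<ge> 0" by (rule order.trans[OF nrm_nonneg M(1)[of "[]"]]) simp
  have lx: "length as \<le> D" if "as \<in> set xs" for as
    using that D member_le_sum_list[of "length as" "map length xs"] by (simp add: length_concat)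
  have 1: "nrm D k (\<Prod>as\<leftarrow>xs. CF as) \<le> M ^ n"
    unfolding n_def by (rule nrm_prod_list) (rule M(1)[OF lx])
  have "nrm D k (\<Prod>w\<in>white_labels m. EV (selected f (concat xs) w)) \<le> M ^ card (white_labels m)"
    by (rule nrm_prod) (rule M(2)[OF order.trans[OF length_selected_le D]])
  then have 2: "nrm D k (\<Prod>w\<in>white_labels m. EV (selected f (concat xs) w)) \<le> M ^ m"
    by (simp add: white_labels_def)
  have "norm (inverse u) ^ length (concat xs) \<le> (1 + norm (inverse u)) ^ length (concat xs)"
    by (rule power_mono) auto
  also have "\<dots> \<le> (1 + norm (inverse u)) ^ D" by (rule power_increasing[OF D]) simp
  finally have 3: "norm (inverse u) ^ length (concat xs) \<le> (1 + norm (inverse u)) ^ D" .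
  have "nrm D k (config_term (xs, m, f)) \<le>
      norm (u ^ (n + m) * inverse u ^ length (concat xs) / (fact n * fact m)) * (M ^ n * M ^ m)"
    unfolding config_term_def prod.case nrm_cst_mult n_def[symmetric] using 1 2 M0
    by (intro mult_left_mono order.trans[OF nrm_mult] mult_mono) auto
  also have "\<dots> = norm (inverse u) ^ length (concat xs) * (q ^ n / fact n * (q ^ m / fact m))"
    by (simp add: q_def norm_mult norm_divide norm_power power_add power_mult_distrib del: norm_inverse)
  also have "\<dots> \<le> (1 + norm (inverse u)) ^ D * (q ^ n / fact n * (q ^ m / fact m))"
    using 3 M0 by (intro mult_right_mono) (auto simp: q_def)
  finally show ?thesis unfolding n_def .
qed

lemma formal_summable_config_term: "formal_summable config_term configurations"
proof (rule formal_summable_nrm)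
  fix D k
  \<comment> \<open>Only finitely many index lists have length at most D, so one constant bounds
    every factor that matters; the sum stands in for a maximum.\<close>
  define M where "M = (\<Sum>as | length (as :: 'd list) \<le> D. nrm D k (CF as) + nrm D k (EV as))"
  have fin: "finite {as :: 'd list. length as \<le> D}"
    using finite_lists_length_le[of "UNIV :: 'd set" D] by simp
  have M: "nrm D k (CF as) \<le> M" "nrm D k (EV as) \<le> M" if "length as \<le> D" for as
  proof -
    have "nrm D k (CF as) + nrm D k (EV as) \<le> M"
      unfolding M_def using fin that by (intro member_le_sum) auto
    then show "nrm D k (CF as) \<le> M" "nrm D k (EV as) \<le> M"
      using nrm_nonneg[of D k "CF as"] nrm_nonneg[of D k "EV as"] by linarith+
  qed
  define q where "q = norm u * M"
  have q: "q \<ge> 0" unfolding q_def M_def by (intro mult_nonneg_nonneg sum_nonneg add_nonneg_nonneg) auto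
  define R where "R = (1 + norm (inverse u)) ^ D"
  have R: "R \<ge> 0" by (simp add: R_def)
  define a where "a n = (1 + real n) ^ D * q ^ n / fact n" for n
  have a: "a n \<ge> 0" for n using q by (simp add: a_def)
  define K where "K = real (Suc D) ^ 3 * (1 + real CARD('d)) ^ D"
  let ?S = "\<lambda>p. small_configurations D (fst p) (snd p) :: 'd config set"
  let ?N = "\<lambda>c. nrm D k (config_term c)"
  have "(\<lambda>n. complex_of_real (a n)) summable_on UNIV"
    unfolding a_def by (rule summable_on_of_real[OF summable_power_exp_bound[OF q]])
  from summable_on_product_complex[OF this this]
  have "(\<lambda>p. a (fst p) * a (snd p)) summable_on UNIV"
    unfolding summable_on_iff_norm using a by (simp add: norm_mult)
  then have sa: "(\<lambda>p. K * R * (a (fst p) * a (snd p))) summable_on UNIV"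
    by (rule summable_on_cmult_right)
  have "(\<lambda>x. ?N (snd x)) summable_on (Sigma UNIV ?S)"
  proof (rule summable_on_SigmaI)
    fix p :: "nat \<times> nat"
    show "((\<lambda>c. ?N (snd (p, c))) has_sum (\<Sum>c\<in>?S p. ?N c)) (?S p)"
      by (simp add: card_small_configurations(1))
  next
    show "(\<lambda>p. \<Sum>c\<in>?S p. ?N c) summable_on UNIV"
    proof (rule summable_on_comparison_test[OF sa])
      fix p :: "nat \<times> nat"
      obtain n m where p: "p = (n, m)" by (cases p)
      let ?b = "R * (q ^ n / fact n * (q ^ m / fact m))"
      have b: "?b \<ge> 0" using R q by simp
      have "?N c \<le> ?b" if "c \<in> ?S p" for c
      proof -
        obtain xs m' f where c: "c = (xs, m', f)" by (cases c)
        then have "m' = m" "length xs = n" "length (concat xs) \<le> D" "(xs, m, f) \<in> configurations"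
          using that by (auto simp: small_configurations_def p)
        with c show ?thesis using nrm_config_term_le[of xs m f D k M] M by (simp add: R_def q_def)
      qed
      then have "(\<Sum>c\<in>?S p. ?N c) \<le> real (card (?S p)) * ?b"
        using sum_bounded_above[of "?S p" ?N ?b] by simp
      also have "\<dots> \<le> K * ((1 + real n) ^ D * (1 + real m) ^ D) * ?b"
        using card_small_configurations(2)[where 'd = 'd, of D n m] b unfolding p K_def fst_conv snd_conv by (rule mult_right_mono)
      also have "\<dots> = K * R * (a n * a m)" by (simp add: a_def mult_ac)
      finally show "(\<Sum>c\<in>?S p. ?N c) \<le> K * R * (a (fst p) * a (snd p))" by (simp add: p)
    qed (auto intro: sum_nonneg)
  qed simp
  moreover have "bij_betw snd (Sigma UNIV ?S) {c \<in> configurations. length (concat (fst c)) \<le> D}"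
    by (rule bij_betwI[where g = "\<lambda>c. ((length (fst c), fst (snd c)), c)"]) (auto simp: small_configurations_def)
  ultimately have "?N summable_on {c \<in> configurations. length (concat (fst c)) \<le> D}"
    using summable_on_reindex_bij_betw[of snd "Sigma UNIV ?S" _ ?N] by blast
  \<comment> \<open>The remaining configurations have more than D indices and norm zero.\<close>
  then show "?N summable_on configurations"
    by (subst summable_on_cong_neutral[where T = "{c \<in> configurations. length (concat (fst c)) \<le> D}" and g = ?N])
       (auto intro: nrm_config_term_eq_0)
qed

subsection \<open>Configurations and the expanded integral\<close>

text \<open>With \<open>EV\<close> given by derivatives of g, this is the Leibniz expansion of the
  derivatives \<open>bs\<close> of g^m at the formal point.\<close>

definition leibniz_sum :: "nat \<Rightarrow> 'd list \<Rightarrow> formal" where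
  "leibniz_sum m bs = (\<Sum>f | length f = length bs \<and> set f \<subseteq> white_labels m. \<Prod>w\<in>white_labels m. EV (selected f bs w))"

text \<open>Empty lists come from the exponential of u S^0 and nonempty ones from that of S^+. The
  key separates the two and forgets how they are interleaved.\<close>

definition fibre_key :: "'d config \<Rightarrow> 'd list list \<times> nat \<times> nat" where
  "fibre_key = (\<lambda>(xs, m, f). (filter (\<lambda>as. as \<noteq> []) xs, length (filter (\<lambda>as. as = []) xs), m))"

lemma shuffles_Nil_iff:
  assumes "[] \<notin> set ass"
  shows "xs \<in> shuffles ass (replicate k []) \<longleftrightarrow> filter (\<lambda>as. as \<noteq> []) xs = ass \<and> length (filter (\<lambda>as. as = []) xs) = k"
proof
  assume xs: "xs \<in> shuffles ass (replicate k [])"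
  have "filter (\<lambda>as. as \<noteq> []) xs \<in> filter (\<lambda>as. as \<noteq> []) ` shuffles ass (replicate k [])" using xs by blast
  moreover have "filter (\<lambda>as. as \<noteq> []) ass = ass" using assms by (intro filter_True) auto
  ultimately have 1: "filter (\<lambda>as. as \<noteq> []) xs = ass" unfolding filter_shuffles by simp
  have "filter (\<lambda>as. as = []) xs \<in> filter (\<lambda>as. as = []) ` shuffles ass (replicate k [])" using xs by blast
  moreover have "filter (\<lambda>as. as = []) ass = []" using assms by (intro filter_False) auto
  ultimately have "filter (\<lambda>as. as = []) xs = replicate k []" unfolding filter_shuffles by simp
  then show "filter (\<lambda>as. as \<noteq> []) xs = ass \<and> length (filter (\<lambda>as. as = []) xs) = k" using 1 by simp
next
  assume xs: "filter (\<lambda>as. as \<noteq> []) xs = ass \<and> length (filter (\<lambda>as. as = []) xs) = k"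
  have "filter (\<lambda>as. as = []) xs = replicate k []"
    using xs by (intro replicate_eqI) auto
  then show "xs \<in> shuffles ass (replicate k [])"
    using partition_in_shuffles[of xs "\<lambda>as. as \<noteq> []"] xs by simp
qed

lemma concat_filter_nonempty: "concat (filter (\<lambda>as. as \<noteq> []) xs) = concat xs"
  by (induction xs) auto

lemma prod_list_CF_filter:
  "(\<Prod>as\<leftarrow>xs. CF as) = CF [] ^ length (filter (\<lambda>as. as = []) xs) * (\<Prod>as\<leftarrow>filter (\<lambda>as. as \<noteq> []) xs. CF as)"
  by (induction xs) (auto simp: mult_ac)

definition index_term :: "'d list list \<Rightarrow> formal" where
  "index_term ass = cst (u ^ length ass / fact (length ass) * inverse u ^ length (concat ass)) * (\<Prod>as\<leftarrow>ass. CF as)"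

text \<open>There are n + k choose n ways to interleave n nonempty lists with k empty ones. This
  splits 1/(n + k)! into 1/n! and 1/k!, the coefficients of the two separate exponentials.\<close>

lemma sum_fibre_key:
  assumes ass: "\<forall>as\<in>set ass. length as \<ge> 2"
  shows "finite {c \<in> configurations. fibre_key c = (ass, k, m)}"
    and "(\<Sum>c | c \<in> configurations \<and> fibre_key c = (ass, k, m). config_term c) =
      index_term ass * (cst (1 / fact k) * (cst u * CF []) ^ k * (cst (u ^ m / fact m) * leibniz_sum m (concat ass)))"
proof -
  define n where "n = length ass"
  let ?F = "{f. length f = length (concat ass) \<and> set f \<subseteq> white_labels m}"
  have ne: "[] \<notin> set ass" using ass by force
  have X: "{c \<in> configurations. fibre_key c = (ass, k, m)} =
      (\<lambda>(xs, f). (xs, m, f)) ` (shuffles ass (replicate k []) \<times> ?F)" (is "?X = ?Y")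
  proof (intro equalityI subsetI)
    fix c assume "c \<in> ?X"
    then obtain xs f where c: "c = (xs, m, f)" "xs \<in> shuffles ass (replicate k [])" "length f = length (concat xs)" "set f \<subseteq> white_labels m"
      unfolding shuffles_Nil_iff[OF ne] by (cases c) (auto simp: configurations_def fibre_key_def)
    moreover have "concat xs = concat ass"
      using c(2) concat_filter_nonempty[of xs] unfolding shuffles_Nil_iff[OF ne] by simp
    ultimately show "c \<in> ?Y" by auto
  next
    fix c assume "c \<in> ?Y"
    then obtain xs f where c: "c = (xs, m, f)" "xs \<in> shuffles ass (replicate k [])" "f \<in> ?F" by auto
    then have xs: "filter (\<lambda>as. as \<noteq> []) xs = ass" "length (filter (\<lambda>as. as = []) xs) = k"
      unfolding shuffles_Nil_iff[OF ne] by auto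
    have "set xs \<subseteq> insert [] (set ass)" using set_shuffles[OF c(2)] by (auto simp: set_replicate_conv_if split: if_splits)
    then have "\<forall>as\<in>set xs. length as \<noteq> 1" using ass by force
    moreover have "concat xs = concat ass" using concat_filter_nonempty[of xs] xs by simp
    ultimately show "c \<in> ?X" using c xs by (auto simp: configurations_def fibre_key_def)
  qed
  have finF: "finite ?F" by (rule finite_lists_over) (simp add: white_labels_def)
  then show "finite ?X" unfolding X by (intro finite_imageI finite_cartesian_product finite_shuffles)
  have inj: "inj_on (\<lambda>(xs, f). (xs, m, f)) (shuffles ass (replicate k []) \<times> ?F)" by (auto simp: inj_on_def)
  let ?c = "cst (u ^ (n + k + m) * inverse u ^ length (concat ass) / (fact (n + k) * fact m))"
  have ct: "config_term (xs, m, f) = ?c * (CF [] ^ k * (\<Prod>as\<leftarrow>ass. CF as) * (\<Prod>w\<in>white_labels m. EV (selected f (concat ass) w)))"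
    if "xs \<in> shuffles ass (replicate k [])" for xs f
  proof -
    have xs: "filter (\<lambda>as. as \<noteq> []) xs = ass" "length (filter (\<lambda>as. as = []) xs) = k"
      using that unfolding shuffles_Nil_iff[OF ne] by auto
    have "concat xs = concat ass" using concat_filter_nonempty[of xs] xs by simp
    moreover have "length xs = n + k" using length_shuffles[OF that] by (simp add: n_def)
    ultimately show ?thesis using prod_list_CF_filter[of xs] xs by (simp add: config_term_def)
  qed
  have card: "card (shuffles ass (replicate k [])) = n + k choose n"
    using card_disjoint_shuffles[of ass "replicate k []"] ne by (auto simp: n_def set_replicate_conv_if)
  have "(\<Sum>c\<in>?X. config_term c) = (\<Sum>(xs, f)\<in>shuffles ass (replicate k []) \<times> ?F. config_term (xs, m, f))"
    unfolding X sum.reindex[OF inj] by (intro sum.cong refl) auto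
  also have "\<dots> = (\<Sum>xs\<in>shuffles ass (replicate k []). \<Sum>f\<in>?F. config_term (xs, m, f))"
    by (rule sum.cartesian_product[symmetric])
  also have "\<dots> = (\<Sum>xs\<in>shuffles ass (replicate k []). ?c * (CF [] ^ k * (\<Prod>as\<leftarrow>ass. CF as) * leibniz_sum m (concat ass)))"
    unfolding leibniz_sum_def sum_distrib_left by (intro sum.cong refl ct)
  also have "\<dots> = of_nat (n + k choose n) * (?c * (CF [] ^ k * (\<Prod>as\<leftarrow>ass. CF as) * leibniz_sum m (concat ass)))"
    by (simp add: card)
  also have "\<dots> = cst (of_nat (n + k choose n) * (u ^ (n + k + m) * inverse u ^ length (concat ass) / (fact (n + k) * fact m))) *
      (CF [] ^ k * (\<Prod>as\<leftarrow>ass. CF as) * leibniz_sum m (concat ass))"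
    unfolding cst_of_nat[symmetric] cst_mult_assoc ..
  also have "of_nat (n + k choose n) * (u ^ (n + k + m) * inverse u ^ length (concat ass) / (fact (n + k) * fact m)) =
      (u ^ n / fact n * inverse u ^ length (concat ass)) * (1 / fact k * u ^ k * (u ^ m / fact m))"
    by (simp add: binomial_fact power_add)
  also have "cst \<dots> * (CF [] ^ k * (\<Prod>as\<leftarrow>ass. CF as) * leibniz_sum m (concat ass)) =
     index_term ass * (cst (1 / fact k) * (cst u * CF []) ^ k * (cst (u ^ m / fact m) * leibniz_sum m (concat ass)))"
    unfolding index_term_def n_def[symmetric] cst_mult cst_power power_mult_distrib by (simp only: ac_simps)
  finally show "(\<Sum>c | c \<in> configurations \<and> fibre_key c = (ass, k, m). config_term c) =
      index_term ass * (cst (1 / fact k) * (cst u * CF []) ^ k * (cst (u ^ m / fact m) * leibniz_sum m (concat ass)))" .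
qed

text \<open>The sum over keys factors into three series: over the empty lists, the nonempty lists
  and the powers of g. Their convergence is obtained from the whole family or, for the powers of g,
  from \<open>Ev\<close>.\<close>

lemma config_sum_eq_pullback:
  assumes s: "has_formal_sum config_term s configurations"
    and Ev: "\<And>bs. has_formal_sum (\<lambda>m. cst (u ^ m / fact m) * leibniz_sum m bs) (Ev bs) UNIV"
  shows "formal_exp (cst u * CF []) *
    formal_sum (\<lambda>ass. index_term ass * Ev (concat ass)) {ass. \<forall>as\<in>set ass. length as \<ge> 2} = s"
proof -
  let ?L = "{ass :: 'd list list. \<forall>as\<in>set ass. length as \<ge> 2}"
  define e where "e k = cst (1 / fact k) * (cst u * CF []) ^ k" for k
  define y where "y ass m = cst (u ^ m / fact m) * leibniz_sum m (concat ass)" for ass m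
  let ?g = "\<lambda>(ass, k, m). index_term ass * (e k * y ass m)"
  have g: "has_formal_sum ?g s (?L \<times> UNIV \<times> UNIV)"
  proof (rule has_formal_sum_group[OF s, where h = fibre_key])
    show "fibre_key ` configurations \<subseteq> ?L \<times> UNIV \<times> UNIV"
    proof (clarsimp simp: configurations_def fibre_key_def)
      fix xs :: "'d list list" and as
      assume "\<forall>as\<in>set xs. length as \<noteq> Suc 0" "as \<in> set xs" "as \<noteq> []"
      then show "2 \<le> length as" by (cases as) (auto simp: Suc_le_eq)
    qed
    fix b assume "b \<in> ?L \<times> (UNIV :: nat set) \<times> (UNIV :: nat set)"
    then obtain ass k m where b: "b = (ass, k, m)" "\<forall>as\<in>set ass. length as \<ge> 2" by auto
    show "has_formal_sum config_term (?g b) {c \<in> configurations. fibre_key c = b}"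
      using has_formal_sum_finite[OF sum_fibre_key(1)[OF b(2)], of config_term k m] sum_fibre_key(2)[OF b(2), of k m]
      by (simp add: b(1) e_def y_def)
  qed
  note gs = has_formal_sum_imp(1)[OF g]
  \<comment> \<open>With no nonempty list and m = 0, exactly the terms of the exponential of u S^0
    remain, so this series converges as a subfamily.\<close>
  have "index_term [] = 1" by (simp add: index_term_def)
  moreover have "{f. f = [] \<and> set f \<subseteq> white_labels 0} = {[]}" by auto
  then have "y [] 0 = 1" by (simp add: y_def leibniz_sum_def white_labels_def)
  ultimately have g0: "?g ([], k, 0) = e k" for k by simp
  have "bij_betw (\<lambda>k :: nat. ([] :: 'd list list, k, 0 :: nat)) UNIV ({[]} \<times> UNIV \<times> {0})"
    by (rule bij_betwI[where g = "fst \<circ> snd"]) auto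
  note re = formal_summable_reindex[OF this, of ?g, unfolded g0]
  have "formal_summable ?g ({[]} \<times> UNIV \<times> {0})"
    by (rule formal_summable_subset[OF gs]) auto
  then have "formal_summable e UNIV" using re by blast
  then have E: "has_formal_sum e (formal_exp (cst u * CF [])) UNIV"
    unfolding formal_exp_def e_def by (rule formal_summable_imp)
  have Y: "has_formal_sum (y ass) (Ev (concat ass)) UNIV" for ass
    unfolding y_def using Ev by simp
  have e0: "e 0 = 1" by (simp add: e_def)
  \<comment> \<open>Setting k = 0 likewise isolates the integral without the prefactor.\<close>
  have "formal_summable ?g (?L \<times> {0} \<times> UNIV)"
    by (rule formal_summable_subset[OF gs]) auto
  from formal_summable_imp[OF this]
  have "has_formal_sum (\<lambda>ass. index_term ass * Ev (concat ass)) (formal_sum ?g (?L \<times> {0} \<times> UNIV)) ?L"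
  proof (rule has_formal_sum_SigmaD)
    fix ass assume "ass \<in> ?L"
    have "bij_betw (\<lambda>m :: nat. (0 :: nat, m)) UNIV ({0} \<times> UNIV)"
      by (rule bij_betwI[where g = snd]) auto
    from has_formal_sum_reindex[OF this, of "\<lambda>b. ?g (ass, b)"] has_formal_sum_mult[OF Y[of ass], of "index_term ass"]
    show "has_formal_sum (\<lambda>b. ?g (ass, b)) (index_term ass * Ev (concat ass)) ({0} \<times> UNIV)"
      by (simp add: e0)
  qed
  then have X: "has_formal_sum (\<lambda>ass. index_term ass * Ev (concat ass))
     (formal_sum (\<lambda>ass. index_term ass * Ev (concat ass)) ?L) ?L"
    by (intro formal_summable_imp has_formal_sum_imp(1))
  have "has_formal_sum (\<lambda>ass. formal_exp (cst u * CF []) * (index_term ass * Ev (concat ass))) s ?L"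
  proof (rule has_formal_sum_SigmaD[OF g])
    fix ass assume "ass \<in> ?L"
    show "has_formal_sum (\<lambda>b. ?g (ass, b)) (formal_exp (cst u * CF []) * (index_term ass * Ev (concat ass))) (UNIV \<times> UNIV)"
      using has_formal_sum_mult[OF has_formal_sum_Times[OF E Y[of ass]], of "index_term ass"]
      by (simp add: case_prod_unfold mult_ac)
  qed
  then show ?thesis
    using has_formal_sum_unique has_formal_sum_mult[OF X] by blast
qed

end

section \<open>The pullback as a sum over graphs\<close>

text \<open>The white vertices are grouped by the number of edges they share with \<open>v\<close>,
  which turns powers of factorials into one factorial per neighbour.\<close>

lemma vertex_factor_eq:
  "vertex_factor G v = fact (size (filter_mset (attached v) (edges G))) / (\<Prod>w\<in>whites G. fact (count (edges G) (v, w)))"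
proof -
  let ?c = "\<lambda>w. count (edges G) (v, w)"
  have le: "?c w \<le> valence G v" for w
  proof -
    have "count (filter_mset (attached v) (edges G)) (v, w) \<le> size (filter_mset (attached v) (edges G))"
      by (rule count_le_size)
    then show ?thesis by (simp add: valence_def attached_def)
  qed
  have fin: "finite (whites G)" by (simp add: whites_def)
  have "(\<Prod>w\<in>whites G. fact (?c w) :: complex) = (\<Prod>i\<in>{0..valence G v}. \<Prod>w | w \<in> whites G \<and> ?c w = i. fact (?c w))"
    using le by (intro prod.group[symmetric] fin) auto
  also have "\<dots> = (\<Prod>i\<in>{0..valence G v}. fact i ^ num_nbrs G v i)"
    by (intro prod.cong refl) (simp add: num_nbrs_def)
  \<comment> \<open>White vertices that share no edge with \<open>v\<close> contribute powers of 0!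
    = 1.\<close>
  also have "\<dots> = (\<Prod>i\<in>{1..valence G v}. fact i ^ num_nbrs G v i)"
    by (intro prod.mono_neutral_right) (auto simp: Suc_le_eq)
  finally have "(\<Prod>w\<in>whites G. fact (?c w) :: complex) = (\<Prod>i\<in>{1..valence G v}. fact i ^ num_nbrs G v i)" .
  then show ?thesis by (simp only: vertex_factor_def valence_def)
qed

lemma mset_edge_list: "mset (edge_list G) = edges G"
  unfolding edge_list_def using ex_mset by (rule someI_ex)

lemma indices_at_eq: "indices_at G as v = edge_indices (edge_list G) as v"
  by (simp add: indices_at_def edge_indices_def)

lemma prod_vertex_factor:
  "(\<Prod>v\<in>blacks G. vertex_factor G v) = multiplicity_factor (pos (verts G)) (neg (verts G)) (edges G)"
  unfolding vertex_factor_eq multiplicity_factor_def blacks_eq_pos[symmetric] whites_eq_neg[symmetric] ..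

theorem mainTheorem6:
  fixes U :: "(real ^ 'n::finite) set" and V :: "(real ^ 'd::finite) set"
    and S :: "('d, 'n) genfun" and g :: "real ^ 'd \<Rightarrow> complex"
    and x :: "real ^ 'n" and h :: complex
  assumes "quantum_generating_function U V S"
    and "smooth_on V g"
    and "x \<in> U"
    and "h \<noteq> 0"
  shows "formal_summable (\<lambda>C. connected_term h S g x (rep C)) (connected_graphs // graph_iso) \<and>
    formal_summable (\<lambda>C. graph_term h S g x (rep C)) (all_graphs // graph_iso) \<and>
    quantum_pullback h S (\<lambda>y. exp (\<i> / h * g y)) x =
      formal_exp (cst (\<i> / h) *
        formal_sum (\<lambda>C. connected_term h S g x (rep C)) (connected_graphs // graph_iso)) \<and>
    quantum_pullback h S (\<lambda>y. exp (\<i> / h * g y)) x =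
      formal_sum (\<lambda>C. graph_term h S g x (rep C)) (all_graphs // graph_iso)"
proof -
  define u where "u = \<i> / h"
  have u: "u \<noteq> 0" "inverse u = h / \<i>" using assms(4) by (simp_all add: u_def)
  define c where "c = phi h S x"
  define CF where "CF as = coef h S as x" for as
  define EV where "EV as = eval_at (partials as g) c" for as
  have V: "open V" using assms(1) by (simp add: quantum_generating_function_def)
  obtain y where y: "y \<in> V" "\<And>i. fps_nth (S [i] x) 0 = of_real (y $ i)"
    using assms(1,3) unfolding quantum_generating_function_def by blast
  have c: "cf D k (c i) = (if D = 0 then fps_nth (S [i] x) k * h ^ k else 0)" for D k i
    by (simp add: c_def phi_def coef_def cf_def)
  have bp: "base_point c = y"
    using c[of 0 0] y(2) by (simp add: base_point_def cf_def vec_eq_iff)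
  \<comment> \<open>Linear coefficients carry no power of t, and in t-degree 0 the term of order
    \<epsilon>^0 is the real point that is subtracted.\<close>
  have inf: "infinitesimal_disp c"
    unfolding infinitesimal_disp_def disp_def bp
    using c y(2) by (simp add: cf_def cst_def)
  have base: "base_point c \<in> V" using bp y(1) by simp
  interpret graded_amplitude CF EV u
  proof
    show "CF as = CF bs" if "mset as = mset bs" for as bs
    proof -
      have "S as x = S bs x" using assms(1,3) that unfolding quantum_generating_function_def by blast
      then show ?thesis using mset_eq_length[OF that] by (simp add: CF_def coef_def)
    qed
    show "EV as = EV bs" if "mset as = mset bs" for as bs
      unfolding EV_def by (rule eval_at_partials_mset_eq[OF V base assms(2) that])
    show "t_order_ge (length as) (CF as)" if "length as \<ge> 2" for as
      using that by (simp add: t_order_ge_def cf_def CF_def coef_def fps_X_power_mult_nth)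
  qed
  define s where "s = formal_sum config_term configurations"
  have s: "has_formal_sum config_term s configurations"
    unfolding s_def by (rule formal_summable_imp[OF formal_summable_config_term])
  have lab: "has_formal_sum labelled_term s all_graphs"
    by (rule has_formal_sum_labelled_term[OF s])

  have pull: "quantum_pullback h S (\<lambda>y. exp (\<i> / h * g y)) x = s"
  proof -
    define Ev where "Ev bs = eval_at (partials bs (\<lambda>y. exp (u * g y))) c" for bs
    have "eval_at (partials bs (\<lambda>y. g y ^ m)) c = leibniz_sum m bs" for bs m
      unfolding leibniz_sum_def EV_def
      by (rule eval_at_partials_power[OF V inf base assms(2)]) (simp_all add: white_labels_def)
    then have "has_formal_sum (\<lambda>m. cst (u ^ m / fact m) * leibniz_sum m bs) (Ev bs) UNIV" for bs
      using eval_at_partials_exp[OF V inf base assms(2), of u bs] by (simp add: Ev_def)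
    from config_sum_eq_pullback[OF s this]
    have "formal_exp (cst u * CF []) *
      formal_sum (\<lambda>ass. index_term ass * Ev (concat ass)) {ass. \<forall>as\<in>set ass. length as \<ge> 2} = s" .
    \<comment> \<open>Fourier inversion yields one factor 1/u for each index.\<close>
    moreover have "cst (u ^ length ass / fact (length ass)) * (\<Prod>as\<leftarrow>ass. CF as) *
        fourier_integral h c (concat ass) (\<lambda>y. exp (u * g y)) = index_term ass * Ev (concat ass)" for ass
      unfolding fourier_integral_def index_term_def Ev_def cst_mult u(2)[symmetric] by (simp only: ac_simps)
    ultimately show ?thesis
      unfolding quantum_pullback_def u_def[symmetric] c_def[symmetric] CF_def[symmetric] by simp
  qed

  have gt: "graph_term h S g x G = cst (1 / of_nat (card (sym_group G))) * wt (verts G) (edges G)" for G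
  proof -
    have "graph_value h S g G x = cst (multiplicity_factor (pos (verts G)) (neg (verts G)) (edges G)) *
        amp (pos (verts G)) (neg (verts G)) (edge_list G)"
    proof -
      have "(\<Prod>v\<in>blacks G. cst (vertex_factor G v)) = cst (multiplicity_factor (pos (verts G)) (neg (verts G)) (edges G))"
        unfolding prod_vertex_factor[symmetric] cst_prod ..
      moreover have "size (edges G) = length (edge_list G)" by (metis mset_edge_list size_mset)
      ultimately show ?thesis
        unfolding graph_value_def amp_def blacks_eq_pos[symmetric] whites_eq_neg[symmetric] indices_at_eq
          prod.distrib CF_def[symmetric] c_def[symmetric] EV_def[symmetric] sum_distrib_left
        by (simp only: mult.assoc)
    qed
    moreover have "(h / \<i>) powi euler_exponent G = u ^ card (verts G) * inverse u ^ size (edges G)"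
    proof -
      have "inverse u \<noteq> 0" using u(1) by simp
      then show ?thesis
        unfolding u(2)[symmetric] euler_exponent_def power_int_diff[OF disjI1[OF \<open>inverse u \<noteq> 0\<close>]] power_int_of_nat
        by (simp only: divide_inverse power_inverse inverse_inverse_eq mult.commute)
    qed
    ultimately show ?thesis
      unfolding graph_term_def wt_eq_amp[OF mset_edge_list] by (simp only: cst_mult ac_simps)
  qed
  \<comment> \<open>The Betti exponent exceeds the Euler exponent by one; the resulting factor 1/u
    is cancelled by the prefactor u in the exponent of the theorem.\<close>
  have ct: "connected_term h S g x G = cst (inverse u) * graph_term h S g x G" for G
  proof -
    have "betti G = euler_exponent G + 1" by (simp add: betti_def euler_exponent_def)
    then have "(h / \<i>) powi betti G = inverse u * (h / \<i>) powi euler_exponent G"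
      unfolding u(2)[symmetric] using u(1) by (simp only: power_int_add_1' inverse_nonzero_iff_nonzero not_False_eq_True simp_thms)
    then show ?thesis
      unfolding connected_term_def graph_term_def by (simp only: cst_mult ac_simps)
  qed

  have all: "has_formal_sum (\<lambda>C. graph_term h S g x (rep C)) s (all_graphs // graph_iso)"
    unfolding gt by (rule has_formal_sum_classes[OF lab order_refl all_graphs_iso])
  define F where "F = formal_sum labelled_term connected_graphs"
  have sub: "connected_graphs \<subseteq> all_graphs" by (auto simp: connected_graphs_def)
  have F: "has_formal_sum labelled_term F connected_graphs"
    unfolding F_def by (rule formal_summable_imp[OF formal_summable_subset[OF has_formal_sum_imp(1)[OF lab] sub]])
  have "has_formal_sum (\<lambda>C. graph_term h S g x (rep C)) F (connected_graphs // graph_iso)"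
    unfolding gt by (rule has_formal_sum_classes[OF F sub connected_graphs_iso])
  from has_formal_sum_mult[OF this, of "cst (inverse u)"]
  have conn: "has_formal_sum (\<lambda>C. connected_term h S g x (rep C)) (cst (inverse u) * F) (connected_graphs // graph_iso)"
    unfolding ct .
  have cancel: "cst (\<i> / h) * (cst (inverse u) * F) = F"
    unfolding u_def[symmetric] cst_mult_assoc using u(1) by simp
  have exp: "formal_exp F = s"
    unfolding F_def by (rule exponential_formula[OF lab])
  show ?thesis
    unfolding has_formal_sum_imp(2)[OF conn] has_formal_sum_imp(2)[OF all] pull cancel exp
    using has_formal_sum_imp(1)[OF conn] has_formal_sum_imp(1)[OF all] by blast
qed

end
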